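(* Let $m\ge0$, $\mathbf x=(x_1,\dots,x_{m+1})$, $\mathbf y=(y_1,\dots,y_{m+1})$, $\mathbf x'=(x_1,\dots,x_m)$, $\mathbf y'=(y_1,\dots,y_m)$. Then \[ Z^{(+)}_{\mathrm{HT}}(2m+1;\mathbf x,\mathbf y)=\frac{(a+\bar a)Z(m+1;\mathbf x,\mathbf y)Z^{(2)}_{\mathrm{HT}}(2m;\mathbf x',\mathbf y')-(x_{m+1}\bar y_{m+1}+\bar x_{m+1}y_{m+1})Z(m;\mathbf x',\mathbf y')Z^{(2)}_{\mathrm{HT}}(2m+2;\mathbf x,\mathbf y)}{\sigma(a)\,\sigma(a x_{m+1}\bar y_{m+1})\,\sigma(a\bar x_{m+1}y_{m+1})}, \] \[ Z^{(-)}_{\mathrm{HT}}(2m+1;\mathbf x,\mathbf y)=\frac{-(x_{m+1}\bar y_{m+1}+\bar x_{m+1}y_{m+1})Z(m+1;\mathbf x,\mathbf y)Z^{(2)}_{\mathrm{HT}}(2m;\mathbf x',\mathbf y')+(a+\bar a)Z(m;\mathbf x',\mathbf y')Z^{(2)}_{\mathrm{HT}}(2m+2;\mathbf x,\mathbf y)}{\sigma(a)\,\sigma(a x_{m+1}\bar y_{m+1})\,\sigma(a\bar x_{m+1}y_{m+1})}. \]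
   Context: Notation: $\bar z=z^{-1}$, $\sigma(z)=z-z^{-1}$; $a$ is a fixed (generic) nonzero complex parameter. Vertex weights: at a vertex where a horizontal and a vertical line cross, the four incident edges are oriented with exactly two pointing into the vertex (ice rule). Type 1: both horizontal edges point in, both vertical out; type 2: horizontal out, vertical in; type 3: horizontal edges point right, vertical up; type 4: horizontal left, vertical down; type 5: horizontal left, vertical up; type 6: horizontal right, vertical down. A vertex with spectral parameter $z$ has weight $\sigma(a^2)$ (types 1,2), $\sigma(az)$ (types 3,4), $\sigma(a\bar z)$ (types 5,6). A state is an orientation of all internal edges obeying the ice rule at every vertex; its weight is the product of the vertex weights; a partition function is the sum of weights of states. Domain-wall model: $Z(n;\mathbf x,\mathbf y)$ ($\mathbf x,\mathbf y$ of length $n$) is the partition function on the $n\times n$ grid of vertices $(i,j)$ (row $i$ from the top, column $j$ from the left), vertex $(i,j)$ having parameter $x_i\bar y_j$; horizontal boundary edges point into the grid, vertical boundary edges point out of it. $Z(0)=1$. Even half-turn model: for $\mathbf x,\mathbf y$ of length $m$, $Z_{\mathrm{HT}}(2m;\mathbf x,\mathbf y)$ is the partition function on vertices $(r,j)$, $1\le r\le 2m$, $1\le j\le m$, vertex $(r,j)$ having parameter $x_{\min(r,2m+1-r)}\bar y_j$; left boundary edges point right, top boundary edges up, bottom boundary edges down; for each $r\le m$ the edges to the right of $(r,m)$ and of $(2m+1-r,m)$ form one single edge (U-turn) with one orientation. $Z_{\mathrm{HT}}(0)=1$, and $Z^{(2)}_{\mathrm{HT}}(2m;\mathbf x,\mathbf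 y):=Z_{\mathrm{HT}}(2m;\mathbf x,\mathbf y)/Z(m;\mathbf x,\mathbf y)$. Odd half-turn model: for $\mathbf x,\mathbf y$ of length $m+1$, the vertices are $(r,j)$ with $1\le r\le 2m+1$, $1\le j\le m$, and $(r,m+1)$ with $m+2\le r\le 2m+1$; vertex $(r,j)$ has parameter $x_{\min(r,2m+2-r)}\bar y_j$. Edges join consecutive vertices in rows and columns. Left boundary edges point right, top boundary edges of columns $1..m$ point up, bottom boundary edges of columns $1..m+1$ point down. The edge right of $(m+1,m)$ and the edge above $(m+2,m+1)$ form one single edge, pointing right out of $(m+1,m)$ iff pointing down into $(m+2,m+1)$. For each $r\le m$, the edges right of $(r,m)$ and right of $(2m+2-r,m+1)$ form one single edge with one orientation. States correspond bijectively to $(2m+1)\times(2m+1)$ half-turn symmetric alternating-sign matrices (vertex types 1, 2, others giving entries $1,-1,0$ in columns $1..m$ and in positions $(r,m+1)$, $r\ge m+2$); the central entry $(m+1,m+1)$ of the matrix is $1$ if the joined middle edge points out of $(m+1,m)$ and into $(m+2,m+1)$, and $-1$ otherwise. $Z^{(+)}_{\mathrm{HT}}(2m+1;\mathbf x,\mathbf y)$, resp. $Z^{(-)}_{\mathrm{HT}}(2m+1;\mathbf x,\mathbf y)$, is the sum of the weights of the states whose corresponding matrix has central entry $1$, resp. $-1$ (for $m=0$: $Z^{(+)}_{\mathrm{HT}}(1)=1$, $Z^{(-)}_{\mathrm{HT}}(1)=0$). *)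

theory Defs
  imports Complex_Main
begin

definition sigma :: "complex \<Rightarrow> complex" where
  "sigma z = z - inverse z"

(* Orientation of the four edges at a vertex:
   l = left edge points right, r = right edge points right,
   t = top edge points up,     b = bottom edge points up.
   Edges pointing INTO the vertex: left edge pointing right, right edge pointing left,
   top edge pointing down, bottom edge pointing up. *)
definition ice :: "bool \<Rightarrow> bool \<Rightarrow> bool \<Rightarrow> bool \<Rightarrow> bool" where
  "ice l r t b \<longleftrightarrow> of_bool l + of_bool (\<not> r) + of_bool (\<not> t) + of_bool b = (2::nat)"

definition vwt :: "complex \<Rightarrow> complex \<Rightarrow> bool \<Rightarrow> bool \<Rightarrow> bool \<Rightarrow> bool \<Rightarrow> complex" where
  "vwt a z l r t b =
     (if l \<and> \<not> r \<and> t \<and> \<not> b then sigma (a^2)            \<comment> \<open>type 1\<close>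
      else if \<not> l \<and> r \<and> \<not> t \<and> b then sigma (a^2)       \<comment> \<open>type 2\<close>
      else if l \<and> r \<and> t \<and> b then sigma (a * z)             \<comment> \<open>type 3\<close>
      else if \<not> l \<and> \<not> r \<and> \<not> t \<and> \<not> b then sigma (a * z) \<comment> \<open>type 4\<close>
      else if \<not> l \<and> \<not> r \<and> t \<and> b then sigma (a * inverse z)   \<comment> \<open>type 5\<close>
      else if l \<and> r \<and> \<not> t \<and> \<not> b then sigma (a * inverse z)   \<comment> \<open>type 6\<close>
      else 0)"

(* Generic partition function.  A state is given by a set H of internal horizontal
   edges pointing right (subset of HE) and a set V of internal vertical edges pointing
   up (subset of VE).  R H V i j says whether the edge to the right of vertex (i,j)
   points right (so the edge to the left of (i,j) is described by R H V i (j-1));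
   U H V i j says whether the edge above vertex (i,j) points up (so the edge below
   (i,j) is U H V (i+1) j).  Vtx is the set of vertices, z i j the spectral parameter
   of vertex (i,j), and P an extra restriction on the states summed over. *)
definition state_sum ::
  "complex \<Rightarrow> (nat \<times> nat) set \<Rightarrow> (nat \<times> nat) set \<Rightarrow> (nat \<times> nat) set \<Rightarrow>
   (nat \<Rightarrow> nat \<Rightarrow> complex) \<Rightarrow>
   ((nat \<times> nat) set \<Rightarrow> (nat \<times> nat) set \<Rightarrow> nat \<Rightarrow> nat \<Rightarrow> bool) \<Rightarrow>
   ((nat \<times> nat) set \<Rightarrow> (nat \<times> nat) set \<Rightarrow> nat \<Rightarrow> nat \<Rightarrow> bool) \<Rightarrow>
   ((nat \<times> nat) set \<Rightarrow> (nat \<times> nat) set \<Rightarrow> bool) \<Rightarrow> complex" where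
  "state_sum a Vtx HE VE z R U P =
     (\<Sum>H\<in>Pow HE. \<Sum>V\<in>Pow VE.
        if P H V \<and> (\<forall>(i,j)\<in>Vtx. ice (R H V i (j-1)) (R H V i j) (U H V i j) (U H V (i+1) j))
        then (\<Prod>(i,j)\<in>Vtx. vwt a (z i j) (R H V i (j-1)) (R H V i j) (U H V i j) (U H V (i+1) j))
        else 0)"

definition Zdw :: "complex \<Rightarrow> nat \<Rightarrow> (nat \<Rightarrow> complex) \<Rightarrow> (nat \<Rightarrow> complex) \<Rightarrow> complex" where
  "Zdw a n x y = state_sum a ({1..n} \<times> {1..n}) ({1..n} \<times> {1..<n}) ({2..n} \<times> {1..n})
     (\<lambda>i j. x i * inverse (y j))
     (\<lambda>H V i j. if j = 0 then True else if j = n then False else (i,j) \<in> H)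
     (\<lambda>H V i j. if i = 1 then True else if i = n+1 then False else (i,j) \<in> V)
     (\<lambda>H V. True)"

definition ZHT :: "complex \<Rightarrow> nat \<Rightarrow> (nat \<Rightarrow> complex) \<Rightarrow> (nat \<Rightarrow> complex) \<Rightarrow> complex" where
  "ZHT a m x y = state_sum a ({1..2*m} \<times> {1..m})
     ({1..2*m} \<times> {1..<m} \<union> {1..m} \<times> {m}) ({2..2*m} \<times> {1..m})
     (\<lambda>r j. x (min r (2*m+1-r)) * inverse (y j))
     (\<lambda>H V r j. if j = 0 then True
                else if j = m \<and> r > m then \<not> ((2*m+1-r, m) \<in> H)
                else (r,j) \<in> H)
     (\<lambda>H V r j. if r = 1 then True else if r = 2*m+1 then False else (r,j) \<in> V)
     (\<lambda>H V. True)"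

definition ZHT2 :: "complex \<Rightarrow> nat \<Rightarrow> (nat \<Rightarrow> complex) \<Rightarrow> (nat \<Rightarrow> complex) \<Rightarrow> complex" where
  "ZHT2 a m x y = ZHT a m x y / Zdw a m x y"

definition ZHTodd_gen :: "complex \<Rightarrow> nat \<Rightarrow> (nat \<Rightarrow> complex) \<Rightarrow> (nat \<Rightarrow> complex) \<Rightarrow>
    ((nat \<times> nat) set \<Rightarrow> (nat \<times> nat) set \<Rightarrow> bool) \<Rightarrow> complex" where
  "ZHTodd_gen a m x y P = state_sum a
     ({1..2*m+1} \<times> {1..m} \<union> {m+2..2*m+1} \<times> {m+1})
     ({1..2*m+1} \<times> {1..m})
     ({2..2*m+1} \<times> {1..m} \<union> {m+3..2*m+1} \<times> {m+1})
     (\<lambda>r j. x (min r (2*m+2-r)) * inverse (y j))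
     (\<lambda>H V r j. if j = 0 then True
                else if j = m+1 then \<not> ((2*m+2-r, m) \<in> H)
                else (r,j) \<in> H)
     (\<lambda>H V r j. if j = m+1 \<and> r = m+2 then \<not> ((m+1, m) \<in> H)
                else if r = 1 then True else if r = 2*m+2 then False else (r,j) \<in> V)
     P"

(* central entry +1: middle edge points right out of (m+1,m) *)
definition ZHTp :: "complex \<Rightarrow> nat \<Rightarrow> (nat \<Rightarrow> complex) \<Rightarrow> (nat \<Rightarrow> complex) \<Rightarrow> complex" where
  "ZHTp a m x y = (if m = 0 then 1 else ZHTodd_gen a m x y (\<lambda>H V. (m+1, m) \<in> H))"

definition ZHTm :: "complex \<Rightarrow> nat \<Rightarrow> (nat \<Rightarrow> complex) \<Rightarrow> (nat \<Rightarrow> complex) \<Rightarrow> complex" where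
  "ZHTm a m x y = (if m = 0 then 0 else ZHTodd_gen a m x y (\<lambda>H V. (m+1, m) \<notin> H))"

end

theory Submission
  imports Defs "HOL-Library.FuncSet" "HOL-Library.Multiset" "HOL-Computational_Algebra.Polynomial"
begin

text \<open>Rotating the lower half of a half-turn lattice by a half-turn and gluing it to the right of the
  upper half expresses all partition functions by one object: the partition function \<open>psi\<close> of a
  rectangle whose left and right edges point inwards, with prescribed vertical edges at top and bottom.

  Solved for \<open>P = Z(m+1) Z\<^sup>2(2m)\<close> and \<open>Q = Z(m) Z\<^sup>2(2m+2)\<close>, where \<open>Z\<^sup>2\<close> is the quotient
  \<open>ZHT2\<close>, the theorem reads \<open>P = sigma a (A Z\<^sup>+ + B Z\<^sup>-)\<close> and
  \<open>Q = sigma a (B Z\<^sup>+ + A Z\<^sup>-)\<close> with \<open>A = a + 1/a\<close> and \<open>B = x/y + y/x\<close> for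
  \<open>x = x (m+1)\<close>, \<open>y = y (m+1)\<close>.  These relations are proved by Lagrange interpolation in
  \<open>x (m+1)\<close> and induction on \<open>m\<close>, together with analogous relations for the even half-turn model
  whose innermost column has parameter \<open>u\<close> in its upper and \<open>v\<close> in its lower half.  At
  \<open>x (m+1) = y j * a\<close> and \<open>x (m+1) = y j / a\<close> a vertex degenerates, and the Yang-Baxter equation
  turns the odd model of size \<open>2m+1\<close> into the split even model of size \<open>2m\<close> with \<open>u = y j\<close>,
  \<open>v = y (m+1)\<close>.  In the same way the split model at \<open>u = x i * a\<close> or \<open>u = x i / a\<close> becomes the odd
  model of size \<open>2m-1\<close> in which \<open>x i\<close> belongs to the middle row.  The relation for \<open>P\<close> in the split
  model is trivial at \<open>u = v\<close>, and the one for \<open>Q\<close> in the odd model holds directly at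
  \<open>x (m+1) = y (m+1) * a\<close> and \<open>x (m+1) = y (m+1) / a\<close>; with these nodes the number of nodes exceeds the
  degree, except for \<open>P\<close> in the odd model with \<open>m = 0\<close>, a direct computation.
  Parameters for which nodes coincide are reached by continuity.\<close>

text \<open>Why the odd model alone does not close up under reduction: the middle row crosses each
  column parameter \<open>y j\<close> once, but \<open>y j\<close> belongs to two columns of the
  glued rectangle. A degenerate vertex in the middle row freezes one of these columns and joins the
  other to the row; pulled to the centre, the survivor stands next to the lone column
  \<open>y (m+1)\<close>. So a column with different parameters in its two halves is unavoidable,
  and the two families must be proved together. Rows and columns can be permuted only where certain
  crossing weights are nonzero, hence the genericity conditions. The interpolation variable itself
  stays arbitrary. All functions are, up to a power of the variable, polynomials in its square, so
  nodes count by their squares; those of \<open>z / a\<close> and \<open>a * z\<close> differ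
  exactly if \<open>a^4\<close> is not 1, which follows from \<open>Z(m+1)\<close> being nonzero.
  The two kinds of nodes are interchanged by inverting all parameters, that is, by a reflection.
  This preserves the odd relations, but swaps \<open>u\<close> and \<open>v\<close> in the split
  model, which one further crossing undoes.\<close>

definition bool_lists :: "nat \<Rightarrow> bool list set" where
  "bool_lists n = {bs. length bs = n}"

lemma finite_bool_lists [simp]: "finite (bool_lists n)"
  using finite_lists_length_eq[of "UNIV :: bool set" n] by (simp add: bool_lists_def)

lemma bool_lists_0 [simp]: "bool_lists 0 = {[]}"
  by (auto simp: bool_lists_def)

lemma replicate_in_bool_lists [simp]: "replicate n b \<in> bool_lists n"
  by (simp add: bool_lists_def)

lemma sum_bool_lists_append:
  "(\<Sum>bs\<in>bool_lists (m + n). f bs) = (\<Sum>as\<in>bool_lists m. \<Sum>bs\<in>bool_lists n. f (as @ bs))"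
proof -
  have "bij_betw (\<lambda>(as, bs). as @ bs) (bool_lists m \<times> bool_lists n) (bool_lists (m + n))"
    by (rule bij_betwI[where g = "\<lambda>bs. (take m bs, drop m bs)"]) (auto simp: bool_lists_def)
  from sum.reindex_bij_betw[OF this, of f]
  show ?thesis by (simp add: sum.cartesian_product case_prod_unfold)
qed

lemma sum_bool_lists_Suc:
  "(\<Sum>bs\<in>bool_lists (Suc n). f bs) = (\<Sum>b\<in>UNIV. \<Sum>bs\<in>bool_lists n. f (b # bs))"
proof -
  have "bij_betw (\<lambda>(b, bs). b # bs) (UNIV \<times> bool_lists n) (bool_lists (Suc n))"
    by (rule bij_betwI[where g = "\<lambda>bs. (hd bs, tl bs)"])
      (auto simp: bool_lists_def length_Suc_conv)
  from sum.reindex_bij_betw[OF this, of f]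
  show ?thesis by (simp add: sum.cartesian_product case_prod_unfold)
qed

lemma sum_bool_lists_rev:
  "(\<Sum>bs\<in>bool_lists n. f (rev bs)) = (\<Sum>bs\<in>bool_lists n. f bs)"
  by (rule sum.reindex_bij_witness[where i = rev and j = rev]) (auto simp: bool_lists_def)

lemma sum_bool_lists_Not:
  "(\<Sum>bs\<in>bool_lists n. f (map Not bs)) = (\<Sum>bs\<in>bool_lists n. f bs)"
  by (rule sum.reindex_bij_witness[where i = "map Not" and j = "map Not"])
    (auto simp: bool_lists_def comp_def)

lemma sum_bool_lists_delta:
  fixes f :: "bool list \<Rightarrow> 'b::semiring_1"
  assumes "cs \<in> bool_lists n"
  shows "(\<Sum>bs\<in>bool_lists n. of_bool (bs = cs) * f bs) = f cs"
    and "(\<Sum>bs\<in>bool_lists n. of_bool (cs = bs) * f bs) = f cs"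
  using assms by (simp_all add: of_bool_def if_distrib[of "\<lambda>c. c * _"] sum.delta sum.delta' cong: if_cong)

subsection \<open>The lattice as an iterated row sum\<close>

locale six_vertex =
  fixes a :: complex
  assumes a_nonzero: "a \<noteq> 0"
begin

text \<open>A half-turn fixes types 1 and 2 and swaps 3 with 4 and 5 with 6, pairs of equal weight,
  so the parameter stays.\<close>

lemma vwt_rotate: "vwt a z (\<not> r) (\<not> l) (\<not> b) (\<not> t) = vwt a z l r t b"
  by (cases l; cases r; cases t; cases b) (simp_all add: vwt_def)

text \<open>Reflection in the vertical axis swaps type 3 with 5 and 4 with 6, which inverts the
  parameter.\<close>

lemma vwt_flip: "vwt a (inverse z) (\<not> r) (\<not> l) t b = vwt a z l r t b"
  by (cases l; cases r; cases t; cases b) (simp_all add: vwt_def)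

lemma vwt_flip': "vwt a (inverse z) l r (\<not> b) (\<not> t) = vwt a z l r t b"
  by (cases l; cases r; cases t; cases b) (simp_all add: vwt_def)

lemma ice_vwt: "\<not> ice l r t b \<Longrightarrow> vwt a z l r t b = 0"
  by (cases l; cases r; cases t; cases b) (simp_all add: vwt_def ice_def)

text \<open>Horizontal edges are \<^const>\<open>True\<close> if they point right, vertical ones if they point up; \<open>l\<close>,
  \<open>r\<close>, \<open>ts\<close>, \<open>bs\<close> are the edges at the left, right, top and bottom.  Lists of the wrong length give 0.\<close>

fun row :: "complex \<Rightarrow> complex list \<Rightarrow> bool \<Rightarrow> bool \<Rightarrow> bool list \<Rightarrow> bool list \<Rightarrow> complex" where
  "row x [] l r [] [] = of_bool (l = r)"
| "row x (y # ys) l r (t # ts) (b # bs) =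
     (\<Sum>k\<in>UNIV. vwt a (x * inverse y) l k t b * row x ys k r ts bs)"
| "row x _ l r _ _ = 0"

fun grid :: "complex list \<Rightarrow> complex list \<Rightarrow> bool list \<Rightarrow> bool list \<Rightarrow> bool list \<Rightarrow> bool list
    \<Rightarrow> complex" where
  "grid [] ys [] [] ts bs = of_bool (ts = bs)"
| "grid (x # xs) ys (l # ls) (r # rs) ts bs =
     (\<Sum>qs\<in>bool_lists (length ys). row x ys l r ts qs * grid xs ys ls rs qs bs)"
| "grid _ ys _ _ ts bs = 0"

lemma row_append:
  assumes "length ts1 = length ys1" "length bs1 = length ys1"
  shows "row x (ys1 @ ys2) l r (ts1 @ ts2) (bs1 @ bs2) =
    (\<Sum>k\<in>UNIV. row x ys1 l k ts1 bs1 * row x ys2 k r ts2 bs2)"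
  using assms
proof (induction ys1 arbitrary: ts1 bs1 l)
  case Nil
  then show ?case by (simp add: UNIV_bool of_bool_def)
next
  case (Cons y ys1)
  then obtain t ts b bs where [simp]: "ts1 = t # ts" "bs1 = b # bs"
    by (auto simp: length_Suc_conv)
  show ?case using Cons
    by (simp add: UNIV_bool algebra_simps)
qed

lemma row_rotate:
  assumes "length ts = length ys" "length bs = length ys"
  shows "row x (rev ys) (\<not> r) (\<not> l) (rev (map Not bs)) (rev (map Not ts)) = row x ys l r ts bs"
  using assms
proof (induction ys arbitrary: ts bs l)
  case Nil
  then show ?case by auto
next
  case (Cons y ys)
  then obtain t ts' b bs' where [simp]: "ts = t # ts'" "bs = b # bs'"
    by (auto simp: length_Suc_conv)
  have "row x (rev (y # ys)) (\<not> r) (\<not> l) (rev (map Not bs)) (rev (map Not ts)) =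
    (\<Sum>k\<in>UNIV. row x (rev ys) (\<not> r) (\<not> k) (rev (map Not bs')) (rev (map Not ts'))
       * vwt a (x * inverse y) (\<not> k) (\<not> l) (\<not> b) (\<not> t))"
    using Cons.prems by (simp add: row_append UNIV_bool)
  then show ?case using Cons.prems
    by (simp add: Cons.IH vwt_rotate mult.commute)
qed

lemma row_flip:
  assumes "length ts = length ys" "length bs = length ys"
  shows "row (inverse x) (rev (map inverse ys)) (\<not> r) (\<not> l) (rev ts) (rev bs) = row x ys l r ts bs"
  using assms
proof (induction ys arbitrary: ts bs l)
  case Nil
  then show ?case by auto
next
  case (Cons y ys)
  then obtain t ts' b bs' where [simp]: "ts = t # ts'" "bs = b # bs'"
    by (auto simp: length_Suc_conv)
  have "row (inverse x) (rev (map inverse (y # ys))) (\<not> r) (\<not> l) (rev ts) (rev bs) =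
    (\<Sum>k\<in>UNIV. row (inverse x) (rev (map inverse ys)) (\<not> r) (\<not> k) (rev ts') (rev bs')
       * vwt a (inverse (x * inverse y)) (\<not> k) (\<not> l) t b)"
    using Cons.prems by (simp add: row_append UNIV_bool)
  then show ?case using Cons.prems
    by (simp only: vwt_flip) (simp add: Cons.IH mult.commute)
qed

text \<open>This reflection in the horizontal axis keeps the ends \<open>l\<close> and
  \<open>r\<close>, as is needed for a middle row whose right end is the middle edge.\<close>

lemma row_flip_vertical:
  assumes "length ts = length ys" "length bs = length ys"
  shows "row (inverse x) (map inverse ys) l r (map Not bs) (map Not ts) = row x ys l r ts bs"
  using assms
proof (induction ys arbitrary: ts bs l)
  case Nil
  then show ?case by auto
next
  case (Cons y ys)
  then obtain t ts' b bs' where [simp]: "ts = t # ts'" "bs = b # bs'"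
    by (auto simp: length_Suc_conv)
  have "inverse x * inverse (inverse y) = inverse (x * inverse y)" by simp
  then show ?case using Cons.prems
    by (simp only: row.simps list.map \<open>ts = _\<close> \<open>bs = _\<close> vwt_flip') (simp add: Cons.IH)
qed

lemma grid_vertical_append:
  assumes "length ls1 = length xs1" "length rs1 = length xs1" "length ts = length ys"
  shows "grid (xs1 @ xs2) ys (ls1 @ ls2) (rs1 @ rs2) ts bs =
    (\<Sum>qs\<in>bool_lists (length ys). grid xs1 ys ls1 rs1 ts qs * grid xs2 ys ls2 rs2 qs bs)"
  using assms
proof (induction xs1 arbitrary: ls1 rs1 ts)
  case Nil
  then show ?case using sum_bool_lists_delta(2)[of ts "length ys" "\<lambda>qs. grid xs2 ys ls2 rs2 qs bs"]
    by (simp add: bool_lists_def)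
next
  case (Cons x xs1)
  then obtain l ls r rs where [simp]: "ls1 = l # ls" "rs1 = r # rs"
    by (auto simp: length_Suc_conv)
  have "grid ((x # xs1) @ xs2) ys (ls1 @ ls2) (rs1 @ rs2) ts bs =
    (\<Sum>ps\<in>bool_lists (length ys). row x ys l r ts ps *
      (\<Sum>qs\<in>bool_lists (length ys). grid xs1 ys ls rs ps qs * grid xs2 ys ls2 rs2 qs bs))"
    using Cons by (auto intro!: sum.cong simp: bool_lists_def)
  also have "\<dots> = (\<Sum>qs\<in>bool_lists (length ys). \<Sum>ps\<in>bool_lists (length ys).
      row x ys l r ts ps * grid xs1 ys ls rs ps qs * grid xs2 ys ls2 rs2 qs bs)"
    by (subst sum.swap) (simp add: sum_distrib_left mult.assoc)
  finally show ?case by (simp add: sum_distrib_right)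
qed

lemma grid_single: "length bs = length ys \<Longrightarrow> grid [x] ys [l] [r] ts bs = row x ys l r ts bs"
  using sum_bool_lists_delta(1)[of bs "length ys" "\<lambda>qs. row x ys l r ts qs"]
  by (simp add: mult.commute bool_lists_def)

lemma grid_horizontal_append:
  assumes "length ls = length xs" "length rs = length xs"
    and "length ts1 = length ys1" "length bs1 = length ys1"
    and "length ts2 = length ys2" "length bs2 = length ys2"
  shows "grid xs (ys1 @ ys2) ls rs (ts1 @ ts2) (bs1 @ bs2) =
    (\<Sum>ks\<in>bool_lists (length xs). grid xs ys1 ls ks ts1 bs1 * grid xs ys2 ks rs ts2 bs2)"
  using assms
proof (induction xs arbitrary: ls rs ts1 ts2)
  case Nil
  then show ?case by simp
next
  case (Cons x xs)
  then obtain l ls' r rs' where [simp]: "ls = l # ls'" "rs = r # rs'"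
    by (auto simp: length_Suc_conv)
  let ?B = "\<lambda>zs. bool_lists (length (zs :: complex list))"
  have "grid (x # xs) (ys1 @ ys2) ls rs (ts1 @ ts2) (bs1 @ bs2) =
    (\<Sum>q1\<in>?B ys1. \<Sum>q2\<in>?B ys2. row x (ys1 @ ys2) l r (ts1 @ ts2) (q1 @ q2) *
       grid xs (ys1 @ ys2) ls' rs' (q1 @ q2) (bs1 @ bs2))"
    by (simp add: sum_bool_lists_append)
  also have "\<dots> = (\<Sum>q1\<in>?B ys1. \<Sum>q2\<in>?B ys2.
      (\<Sum>k\<in>UNIV. row x ys1 l k ts1 q1 * row x ys2 k r ts2 q2) *
      (\<Sum>ks\<in>?B xs. grid xs ys1 ls' ks q1 bs1 * grid xs ys2 ks rs' q2 bs2))"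
    using Cons.prems
    by (intro sum.cong refl) (simp add: row_append Cons.IH bool_lists_def)
  also have "\<dots> = (\<Sum>q1\<in>?B ys1. \<Sum>q2\<in>?B ys2. \<Sum>k\<in>UNIV. \<Sum>ks\<in>?B xs.
      (row x ys1 l k ts1 q1 * grid xs ys1 ls' ks q1 bs1) *
      (row x ys2 k r ts2 q2 * grid xs ys2 ks rs' q2 bs2))"
    by (simp add: sum_product algebra_simps)
  also have "\<dots> = (\<Sum>k\<in>UNIV. \<Sum>ks\<in>?B xs. \<Sum>q1\<in>?B ys1. \<Sum>q2\<in>?B ys2.
      (row x ys1 l k ts1 q1 * grid xs ys1 ls' ks q1 bs1) *
      (row x ys2 k r ts2 q2 * grid xs ys2 ks rs' q2 bs2))"
    by (subst (2) sum.swap, subst (3) sum.swap, subst sum.swap, subst (2) sum.swap) (rule refl)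
  also have "\<dots> = (\<Sum>k\<in>UNIV. \<Sum>ks\<in>?B xs.
      (\<Sum>q1\<in>?B ys1. row x ys1 l k ts1 q1 * grid xs ys1 ls' ks q1 bs1) *
      (\<Sum>q2\<in>?B ys2. row x ys2 k r ts2 q2 * grid xs ys2 ks rs' q2 bs2))"
    by (simp add: sum_product)
  finally show ?case by (simp add: sum_bool_lists_Suc)
qed

lemma grid_rotate:
  assumes "length ls = length xs" "length rs = length xs"
    and "length ts = length ys" "length bs = length ys"
  shows "grid (rev xs) (rev ys) (rev (map Not rs)) (rev (map Not ls)) (rev (map Not bs))
    (rev (map Not ts)) = grid xs ys ls rs ts bs"
  using assms
proof (induction xs arbitrary: ls rs ts)
  case Nil
  then show ?case by (auto simp: inj_map_eq_map inj_def)
next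
  case (Cons x xs)
  then obtain l ls' r rs' where [simp]: "ls = l # ls'" "rs = r # rs'"
    by (auto simp: length_Suc_conv)
  have "grid (rev (x # xs)) (rev ys) (rev (map Not rs)) (rev (map Not ls)) (rev (map Not bs))
    (rev (map Not ts)) = (\<Sum>qs\<in>bool_lists (length ys).
      grid (rev xs) (rev ys) (rev (map Not rs')) (rev (map Not ls')) (rev (map Not bs)) qs *
      row x (rev ys) (\<not> r) (\<not> l) qs (rev (map Not ts)))"
    using Cons.prems by (simp add: grid_vertical_append grid_single del: grid.simps)
  also have "\<dots> = (\<Sum>qs\<in>bool_lists (length ys).
      grid (rev xs) (rev ys) (rev (map Not rs')) (rev (map Not ls')) (rev (map Not bs))
        (rev (map Not qs)) *
      row x (rev ys) (\<not> r) (\<not> l) (rev (map Not qs)) (rev (map Not ts)))"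
    by (rule sum.reindex_bij_witness[where i = "\<lambda>qs. rev (map Not qs)"
          and j = "\<lambda>qs. rev (map Not qs)"])
      (auto simp: bool_lists_def rev_map comp_def)
  also have "\<dots> = (\<Sum>qs\<in>bool_lists (length ys). row x ys l r ts qs * grid xs ys ls' rs' qs bs)"
    using Cons.prems by (intro sum.cong refl) (simp add: Cons.IH row_rotate bool_lists_def)
  finally show ?case by simp
qed

definition psi :: "complex list \<Rightarrow> complex list \<Rightarrow> bool list \<Rightarrow> bool list \<Rightarrow> complex" where
  "psi xs ys ts bs = grid xs ys (replicate (length xs) True) (replicate (length xs) False) ts bs"

lemma psi_Nil [simp]: "psi [] ys ts bs = of_bool (ts = bs)"
  by (simp add: psi_def)

lemma psi_Cons:
  "psi (x # xs) ys ts bs =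
    (\<Sum>qs\<in>bool_lists (length ys). row x ys True False ts qs * psi xs ys qs bs)"
  by (simp add: psi_def)

lemma psi_append:
  "length ts = length ys \<Longrightarrow>
    psi (xs1 @ xs2) ys ts bs = (\<Sum>qs\<in>bool_lists (length ys). psi xs1 ys ts qs * psi xs2 ys qs bs)"
  by (simp add: psi_def replicate_add grid_vertical_append)

lemma psi_rotate:
  assumes "length ts = length ys" "length bs = length ys"
  shows "psi (rev xs) (rev ys) (rev (map Not bs)) (rev (map Not ts)) = psi xs ys ts bs"
  using grid_rotate[of "replicate (length xs) True" xs "replicate (length xs) False" ts ys bs] assms
  by (simp add: psi_def)

text \<open>Horizontal edges pointing inwards on both sides still do so after a reflection in the
  vertical axis. The order of the rows is kept, that of the columns reversed.\<close>

lemma psi_flip: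
  assumes "length ts = length ys" "length bs = length ys"
  shows "psi (map inverse xs) (rev (map inverse ys)) (rev ts) (rev bs) = psi xs ys ts bs"
  using assms
proof (induction xs arbitrary: ts)
  case Nil
  then show ?case by simp
next
  case (Cons x xs)
  have "psi (map inverse (x # xs)) (rev (map inverse ys)) (rev ts) (rev bs) =
    (\<Sum>qs\<in>bool_lists (length ys). row (inverse x) (rev (map inverse ys)) True False (rev ts) (rev qs)
       * psi (map inverse xs) (rev (map inverse ys)) (rev qs) (rev bs))"
    unfolding list.map psi_Cons length_rev length_map
    by (rule sum_bool_lists_rev[symmetric])
  then show ?case using Cons row_flip[of ts ys _ x False True]
    unfolding psi_Cons by (auto intro!: sum.cong simp: bool_lists_def)
qed

end

subsection \<open>The Yang-Baxter equation\<close>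

lemma sum_bool_lists_pair:
  "(\<Sum>qs\<in>bool_lists (Suc (Suc (m + n))). f qs) =
    (\<Sum>pa\<in>bool_lists m. \<Sum>pb\<in>bool_lists n. \<Sum>q1\<in>UNIV. \<Sum>q2\<in>UNIV. f (pa @ q1 # q2 # pb))"
  using sum_bool_lists_append[of f m "Suc (Suc n)"]
  by (simp add: sum_bool_lists_Suc UNIV_bool sum.distrib)

context six_vertex
begin

text \<open>A vertex rotated by 45 degrees at which the columns \<open>u\<close> and \<open>v\<close> cross; \<open>p\<close>, \<open>q\<close> are the
  edges above and \<open>p'\<close>, \<open>q'\<close> the edges below.\<close>

definition cross :: "complex \<Rightarrow> complex \<Rightarrow> bool \<Rightarrow> bool \<Rightarrow> bool \<Rightarrow> bool \<Rightarrow> complex" where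
  "cross u v p q p' q' = vwt a (u * inverse a * inverse v) (\<not> p) (\<not> q') q p'"

text \<open>In \<open>cross\<close> the column \<open>u\<close> counts as a row of parameter
  \<open>u * inverse a\<close> passing the column \<open>v\<close>; an edge pointing up at the upper
  left then points left, hence the negations. With this shift the three vertices satisfy the
  Yang-Baxter equation, checked for each of the 64 boundary orientations.\<close>

lemma yang_baxter_columns:
  assumes "x \<noteq> 0" "u \<noteq> 0" "v \<noteq> 0"
  shows "(\<Sum>q1\<in>UNIV. \<Sum>q2\<in>UNIV. (\<Sum>k\<in>UNIV. vwt a (x * inverse u) l k t1 q1 *
            vwt a (x * inverse v) k r t2 q2) * cross u v q1 q2 p1 p2) =
         (\<Sum>s1\<in>UNIV. \<Sum>s2\<in>UNIV. cross u v t1 t2 s1 s2 * (\<Sum>k\<in>UNIV. vwt a (x * inverse v) l k s1 p1 *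
            vwt a (x * inverse u) k r s2 p2))"
  using assms a_nonzero
  by (cases l; cases r; cases t1; cases t2; cases p1; cases p2)
    (simp add: UNIV_bool cross_def vwt_def sigma_def; simp add: divide_simps; algebra?)+

text \<open>Dual to \<open>cross\<close>: the row \<open>x2\<close> counts as a column of parameter
  \<open>a * x2\<close>, running from the upper left \<open>l1\<close> to the lower right
  \<open>k2\<close>, while \<open>x1\<close> runs from the lower left \<open>l2\<close> to the upper
  right \<open>k1\<close>.\<close>

definition cross_rows :: "complex \<Rightarrow> complex \<Rightarrow> bool \<Rightarrow> bool \<Rightarrow> bool \<Rightarrow> bool \<Rightarrow> complex" where
  "cross_rows x1 x2 l1 l2 k1 k2 = vwt a (x1 * inverse x2 * inverse a) l2 k1 (\<not> l1) (\<not> k2)"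

lemma yang_baxter_rows:
  assumes "y \<noteq> 0" "x1 \<noteq> 0" "x2 \<noteq> 0"
  shows "(\<Sum>k1\<in>UNIV. \<Sum>k2\<in>UNIV. cross_rows x1 x2 l1 l2 k1 k2 *
           (\<Sum>q\<in>UNIV. vwt a (x1 * inverse y) k1 r1 t q * vwt a (x2 * inverse y) k2 r2 q b)) =
         (\<Sum>k1\<in>UNIV. \<Sum>k2\<in>UNIV. (\<Sum>q\<in>UNIV. vwt a (x2 * inverse y) l1 k1 t q *
            vwt a (x1 * inverse y) l2 k2 q b) * cross_rows x1 x2 k1 k2 r1 r2)"
  using assms a_nonzero
  by (cases l1; cases l2; cases r1; cases r2; cases t; cases b)
    (simp add: UNIV_bool cross_rows_def vwt_def sigma_def; simp add: divide_simps; algebra?)+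

text \<open>Only the two vertices in the columns \<open>u\<close> and \<open>v\<close> take part;
  the pieces of the row on either side of them are constant factors.\<close>

lemma row_exchange:
  assumes "x \<noteq> 0" "u \<noteq> 0" "v \<noteq> 0" "length ta = length as" "length pa = length as"
  shows "(\<Sum>q1\<in>UNIV. \<Sum>q2\<in>UNIV.
      row x (as @ u # v # bs) l r (ta @ t1 # t2 # tb) (pa @ q1 # q2 # pb) * cross u v q1 q2 p1 p2) =
    (\<Sum>s1\<in>UNIV. \<Sum>s2\<in>UNIV. cross u v t1 t2 s1 s2 *
      row x (as @ v # u # bs) l r (ta @ s1 # s2 # tb) (pa @ p1 # p2 # pb))"
    (is "?L = ?R")
proof -
  let ?A = "\<lambda>k. row x as l k ta pa" and ?B = "\<lambda>k. row x bs k r tb pb"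
  have "?L = (\<Sum>k\<in>UNIV. \<Sum>k'\<in>UNIV. ?A k * ?B k' *
      (\<Sum>q1\<in>UNIV. \<Sum>q2\<in>UNIV. (\<Sum>j\<in>UNIV. vwt a (x * inverse u) k j t1 q1 *
            vwt a (x * inverse v) j k' t2 q2) * cross u v q1 q2 p1 p2))"
    using assms(4,5) by (simp add: row_append UNIV_bool algebra_simps)
  also have "\<dots> = (\<Sum>k\<in>UNIV. \<Sum>k'\<in>UNIV. ?A k * ?B k' *
      (\<Sum>s1\<in>UNIV. \<Sum>s2\<in>UNIV. cross u v t1 t2 s1 s2 * (\<Sum>j\<in>UNIV. vwt a (x * inverse v) k j s1 p1 *
            vwt a (x * inverse u) j k' s2 p2)))"
    by (simp only: yang_baxter_columns[OF assms(1-3)])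
  also have "\<dots> = ?R"
    using assms(4,5) by (simp add: row_append UNIV_bool algebra_simps)
  finally show ?thesis .
qed

text \<open>A crossing attached below the rectangle is pushed upwards through one row after another
  by \<open>row_exchange\<close>.\<close>

lemma psi_exchange:
  assumes "0 \<notin> set xs" "u \<noteq> 0" "v \<noteq> 0"
    and "length ta = length as" "length pa = length as"
    and "length tb = length bs" "length pb = length bs"
  shows "(\<Sum>q1\<in>UNIV. \<Sum>q2\<in>UNIV.
      psi xs (as @ u # v # bs) (ta @ t1 # t2 # tb) (pa @ q1 # q2 # pb) * cross u v q1 q2 p1 p2) =
    (\<Sum>s1\<in>UNIV. \<Sum>s2\<in>UNIV. cross u v t1 t2 s1 s2 *
      psi xs (as @ v # u # bs) (ta @ s1 # s2 # tb) (pa @ p1 # p2 # pb))"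
    (is "?L = ?R")
  using assms(1,4-)
proof (induction xs arbitrary: ta tb t1 t2)
  case Nil
  then show ?case
    by (auto simp: UNIV_bool simp del: sum_mult_of_bool_eq sum_of_bool_mult_eq)
next
  case (Cons x xs)
  let ?B = "\<lambda>zs. bool_lists (length (zs :: complex list))"
  let ?r = "\<lambda>ra r1 r2 rb. row x (as @ u # v # bs) True False (ta @ t1 # t2 # tb) (ra @ r1 # r2 # rb)"
  let ?r' = "\<lambda>s1 s2 ra r1 r2 rb. row x (as @ v # u # bs) True False (ta @ s1 # s2 # tb) (ra @ r1 # r2 # rb)"
  let ?p = "\<lambda>ra r1 r2 rb q1 q2. psi xs (as @ u # v # bs) (ra @ r1 # r2 # rb) (pa @ q1 # q2 # pb)"
  let ?p' = "\<lambda>ra r1 r2 rb. psi xs (as @ v # u # bs) (ra @ r1 # r2 # rb) (pa @ p1 # p2 # pb)"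
  have "(\<Sum>q1\<in>UNIV. \<Sum>q2\<in>UNIV.
      psi (x # xs) (as @ u # v # bs) (ta @ t1 # t2 # tb) (pa @ q1 # q2 # pb) * cross u v q1 q2 p1 p2) =
    (\<Sum>ra\<in>?B as. \<Sum>rb\<in>?B bs. \<Sum>r1\<in>UNIV. \<Sum>r2\<in>UNIV. ?r ra r1 r2 rb *
       (\<Sum>q1\<in>UNIV. \<Sum>q2\<in>UNIV. ?p ra r1 r2 rb q1 q2 * cross u v q1 q2 p1 p2))"
    by (simp add: psi_Cons sum_bool_lists_pair UNIV_bool sum.distrib sum_distrib_right
        sum_distrib_left distrib_left distrib_right mult.assoc add_ac)
  also have "\<dots> = (\<Sum>ra\<in>?B as. \<Sum>rb\<in>?B bs. \<Sum>r1\<in>UNIV. \<Sum>r2\<in>UNIV. ?r ra r1 r2 rb *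
       (\<Sum>s1\<in>UNIV. \<Sum>s2\<in>UNIV. cross u v r1 r2 s1 s2 * ?p' ra s1 s2 rb))"
    using Cons.prems by (intro sum.cong refl arg_cong2[where f = "(*)"] Cons.IH)
      (auto simp: bool_lists_def)
  also have "\<dots> = (\<Sum>ra\<in>?B as. \<Sum>rb\<in>?B bs. \<Sum>s1\<in>UNIV. \<Sum>s2\<in>UNIV.
      (\<Sum>r1\<in>UNIV. \<Sum>r2\<in>UNIV. ?r ra r1 r2 rb * cross u v r1 r2 s1 s2) * ?p' ra s1 s2 rb)"
    by (rule sum.cong[OF refl], rule sum.cong[OF refl]) (simp add: UNIV_bool algebra_simps)
  also have "\<dots> = (\<Sum>ra\<in>?B as. \<Sum>rb\<in>?B bs. \<Sum>s1\<in>UNIV. \<Sum>s2\<in>UNIV.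
      (\<Sum>w1\<in>UNIV. \<Sum>w2\<in>UNIV. cross u v t1 t2 w1 w2 * ?r' w1 w2 ra s1 s2 rb) * ?p' ra s1 s2 rb)"
    using Cons.prems assms by (intro sum.cong refl arg_cong2[where f = "(*)"] row_exchange)
      (auto simp: bool_lists_def)
  also have "\<dots> = (\<Sum>w1\<in>UNIV. \<Sum>w2\<in>UNIV. cross u v t1 t2 w1 w2 *
      psi (x # xs) (as @ v # u # bs) (ta @ w1 # w2 # tb) (pa @ p1 # p2 # pb))"
    by (simp add: psi_Cons sum_bool_lists_pair UNIV_bool sum.distrib sum_distrib_right
        sum_distrib_left distrib_right distrib_left mult.assoc add_ac)
  finally show ?case .
qed

text \<open>A row with parameter \<^term>\<open>u * inverse a\<close> acts on the columns it crosses as a product of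
  crossings, so that it continues the column \<^term>\<open>u\<close> and the two can be moved together.\<close>

lemma psi_pull:
  assumes "0 \<notin> set xs" "u \<noteq> 0" "0 \<notin> set ys"
    and "length ta = length as" "length pa = length as"
    and "length tb = length bs" "length pb = length bs"
    and "length ts = length ys" "length ps = length ys"
  shows "(\<Sum>k\<in>UNIV. \<Sum>qs\<in>bool_lists (length ys).
      psi xs (as @ u # ys @ bs) (ta @ t # ts @ tb) (pa @ k # qs @ pb) *
        row (u * inverse a) ys (\<not> k) (\<not> e) qs ps) =
    (\<Sum>k\<in>UNIV. \<Sum>ss\<in>bool_lists (length ys). row (u * inverse a) ys (\<not> t) (\<not> k) ts ss *
      psi xs (as @ ys @ u # bs) (ta @ ss @ k # tb) (pa @ ps @ e # pb))"
  using assms(3-5,8-)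
proof (induction ys arbitrary: as ta pa t ts ps)
  case Nil
  then show ?case by (simp add: UNIV_bool)
next
  case (Cons v ys)
  then obtain t2 ts' p2 ps' where [simp]: "ts = t2 # ts'" "ps = p2 # ps'"
    by (auto simp: length_Suc_conv)
  let ?B = "bool_lists (length ys)"
  let ?x = "u * inverse a"
  let ?p = "\<lambda>k q qs. psi xs (as @ u # v # ys @ bs) (ta @ t # t2 # ts' @ tb) (pa @ k # q # qs @ pb)"
  let ?p' = "\<lambda>s1 s2 k qs. psi xs (as @ v # u # ys @ bs) (ta @ s1 # s2 # ts' @ tb) (pa @ p2 # k # qs @ pb)"
  \<comment> \<open>The first vertex of the row \<open>u * inverse a\<close> lies in the column
    \<open>v\<close> and is by \<open>cross_def\<close> the crossing of \<open>u\<close> and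
    \<open>v\<close>.\<close>
  have "(\<Sum>k\<in>UNIV. \<Sum>qs\<in>bool_lists (length (v # ys)).
      psi xs (as @ u # (v # ys) @ bs) (ta @ t # ts @ tb) (pa @ k # qs @ pb) *
        row ?x (v # ys) (\<not> k) (\<not> e) qs ps) =
    (\<Sum>k2\<in>UNIV. \<Sum>qs\<in>?B. (\<Sum>k\<in>UNIV. \<Sum>q\<in>UNIV. ?p k q qs * cross u v k q p2 k2) *
       row ?x ys (\<not> k2) (\<not> e) qs ps')"
    by (simp add: sum_bool_lists_Suc UNIV_bool cross_def sum.distrib sum_distrib_right
        sum_distrib_left distrib_right distrib_left mult.assoc add_ac)
  also have "\<dots> = (\<Sum>k2\<in>UNIV. \<Sum>qs\<in>?B. (\<Sum>s1\<in>UNIV. \<Sum>s2\<in>UNIV. cross u v t t2 s1 s2 * ?p' s1 s2 k2 qs) *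
       row ?x ys (\<not> k2) (\<not> e) qs ps')"
    using Cons.prems assms by (intro sum.cong refl arg_cong2[where f = "(*)"] psi_exchange)
      (auto simp: bool_lists_def)
  also have "\<dots> = (\<Sum>s1\<in>UNIV. \<Sum>s2\<in>UNIV. cross u v t t2 s1 s2 *
      (\<Sum>k\<in>UNIV. \<Sum>qs\<in>?B. psi xs ((as @ [v]) @ u # ys @ bs) ((ta @ [s1]) @ s2 # ts' @ tb)
         ((pa @ [p2]) @ k # qs @ pb) * row ?x ys (\<not> k) (\<not> e) qs ps'))"
    by (simp add: UNIV_bool sum.distrib sum_distrib_right
        sum_distrib_left distrib_right distrib_left mult.assoc add_ac)
  also have "\<dots> = (\<Sum>s1\<in>UNIV. \<Sum>s2\<in>UNIV. cross u v t t2 s1 s2 *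
      (\<Sum>k\<in>UNIV. \<Sum>ss\<in>?B. row ?x ys (\<not> s2) (\<not> k) ts' ss *
      psi xs ((as @ [v]) @ ys @ u # bs) ((ta @ [s1]) @ ss @ k # tb) ((pa @ [p2]) @ ps' @ e # pb)))"
    using Cons.prems by (intro sum.cong refl arg_cong2[where f = "(*)"] Cons.IH) auto
  also have "\<dots> = (\<Sum>k\<in>UNIV. \<Sum>ss\<in>bool_lists (length (v # ys)). row ?x (v # ys) (\<not> t) (\<not> k) ts ss *
      psi xs (as @ (v # ys) @ u # bs) (ta @ ss @ k # tb) (pa @ ps @ e # pb))"
    by (simp add: sum_bool_lists_Suc UNIV_bool cross_def sum.distrib sum_distrib_right
        sum_distrib_left distrib_right distrib_left mult.assoc add_ac)
  finally show ?case .
qed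

definition two_rows where
  "two_rows x1 x2 ys l1 l2 r1 r2 ts bs =
    (\<Sum>qs\<in>bool_lists (length ys). row x1 ys l1 r1 ts qs * row x2 ys l2 r2 qs bs)"

lemma two_rows_exchange:
  assumes "x1 \<noteq> 0" "x2 \<noteq> 0" "0 \<notin> set ys" "length ts = length ys" "length bs = length ys"
  shows "(\<Sum>k1\<in>UNIV. \<Sum>k2\<in>UNIV. cross_rows x1 x2 l1 l2 k1 k2 * two_rows x1 x2 ys k1 k2 r1 r2 ts bs) =
    (\<Sum>k1\<in>UNIV. \<Sum>k2\<in>UNIV. two_rows x2 x1 ys l1 l2 k1 k2 ts bs * cross_rows x1 x2 k1 k2 r1 r2)"
  using assms(3-)
proof (induction ys arbitrary: l1 l2 ts bs)
  case Nil
  then show ?case by (cases l1; cases l2; cases r1; cases r2) (simp_all add: two_rows_def UNIV_bool)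
next
  case (Cons y ys)
  then obtain t ts' b bs' where [simp]: "ts = t # ts'" "bs = b # bs'"
    by (auto simp: length_Suc_conv)
  have step: "two_rows x1 x2 (y # ys) l1 l2 r1 r2 ts bs = (\<Sum>k1\<in>UNIV. \<Sum>k2\<in>UNIV.
      (\<Sum>q\<in>UNIV. vwt a (x1 * inverse y) l1 k1 t q * vwt a (x2 * inverse y) l2 k2 q b) *
      two_rows x1 x2 ys k1 k2 r1 r2 ts' bs')" for x1 x2 l1 l2 r1 r2
    by (simp add: two_rows_def sum_bool_lists_Suc UNIV_bool sum.distrib sum_distrib_right
        sum_distrib_left distrib_right distrib_left mult_ac add_ac)
  have "(\<Sum>k1\<in>UNIV. \<Sum>k2\<in>UNIV. cross_rows x1 x2 l1 l2 k1 k2 * two_rows x1 x2 (y # ys) k1 k2 r1 r2 ts bs) =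
    (\<Sum>j1\<in>UNIV. \<Sum>j2\<in>UNIV. (\<Sum>k1\<in>UNIV. \<Sum>k2\<in>UNIV. cross_rows x1 x2 l1 l2 k1 k2 *
       (\<Sum>q\<in>UNIV. vwt a (x1 * inverse y) k1 j1 t q * vwt a (x2 * inverse y) k2 j2 q b)) *
     two_rows x1 x2 ys j1 j2 r1 r2 ts' bs')"
    unfolding step by (simp add: UNIV_bool algebra_simps)
  also have "\<dots> = (\<Sum>j1\<in>UNIV. \<Sum>j2\<in>UNIV. (\<Sum>k1\<in>UNIV. \<Sum>k2\<in>UNIV. (\<Sum>q\<in>UNIV. vwt a (x2 * inverse y) l1 k1 t q *
            vwt a (x1 * inverse y) l2 k2 q b) * cross_rows x1 x2 k1 k2 j1 j2) *
     two_rows x1 x2 ys j1 j2 r1 r2 ts' bs')"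
    using Cons.prems assms by (intro sum.cong refl arg_cong2[where f = "(*)"] yang_baxter_rows) auto
  also have "\<dots> = (\<Sum>k1\<in>UNIV. \<Sum>k2\<in>UNIV. (\<Sum>q\<in>UNIV. vwt a (x2 * inverse y) l1 k1 t q *
            vwt a (x1 * inverse y) l2 k2 q b) *
     (\<Sum>j1\<in>UNIV. \<Sum>j2\<in>UNIV. cross_rows x1 x2 k1 k2 j1 j2 * two_rows x1 x2 ys j1 j2 r1 r2 ts' bs'))"
    by (simp add: UNIV_bool algebra_simps)
  also have "\<dots> = (\<Sum>k1\<in>UNIV. \<Sum>k2\<in>UNIV. (\<Sum>q\<in>UNIV. vwt a (x2 * inverse y) l1 k1 t q *
            vwt a (x1 * inverse y) l2 k2 q b) *
     (\<Sum>j1\<in>UNIV. \<Sum>j2\<in>UNIV. two_rows x2 x1 ys k1 k2 j1 j2 ts' bs' * cross_rows x1 x2 j1 j2 r1 r2))"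
    using Cons by simp
  also have "\<dots> = (\<Sum>k1\<in>UNIV. \<Sum>k2\<in>UNIV. two_rows x2 x1 (y # ys) l1 l2 k1 k2 ts bs * cross_rows x1 x2 k1 k2 r1 r2)"
    unfolding step by (simp add: UNIV_bool algebra_simps)
  finally show ?case .
qed

text \<open>With both left edges pointing right and both right edges pointing left, the ice rule
  leaves the crossing a single state at either side. Both states have the weight
  \<open>sigma (a^2 * x2 * inverse x1)\<close>, which cancels.\<close>

lemma psi_swap_rows:
  assumes "x1 \<noteq> 0" "x2 \<noteq> 0" "0 \<notin> set ys" "length ts = length ys" "length bs = length ys"
    and "sigma (a^2 * x2 * inverse x1) \<noteq> 0"
  shows "psi (as @ x1 # x2 # zs) ys ts bs = psi (as @ x2 # x1 # zs) ys ts bs"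
proof -
  have comm: "two_rows x1 x2 ys True True False False ts' bs' =
    two_rows x2 x1 ys True True False False ts' bs'"
    if "length ts' = length ys" "length bs' = length ys" for ts' bs'
  proof -
    have "sigma (a * inverse (x1 * inverse x2 * inverse a)) \<noteq> 0"
      using assms a_nonzero by (simp add: power2_eq_square algebra_simps)
    then show ?thesis
    using two_rows_exchange[OF assms(1-3) that, of True True False False]
    by (simp add: UNIV_bool cross_rows_def vwt_def)
  qed
  have cons: "psi (x1 # x2 # zs) ys ts' bs = (\<Sum>qs\<in>bool_lists (length ys).
      two_rows x1 x2 ys True True False False ts' qs * psi zs ys qs bs)" for x1 x2 ts'
    unfolding psi_Cons two_rows_def
    by (simp add: sum_distrib_left sum_distrib_right mult.assoc) (rule sum.swap)
  have "psi (x1 # x2 # zs) ys ts' bs = psi (x2 # x1 # zs) ys ts' bs"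
    if "length ts' = length ys" for ts'
    unfolding cons using that by (intro sum.cong refl) (simp add: comm bool_lists_def)
  then show ?thesis using assms(4)
    by (auto simp: psi_append bool_lists_def intro!: sum.cong)
qed

end

lemma sum_bool_lists_snoc:
  "(\<Sum>bs\<in>bool_lists (Suc n). f bs) = (\<Sum>bs\<in>bool_lists n. \<Sum>b\<in>UNIV. f (bs @ [b]))"
  using sum_bool_lists_append[of f n 1] by (simp add: sum_bool_lists_Suc)

text \<open>Abstract form of a column swap in a half-turn model, where both columns occur twice.
  \<open>X\<close> stands for the rectangle in which the left and the right pair have the same
  order, which is no half-turn model. Crossing the left pair yields \<open>A\<close>, crossing the
  right pair yields \<open>B\<close>; these are the models with the two columns in either order. The
  hypothesis on \<open>K\<close> lets the crossing pass from one pair to the other, and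
  \<open>n\<close> is the effect of a half-turn on a pair of edges.\<close>

lemma double_sum_exchange:
  fixes X :: "'i \<Rightarrow> 'i \<Rightarrow> 'c::field"
  assumes "finite I" "w \<noteq> 0" "\<And>i. i \<in> I \<Longrightarrow> n i \<in> I" "\<And>i. i \<in> I \<Longrightarrow> n (n i) = i"
    and X1: "\<And>p q. p \<in> I \<Longrightarrow> q \<in> I \<Longrightarrow> (\<Sum>i\<in>I. X i (n q) * c i p) = w * A p q"
    and X2: "\<And>i p. i \<in> I \<Longrightarrow> p \<in> I \<Longrightarrow> (\<Sum>e\<in>I. X i e * c e (n p)) = w * B i p"
    and c: "\<And>p q. p \<in> I \<Longrightarrow> q \<in> I \<Longrightarrow> c (n q) (n p) = c p q"
    and K: "\<And>i q. i \<in> I \<Longrightarrow> q \<in> I \<Longrightarrow> (\<Sum>r\<in>I. K i r * c r q) = (\<Sum>s\<in>I. c i s * K' s q)"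
  shows "(\<Sum>p\<in>I. \<Sum>q\<in>I. A p q * K' p q) = (\<Sum>p\<in>I. \<Sum>q\<in>I. B p q * K p q)"
proof -
  have "w * (\<Sum>p\<in>I. \<Sum>q\<in>I. A p q * K' p q) = (\<Sum>p\<in>I. \<Sum>q\<in>I. (\<Sum>i\<in>I. X i (n q) * c i p) * K' p q)"
    by (simp add: sum_distrib_left X1 mult.assoc cong: sum.cong)
  also have "\<dots> = (\<Sum>q\<in>I. \<Sum>p\<in>I. \<Sum>i\<in>I. X i (n q) * (c i p * K' p q))"
    by (subst sum.swap) (simp add: sum_distrib_right mult.assoc)
  also have "\<dots> = (\<Sum>q\<in>I. \<Sum>i\<in>I. X i (n q) * (\<Sum>s\<in>I. c i s * K' s q))"
    by (rule sum.cong[OF refl], subst sum.swap) (simp add: sum_distrib_left)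
  also have "\<dots> = (\<Sum>q\<in>I. \<Sum>i\<in>I. X i (n q) * (\<Sum>r\<in>I. K i r * c r q))"
    by (intro sum.cong refl) (simp add: K)
  also have "\<dots> = (\<Sum>i\<in>I. \<Sum>r\<in>I. \<Sum>q\<in>I. X i (n q) * (c r q * K i r))"
    by (subst sum.swap, subst (2) sum.swap) (simp add: sum_distrib_left mult_ac)
  also have "\<dots> = (\<Sum>i\<in>I. \<Sum>r\<in>I. (\<Sum>q\<in>I. X i (n q) * c (n q) (n r)) * K i r)"
    by (simp add: sum_distrib_right c mult.assoc cong: sum.cong)
  also have "\<dots> = (\<Sum>i\<in>I. \<Sum>r\<in>I. (\<Sum>e\<in>I. X i e * c e (n r)) * K i r)"
    by (intro sum.cong refl arg_cong2[where f = "(*)"] sum.reindex_bij_witness[where i = n and j = n])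
      (auto simp: assms(3,4))
  also have "\<dots> = w * (\<Sum>p\<in>I. \<Sum>q\<in>I. B p q * K p q)"
    by (simp add: sum_distrib_left X2 mult.assoc cong: sum.cong)
  finally show ?thesis using \<open>w \<noteq> 0\<close> by simp
qed

section \<open>Degenerate vertices and frozen rows and columns\<close>

context six_vertex
begin

text \<open>Types 3 and 4 vanish here and the other four types have equal weight. The two lines no
  longer cross: the left edge is joined to the bottom edge and the top edge to the right
  edge.\<close>

lemma vwt_inverse_a: "vwt a (inverse a) l r t b = of_bool (r = (\<not> t) \<and> b = (\<not> l)) * sigma (a\<^sup>2)"
  using a_nonzero
  by (cases l; cases r; cases t; cases b) (simp_all add: vwt_def sigma_def power2_eq_square)

abbreviation tops :: "complex list \<Rightarrow> bool list" where
  "tops ys \<equiv> replicate (length ys) True"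

text \<open>A left edge pointing left and a top edge pointing up both leave the vertex, so only type
  5 remains, and it passes the same situation on to the next vertex.\<close>

lemma row_left_False:
  assumes "length bs = length ys"
  shows "row x ys False r (tops ys) bs =
    of_bool (\<not> r \<and> bs = tops ys) * (\<Prod>y\<leftarrow>ys. sigma (a * inverse x * y))"
  using assms
proof (induction ys arbitrary: bs)
  case Nil
  then show ?case by simp
next
  case (Cons y ys)
  then obtain b bs' where [simp]: "bs = b # bs'"
    by (auto simp: length_Suc_conv)
  show ?case using Cons
    by (cases b) (auto simp: UNIV_bool vwt_def mult_ac)
qed

text \<open>The corner vertex has parameter \<open>inverse a\<close> and is forced to type 1; the
  edge to its right points left and freezes the remaining row.\<close>

lemma psi_first_row:
  assumes "u \<noteq> 0"
  shows "psi (u * inverse a # xs) (u # ys) (True # tops ys) bs =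
    sigma (a\<^sup>2) * (\<Prod>y\<leftarrow>ys. sigma (a\<^sup>2 * inverse u * y)) * psi xs (u # ys) (False # tops ys) bs"
proof -
  have z: "u * inverse a * inverse u = inverse a" using assms by simp
  have w: "(\<Prod>y\<leftarrow>ys. sigma (a * inverse (u * inverse a) * y)) =
      (\<Prod>y\<leftarrow>ys. sigma (a\<^sup>2 * inverse u * y))"
    by (simp add: power2_eq_square mult_ac)
  have "psi (u * inverse a # xs) (u # ys) (True # tops ys) bs =
    (\<Sum>qs\<in>bool_lists (length ys). sigma (a\<^sup>2) * row (u * inverse a) ys False False (tops ys) qs
       * psi xs (u # ys) (False # qs) bs)"
    by (simp add: psi_Cons sum_bool_lists_Suc UNIV_bool z vwt_inverse_a)
  also have "\<dots> = (\<Sum>qs\<in>bool_lists (length ys). of_bool (qs = tops ys) *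
       (sigma (a\<^sup>2) * (\<Prod>y\<leftarrow>ys. sigma (a\<^sup>2 * inverse u * y)) * psi xs (u # ys) (False # qs) bs))"
    by (intro sum.cong refl) (simp add: row_left_False bool_lists_def w del: inverse_mult_distrib)
  finally show ?thesis by (simp add: sum_bool_lists_delta)
qed

text \<open>A top edge pointing down and a left edge pointing right both enter the vertex, so only
  type 6 remains, down the whole column.\<close>

lemma psi_left_column:
  assumes "length ts = length ys" "length bs = length ys"
  shows "psi xs (y # ys) (False # ts) (b # bs) =
    of_bool (\<not> b) * (\<Prod>x\<leftarrow>xs. sigma (a * inverse x * y)) * psi xs ys ts bs"
  using assms(1)
proof (induction xs arbitrary: ts)
  case Nil
  then show ?case by auto
next
  case (Cons x xs)
  have r: "row x (y # ys) True False (False # ts) (q # qs) =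
    of_bool (\<not> q) * sigma (a * inverse x * y) * row x ys True False ts qs" for q qs
    by (cases q) (simp_all add: UNIV_bool vwt_def mult_ac)
  have "psi (x # xs) (y # ys) (False # ts) (b # bs) = (\<Sum>qs\<in>bool_lists (length ys).
      sigma (a * inverse x * y) * row x ys True False ts qs * psi xs (y # ys) (False # qs) (b # bs))"
    by (simp add: psi_Cons sum_bool_lists_Suc r UNIV_bool del: row.simps)
  also have "\<dots> = (\<Sum>qs\<in>bool_lists (length ys). sigma (a * inverse x * y) * row x ys True False ts qs *
      (of_bool (\<not> b) * (\<Prod>x\<leftarrow>xs. sigma (a * inverse x * y)) * psi xs ys qs bs))"
    by (intro sum.cong refl) (simp add: Cons.IH bool_lists_def)
  finally show ?case
    by (simp add: psi_Cons sum_distrib_left mult_ac)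
qed

lemma psi_right_column:
  assumes "length ts = length ys" "length bs = length ys"
  shows "psi xs (ys @ [y]) (ts @ [t]) (bs @ [True]) =
    of_bool t * (\<Prod>x\<leftarrow>xs. sigma (a * inverse x * y)) * psi xs ys ts bs"
  using psi_left_column[of "rev (map Not bs)" "rev ys" "rev (map Not ts)" "rev xs" y "\<not> t"]
    psi_rotate[of ts ys bs xs] psi_rotate[of "ts @ [t]" "ys @ [y]" "bs @ [True]" xs] assms
  by (simp add: rev_map[symmetric])

subsection \<open>The models and their reductions\<close>

definition domain_wall :: "complex list \<Rightarrow> complex list \<Rightarrow> complex" where
  "domain_wall xs ys = psi xs ys (tops ys) (replicate (length ys) False)"

text \<open>In the half-turn models the lower half of the lattice is rotated by a half-turn and glued to
  the right of the upper half, so that every column parameter occurs twice.  The list \<^term>\<open>ps\<close>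
  describes the edges below the upper half.\<close>

definition half_turn :: "complex list \<Rightarrow> complex list \<Rightarrow> complex" where
  "half_turn xs ys = (\<Sum>ps\<in>bool_lists (length ys).
     psi xs (ys @ rev ys) (tops ys @ tops ys) (ps @ rev (map Not ps)))"

text \<open>The even half-turn model whose innermost column has parameter \<^term>\<open>u\<close> in the upper and
  \<^term>\<open>v\<close> in the lower half, restricted to the orientation \<^term>\<open>s\<close> of its middle edge.\<close>

definition split_turn :: "bool \<Rightarrow> complex list \<Rightarrow> complex list \<Rightarrow> complex \<Rightarrow> complex \<Rightarrow> complex" where
  "split_turn s xs ys u v = (\<Sum>ps\<in>bool_lists (length ys).
     psi xs (ys @ u # v # rev ys) (tops ys @ True # True # tops ys) (ps @ s # (\<not> s) # rev (map Not ps)))"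

text \<open>\<open>ps\<close> are the edges above and \<open>qs\<close> those below the middle row.
  The last edge of this row bends into the top of the column \<open>v\<close> in the lower half;
  pointing down there, it points up after the rotation, so the same \<open>s\<close> stands in both
  places. True \<open>s\<close> is the central entry 1.\<close>

definition odd_turn :: "bool \<Rightarrow> complex list \<Rightarrow> complex \<Rightarrow> complex list \<Rightarrow> complex \<Rightarrow> complex" where
  "odd_turn s xs x ys v = (\<Sum>ps\<in>bool_lists (length ys). \<Sum>qs\<in>bool_lists (length ys).
     psi xs (ys @ v # rev ys) (tops ys @ True # tops ys) (ps @ s # rev (map Not qs)) * row x ys True s ps qs)"

lemma half_turn_snoc: "half_turn xs (ys @ [u]) = (\<Sum>s\<in>UNIV. split_turn s xs ys u u)"
  by (simp add: half_turn_def split_turn_def sum_bool_lists_snoc UNIV_bool sum.distrib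
      replicate_app_Cons_same)

text \<open>At these parameters the first vertex of the middle row decouples, so that the first column
  continues into the middle row and can be pulled through to the centre.\<close>

lemma odd_turn_first_column:
  assumes "u \<noteq> 0" "0 \<notin> set xs" "0 \<notin> set ys"
  shows "odd_turn s xs (u * inverse a) (u # ys) v =
    sigma (a\<^sup>2) * (\<Prod>x\<leftarrow>xs. sigma (a * inverse x * u)) * (\<Prod>y\<leftarrow>ys. sigma (a\<^sup>2 * inverse u * y)) *
    split_turn (\<not> s) xs ys u v"
proof -
  let ?x = "u * inverse a"
  let ?B = "bool_lists (length ys)"
  let ?P = "\<Prod>x\<leftarrow>xs. sigma (a * inverse x * u)"
  let ?Q = "\<Prod>y\<leftarrow>ys. sigma (a\<^sup>2 * inverse u * y)"
  have z: "?x * inverse u = inverse a" using assms by simp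
  have w: "(\<Prod>y\<leftarrow>ys. sigma (a * inverse ?x * y)) = ?Q"
    by (simp add: power2_eq_square mult_ac)
  \<comment> \<open>The first vertex has parameter \<open>inverse a\<close>: the left boundary edge
    turns down, so \<open>q\<close> is false, and the edge \<open>p\<close> turns into the rest of
    the row.\<close>
  have r: "row ?x (u # ys) True s (p # ps) (q # qs) =
      of_bool (\<not> q) * (sigma (a\<^sup>2) * row ?x ys (\<not> p) s ps qs)" for p q ps qs
    by (cases p; cases q) (simp_all add: UNIV_bool z vwt_inverse_a)
  \<comment> \<open>Rotated and negated, the false \<open>q\<close> is a bottom edge pointing up
    under the rightmost column \<open>u\<close>, which freezes that column.\<close>
  have summand: "(\<Sum>q\<in>UNIV. psi xs ((u # ys) @ v # rev (u # ys)) (replicate (Suc (length ys)) True @ True # replicate (Suc (length ys)) True)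
        ((p # ps) @ s # rev (map Not (q # qs))) * row ?x (u # ys) True s (p # ps) (q # qs)) =
      sigma (a\<^sup>2) * ?P * (psi xs (u # ys @ v # rev ys) (True # tops ys @ True # tops ys)
        (p # ps @ s # rev (map Not qs)) * row ?x ys (\<not> p) s ps qs)"
    if "ps \<in> ?B" "qs \<in> ?B" for p ps qs
    using psi_right_column[of "True # tops ys @ True # tops ys" "u # ys @ v # rev ys"
        "p # ps @ s # rev (map Not qs)" xs u True] that
    by (simp add: UNIV_bool r bool_lists_def replicate_append_same
        replicate_app_Cons_same mult_ac del: row.simps)
  have "odd_turn s xs ?x (u # ys) v = (\<Sum>p\<in>UNIV. \<Sum>ps\<in>?B. \<Sum>qs\<in>?B.
      sigma (a\<^sup>2) * ?P * (psi xs (u # ys @ v # rev ys) (True # tops ys @ True # tops ys)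
        (p # ps @ s # rev (map Not qs)) * row ?x ys (\<not> p) s ps qs))"
    unfolding odd_turn_def list.size add_0_right add_Suc_right sum_bool_lists_Suc
    by (rule sum.cong[OF refl], rule sum.cong[OF refl], subst sum.swap, intro sum.cong refl summand)
  also have "\<dots> = (\<Sum>qs\<in>?B. sigma (a\<^sup>2) * ?P * (\<Sum>p\<in>UNIV. \<Sum>ps\<in>?B.
      psi xs ([] @ u # ys @ v # rev ys) ([] @ True # tops ys @ True # tops ys)
        ([] @ p # ps @ s # rev (map Not qs)) * row ?x ys (\<not> p) (\<not> \<not> s) ps qs))"
    by (subst (3) sum.swap, subst (2) sum.swap, subst sum.swap, subst (2) sum.swap)
      (simp add: sum_distrib_left)
  \<comment> \<open>The column \<open>u\<close> moves to the centre, and the row that continued it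
    below now crosses \<open>ys\<close> above the rectangle, where the boundary edges freeze
    it.\<close>
  also have "\<dots> = (\<Sum>qs\<in>?B. sigma (a\<^sup>2) * ?P * (\<Sum>k\<in>UNIV. \<Sum>ss\<in>?B.
      row ?x ys (\<not> True) (\<not> k) (tops ys) ss *
      psi xs ([] @ ys @ u # v # rev ys) ([] @ ss @ k # True # tops ys)
        ([] @ qs @ (\<not> s) # s # rev (map Not qs))))"
    using assms by (intro sum.cong refl arg_cong2[where f = "(*)"] psi_pull)
      (auto simp: bool_lists_def)
  also have "\<dots> = (\<Sum>qs\<in>?B. sigma (a\<^sup>2) * ?P * (\<Sum>k\<in>UNIV. \<Sum>ss\<in>?B. of_bool (ss = tops ys) *
      (of_bool k * ?Q * psi xs (ys @ u # v # rev ys) (ss @ k # True # tops ys)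
        (qs @ (\<not> s) # s # rev (map Not qs)))))"
    by (rule sum.cong[OF refl], rule arg_cong2[where f = "(*)", OF refl], intro sum.cong refl)
      (auto simp: w row_left_False bool_lists_def simp del: inverse_mult_distrib)
  also have "\<dots> = sigma (a\<^sup>2) * ?P * ?Q * split_turn (\<not> s) xs ys u v"
    by (simp add: sum_bool_lists_delta UNIV_bool split_turn_def sum_distrib_left mult.assoc)
  finally show ?thesis .
qed

text \<open>The reverse of the preceding move. Row \<open>x\<close> and column \<open>a * x\<close>
  meet with parameter \<open>inverse a\<close>: to the left of this vertex the row turns down into
  the column, to the right it is frozen. Pulling the column to the left border freezes it and leaves
  the surviving piece of the row below \<open>ys\<close>, in the place of a middle row.\<close>

lemma split_turn_first_row:
  assumes "x \<noteq> 0" "0 \<notin> set xs" "0 \<notin> set ys"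
  shows "split_turn s (x # xs) ys (a * x) v =
    sigma (a\<^sup>2) * sigma (a * inverse x * v) * (\<Prod>y\<leftarrow>ys. sigma (a * inverse x * y)) *
    (\<Prod>z\<leftarrow>xs. sigma (a * inverse z * (a * x))) * odd_turn (\<not> s) xs x ys v"
proof -
  let ?u = "a * x"
  let ?B = "bool_lists (length ys)"
  let ?W = "sigma (a * inverse x * v) * (\<Prod>y\<leftarrow>ys. sigma (a * inverse x * y))"
  let ?P = "\<Prod>z\<leftarrow>xs. sigma (a * inverse z * ?u)"
  have x: "x = ?u * inverse a" and z: "x * (inverse a * inverse x) = inverse a" and u: "?u \<noteq> 0"
    using assms a_nonzero by simp_all
  have first: "psi (x # xs) (ys @ ?u # v # rev ys) (tops ys @ True # True # tops ys) bs =
      sigma (a\<^sup>2) * ?W * (\<Sum>k\<in>UNIV. \<Sum>ss\<in>?B. row x ys (\<not> False) (\<not> k) (tops ys) ss *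
        psi xs ([] @ ys @ ?u # v # rev ys) ([] @ ss @ k # True # tops ys) bs)" for bs
  proof -
    let ?f' = "\<lambda>ss k qs. psi xs (ys @ ?u # v # rev ys) (ss @ k # qs) bs"
    let ?f = "\<lambda>k ss. ?f' ss k (True # tops ys)"
    have r: "row x (ys @ ?u # v # rev ys) True False (tops ys @ True # True # tops ys) (ss @ q # qs) =
        of_bool (qs = True # tops ys) * (sigma (a\<^sup>2) * ?W * row x ys True (\<not> q) (tops ys) ss)"
      if "ss \<in> ?B" "qs \<in> bool_lists (Suc (length ys))" for ss q qs
      using row_left_False[of qs "v # rev ys" x False] that
      by (simp add: row_append bool_lists_def UNIV_bool z vwt_inverse_a
          prod_list.rev rev_map[symmetric] del: row.simps(3))
    have "psi (x # xs) (ys @ ?u # v # rev ys) (tops ys @ True # True # tops ys) bs =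
      (\<Sum>ss\<in>?B. \<Sum>q\<in>UNIV. \<Sum>qs\<in>bool_lists (Suc (length ys)).
         row x (ys @ ?u # v # rev ys) True False (tops ys @ True # True # tops ys) (ss @ q # qs) *
         ?f' ss q qs)" (is "_ = ?S")
      using sum_bool_lists_append[of _ "length ys" "Suc (Suc (length ys))"]
      by (simp add: psi_Cons sum_bool_lists_Suc[of _ "Suc _"] del: row.simps)
    also have "?S = (\<Sum>ss\<in>?B. \<Sum>q\<in>UNIV. \<Sum>qs\<in>bool_lists (Suc (length ys)).
         of_bool (qs = True # tops ys) * (sigma (a\<^sup>2) * ?W * row x ys True (\<not> q) (tops ys) ss *
         ?f' ss q qs))"
      by (intro sum.cong refl) (simp add: r mult.assoc del: row.simps)
    also have "\<dots> = (\<Sum>ss\<in>?B. \<Sum>q\<in>UNIV. sigma (a\<^sup>2) * ?W * row x ys True (\<not> q) (tops ys) ss *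
         ?f q ss)"
      by (intro sum.cong refl sum_bool_lists_delta) (simp add: bool_lists_def)
    also have "\<dots> = sigma (a\<^sup>2) * ?W * (\<Sum>k\<in>UNIV. \<Sum>ss\<in>?B. row x ys True (\<not> k) (tops ys) ss * ?f k ss)"
      by (subst sum.swap) (simp add: sum_distrib_left mult.assoc)
    finally show ?thesis by simp
  qed
  have left: "psi xs (?u # ys @ v # rev ys) (False # tops ys @ True # tops ys)
      (k # qs @ (\<not> s) # rev (map Not ps)) = of_bool (\<not> k) * ?P *
      psi xs (ys @ v # rev ys) (tops ys @ True # tops ys) (qs @ (\<not> s) # rev (map Not ps))"
    if "ps \<in> ?B" "qs \<in> ?B" for k ps qs
    using that by (simp add: psi_left_column bool_lists_def)
  have "split_turn s (x # xs) ys ?u v = (\<Sum>ps\<in>?B. sigma (a\<^sup>2) * ?W *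
      (\<Sum>k\<in>UNIV. \<Sum>ss\<in>?B. row (?u * inverse a) ys (\<not> False) (\<not> k) (tops ys) ss *
        psi xs ([] @ ys @ ?u # v # rev ys) ([] @ ss @ k # True # tops ys)
          ([] @ ps @ s # (\<not> s) # rev (map Not ps))))"
    unfolding split_turn_def x[symmetric] by (simp only: first append_Nil)
  also have "\<dots> = (\<Sum>ps\<in>?B. sigma (a\<^sup>2) * ?W * (\<Sum>k\<in>UNIV. \<Sum>qs\<in>?B.
      psi xs ([] @ ?u # ys @ v # rev ys) ([] @ False # tops ys @ True # tops ys)
        ([] @ k # qs @ (\<not> s) # rev (map Not ps)) * row (?u * inverse a) ys (\<not> k) (\<not> s) qs ps))"
    using assms u by (intro sum.cong refl arg_cong2[where f = "(*)"] psi_pull[symmetric])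
      (auto simp: bool_lists_def)
  also have "\<dots> = (\<Sum>ps\<in>?B. sigma (a\<^sup>2) * ?W * (\<Sum>qs\<in>?B. ?P *
      (psi xs (ys @ v # rev ys) (tops ys @ True # tops ys) (qs @ (\<not> s) # rev (map Not ps)) *
        row x ys True (\<not> s) qs ps)))"
    unfolding x[symmetric]
    by (intro sum.cong refl arg_cong2[where f = "(*)"])
      (simp add: UNIV_bool left mult.assoc cong: sum.cong)
  also have "\<dots> = sigma (a\<^sup>2) * ?W * ?P * odd_turn (\<not> s) xs x ys v"
    unfolding odd_turn_def by (subst sum.swap) (simp add: sum_distrib_left mult.assoc)
  finally show ?thesis by (simp add: mult.assoc)
qed

lemma domain_wall_first:
  assumes "u \<noteq> 0"
  shows "domain_wall (u * inverse a # xs) (u # ys) =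
    sigma (a\<^sup>2) * (\<Prod>y\<leftarrow>ys. sigma (a\<^sup>2 * inverse u * y)) * (\<Prod>x\<leftarrow>xs. sigma (a * inverse x * u)) *
    domain_wall xs ys"
  using assms by (simp add: domain_wall_def psi_first_row psi_left_column)

lemma half_turn_first:
  assumes "u \<noteq> 0"
  shows "half_turn (u * inverse a # xs) (u # ys) =
    (sigma (a\<^sup>2) * (\<Prod>y\<leftarrow>ys. sigma (a\<^sup>2 * inverse u * y)) * (\<Prod>x\<leftarrow>xs. sigma (a * inverse x * u)))\<^sup>2 *
    half_turn xs ys"
proof -
  let ?B = "bool_lists (length ys)"
  let ?P = "\<Prod>x\<leftarrow>xs. sigma (a * inverse x * u)"
  let ?Q = "\<Prod>y\<leftarrow>ys. sigma (a\<^sup>2 * inverse u * y)"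
  have uu: "sigma (a\<^sup>2 * inverse u * u) = sigma (a\<^sup>2)"
    using assms by (simp add: mult.assoc)
  have *: "psi (u * inverse a # xs) (u # ys @ rev ys @ [u]) (True # tops ys @ tops ys @ [True])
      (p # ps @ rev (map Not ps) @ [\<not> p]) = of_bool (\<not> p) * ((sigma (a\<^sup>2) * ?Q * ?P)\<^sup>2 *
      psi xs (ys @ rev ys) (tops ys @ tops ys) (ps @ rev (map Not ps)))" if "ps \<in> ?B" for p ps
  proof -
    have "psi (u * inverse a # xs) (u # (ys @ rev ys @ [u])) (True # tops (ys @ rev ys @ [u]))
        (p # ps @ rev (map Not ps) @ [\<not> p]) =
      sigma (a\<^sup>2) * (?Q * ?Q * sigma (a\<^sup>2)) * psi xs (u # (ys @ rev ys @ [u]))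
        (False # tops (ys @ rev ys @ [u])) (p # ps @ rev (map Not ps) @ [\<not> p])"
      unfolding psi_first_row[OF assms] using uu
      by (simp add: prod_list.rev rev_map[symmetric])
    also have "psi xs (u # (ys @ rev ys @ [u]))
        (False # tops (ys @ rev ys @ [u])) (p # ps @ rev (map Not ps) @ [\<not> p]) =
      of_bool (\<not> p) * ?P * psi xs ((ys @ rev ys) @ [u]) ((tops ys @ tops ys) @ [True])
        ((ps @ rev (map Not ps)) @ [\<not> p])"
      using that by (simp add: psi_left_column bool_lists_def replicate_add replicate_append_same
          replicate_app_Cons_same)
    finally show ?thesis
      using that psi_right_column[of "tops ys @ tops ys" "ys @ rev ys" "ps @ rev (map Not ps)" xs u True]
      by (cases p) (simp_all add: bool_lists_def replicate_add replicate_append_same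
          replicate_app_Cons_same power2_eq_square mult_ac)
  qed
  show ?thesis
    unfolding half_turn_def list.size add_0_right add_Suc_right sum_bool_lists_Suc
    using *[where p = True] *[where p = False]
    by (simp add: UNIV_bool sum_distrib_left replicate_app_Cons_same replicate_append_same cong: sum.cong)
qed

end

subsection \<open>Symmetry in the parameters\<close>

lemma sum_bool_lists_pair_prod:
  "(\<Sum>qs\<in>bool_lists (Suc (Suc (m + n))). f qs) =
    (\<Sum>pa\<in>bool_lists m. \<Sum>pb\<in>bool_lists n. \<Sum>q\<in>UNIV. f (pa @ fst q # snd q # pb))"
  by (simp add: sum_bool_lists_pair sum.cartesian_product case_prod_unfold)

lemma move_to_front:
  assumes swap: "\<And>as p q bs. P (as @ p # q # bs) \<Longrightarrow> f (as @ p # q # bs) = f (as @ q # p # bs)"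
    and perm: "\<And>as bs. mset as = mset bs \<Longrightarrow> P as \<Longrightarrow> P bs"
    and "P (as @ x # bs)"
  shows "f (x # as @ bs) = f (as @ x # bs)"
  using assms(3)
proof (induction as arbitrary: bs rule: rev_induct)
  case Nil
  then show ?case by simp
next
  case (snoc z as)
  have "P (as @ x # z # bs)" using perm[OF _ snoc.prems, of "as @ x # z # bs"] by simp
  then have "f (x # as @ z # bs) = f (as @ x # z # bs)" by (rule snoc.IH)
  also have "\<dots> = f (as @ z # x # bs)" by (rule swap) fact
  finally show ?case by simp
qed

text \<open>\<open>P\<close> is the side condition that licenses a swap of neighbours. Being stable
  under permutations, it holds for all intermediate lists.\<close>

lemma perm_invariant:
  assumes swap: "\<And>as p q bs. P (as @ p # q # bs) \<Longrightarrow> f (as @ p # q # bs) = f (as @ q # p # bs)"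
    and perm: "\<And>as bs. mset as = mset bs \<Longrightarrow> P as \<Longrightarrow> P bs"
    and "P xs" "mset xs = mset ys"
  shows "f xs = f ys"
  using assms
proof (induction xs arbitrary: f ys P)
  case Nil
  from Nil.prems(4) show ?case by simp
next
  case (Cons x xs)
  note swap = Cons.prems(1) and perm = Cons.prems(2)
  from Cons.prems(4) have "x \<in> set ys" by (metis list.set_intros(1) set_mset_mset)
  then obtain as bs where ys: "ys = as @ x # bs" by (meson split_list)
  have m: "mset xs = mset (as @ bs)" using Cons.prems(4) ys by simp
  have P: "P (as @ x # bs)" using perm[OF Cons.prems(4,3)] ys by simp
  have "f (x # xs) = f (x # as @ bs)"
  proof (rule Cons.IH[of "\<lambda>zs. P (x # zs)" "\<lambda>zs. f (x # zs)", OF _ _ _ m])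
    show "f (x # cs @ p # q # ds) = f (x # cs @ q # p # ds)" if "P (x # cs @ p # q # ds)" for cs p q ds
      using swap[of "x # cs"] that by simp
    show "P (x # ds)" if "mset cs = mset ds" "P (x # cs)" for cs ds
      using perm[OF _ that(2)] that(1) by simp
  qed fact
  also have "\<dots> = f ys" unfolding ys
    by (rule move_to_front[where P = P and f = f, OF swap perm P])
  finally show ?case .
qed

lemma sorted_wrt_perm:
  assumes "mset xs = mset ys" "sorted_wrt R xs" "\<And>x y. R x y \<Longrightarrow> R y x"
  shows "sorted_wrt R ys"
  using assms(1,2)
proof (induction xs arbitrary: ys)
  case Nil
  then show ?case by simp
next
  case (Cons x xs)
  then have "x \<in> set ys" by (metis list.set_intros(1) set_mset_mset)
  then obtain as bs where ys: "ys = as @ x # bs" by (meson split_list)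
  then have m: "mset xs = mset (as @ bs)" using Cons.prems by simp
  then have "set xs = set (as @ bs)" by (metis set_mset_mset)
  moreover have "\<forall>z\<in>set xs. R x z \<and> R z x" "sorted_wrt R (as @ bs)"
    using Cons.prems(2) Cons.IH[OF m] assms(3) by simp_all
  ultimately show ?case by (simp add: ys sorted_wrt_append)
qed

context six_vertex
begin

text \<open>Both upper edges leave the crossing, so both lower edges enter it. A crossing that
  reaches the top of a rectangle thus costs only a scalar.\<close>

lemma cross_top: "cross u v True True s1 s2 = of_bool (s1 \<and> s2) * sigma (a\<^sup>2 * inverse u * v)"
  by (cases s1; cases s2) (simp_all add: cross_def vwt_def power2_eq_square mult_ac)

lemma cross_bottom: "cross u v q1 q2 False False = of_bool (\<not> q1 \<and> \<not> q2) * sigma (a\<^sup>2 * inverse u * v)"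
  by (cases q1; cases q2) (simp_all add: cross_def vwt_def power2_eq_square mult_ac)

lemma cross_rotate: "cross u v (\<not> q2) (\<not> q1) (\<not> p2) (\<not> p1) = cross u v p1 p2 q1 q2"
  using vwt_rotate[of "u * inverse a * inverse v" "\<not> q2" "\<not> p1" q1 p2] by (simp add: cross_def)

lemma psi_exchange_tops:
  assumes "0 \<notin> set xs" "u \<noteq> 0" "v \<noteq> 0" "length pa = length as" "length pb = length bs"
  shows "(\<Sum>q1\<in>UNIV. \<Sum>q2\<in>UNIV. psi xs (as @ u # v # bs) (tops (as @ u # v # bs)) (pa @ q1 # q2 # pb) *
      cross u v q1 q2 p1 p2) =
    sigma (a\<^sup>2 * inverse u * v) * psi xs (as @ v # u # bs) (tops (as @ v # u # bs)) (pa @ p1 # p2 # pb)"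
  using psi_exchange[OF assms(1-3), of "tops as" as pa "tops bs" bs pb True True p1 p2] assms
  by (simp add: replicate_add replicate_app_Cons_same cross_top UNIV_bool)

text \<open>Both orders of each pair are listed so that the relation is symmetric and the condition
  survives permutations.\<close>

definition swappable :: "complex list \<Rightarrow> bool" where
  "swappable zs \<longleftrightarrow> 0 \<notin> set zs \<and>
    sorted_wrt (\<lambda>z w. sigma (a\<^sup>2 * inverse z * w) \<noteq> 0 \<and> sigma (a\<^sup>2 * inverse w * z) \<noteq> 0) zs"

lemma swappable_perm: "mset as = mset bs \<Longrightarrow> swappable as \<Longrightarrow> swappable bs"
  unfolding swappable_def by (auto elim!: sorted_wrt_perm dest: mset_eq_setD)

lemma swappable_adjacent:
  assumes "swappable (as @ u # v # bs)"
  shows "u \<noteq> 0" "v \<noteq> 0" "sigma (a\<^sup>2 * inverse u * v) \<noteq> 0"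
  using assms by (auto simp: swappable_def sorted_wrt_append)

lemma psi_perm_rows:
  assumes "swappable xs" "mset xs = mset xs'"
    and "0 \<notin> set ys" "length ts = length ys" "length bs = length ys"
  shows "psi xs ys ts bs = psi xs' ys ts bs"
proof (rule perm_invariant[where P = swappable])
  show "psi (as @ p # q # zs) ys ts bs = psi (as @ q # p # zs) ys ts bs"
    if "swappable (as @ p # q # zs)" for as p q zs
    using swappable_adjacent[OF that] assms
    by (intro psi_swap_rows) (simp_all add: mult_ac)
qed (fact swappable_perm assms(1,2))+

lemma domain_wall_perm_rows:
  "swappable xs \<Longrightarrow> mset xs = mset xs' \<Longrightarrow> 0 \<notin> set ys \<Longrightarrow> domain_wall xs ys = domain_wall xs' ys"
  unfolding domain_wall_def by (rule psi_perm_rows) simp_all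

lemma half_turn_perm_rows:
  "swappable xs \<Longrightarrow> mset xs = mset xs' \<Longrightarrow> 0 \<notin> set ys \<Longrightarrow> half_turn xs ys = half_turn xs' ys"
  unfolding half_turn_def
  by (intro sum.cong refl psi_perm_rows) (auto simp: bool_lists_def)

lemma split_turn_perm_rows:
  "swappable xs \<Longrightarrow> mset xs = mset xs' \<Longrightarrow> 0 \<notin> set ys \<Longrightarrow> u \<noteq> 0 \<Longrightarrow> v \<noteq> 0 \<Longrightarrow>
    split_turn s xs ys u v = split_turn s xs' ys u v"
  unfolding split_turn_def
  by (intro sum.cong refl psi_perm_rows) (auto simp: bool_lists_def)

text \<open>The crossing is frozen at the bottom as well as at the top, with the same
  weight.\<close>

lemma domain_wall_perm_columns:
  assumes "swappable ys" "mset ys = mset ys'" "0 \<notin> set xs"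
  shows "domain_wall xs ys = domain_wall xs ys'"
proof (rule perm_invariant[where P = swappable])
  show "domain_wall xs (as @ p # q # zs) = domain_wall xs (as @ q # p # zs)"
    if "swappable (as @ p # q # zs)" for as p q zs
    using swappable_adjacent[OF that] assms(3)
      psi_exchange_tops[of xs p q "replicate (length as) False" as "replicate (length zs) False" zs False False]
    by (simp add: domain_wall_def UNIV_bool cross_bottom replicate_add replicate_app_Cons_same)
qed (fact swappable_perm assms(1,2))+

text \<open>Common form of the half-turn models, whose summed bottom edges do not freeze a crossing.
  \<open>K\<close> relates the edges below the upper half to those above the lower half: equality in
  the even model, the middle row in the odd one. \<open>cs\<close> are the columns in the centre and
  \<open>es\<close> their lower edges.\<close>

definition turn_sum :: "(complex list \<Rightarrow> bool list \<Rightarrow> bool list \<Rightarrow> complex) \<Rightarrow> complex list \<Rightarrow>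
    bool list \<Rightarrow> complex list \<Rightarrow> complex list \<Rightarrow> complex" where
  "turn_sum K cs es xs ys = (\<Sum>ps\<in>bool_lists (length ys). \<Sum>qs\<in>bool_lists (length ys).
     psi xs (ys @ cs @ rev ys) (tops (ys @ cs @ rev ys)) (ps @ es @ rev (map Not qs)) * K ys ps qs)"

definition intertwines :: "(complex list \<Rightarrow> bool list \<Rightarrow> bool list \<Rightarrow> complex) \<Rightarrow> bool" where
  "intertwines K \<longleftrightarrow> (\<forall>as bs u v ta tb pa pb t1 t2 p1 p2.
     u \<noteq> 0 \<longrightarrow> v \<noteq> 0 \<longrightarrow> length ta = length as \<longrightarrow> length pa = length as \<longrightarrow>
     length tb = length bs \<longrightarrow> length pb = length bs \<longrightarrow>
     (\<Sum>q1\<in>UNIV. \<Sum>q2\<in>UNIV. K (as @ u # v # bs) (ta @ t1 # t2 # tb) (pa @ q1 # q2 # pb) *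
        cross u v q1 q2 p1 p2) =
     (\<Sum>s1\<in>UNIV. \<Sum>s2\<in>UNIV. cross u v t1 t2 s1 s2 *
        K (as @ v # u # bs) (ta @ s1 # s2 # tb) (pa @ p1 # p2 # pb)))"

lemma intertwines_row: "x \<noteq> 0 \<Longrightarrow> intertwines (\<lambda>ys. row x ys l r)"
  unfolding intertwines_def by (intro allI impI row_exchange)

lemma intertwines_delta: "intertwines (\<lambda>ys ps qs. of_bool (ps = qs))"
  unfolding intertwines_def
  by (auto simp: UNIV_bool simp del: sum_mult_of_bool_eq sum_of_bool_mult_eq)

lemma turn_sum_swap:
  assumes K: "intertwines K" and "0 \<notin> set xs" "u \<noteq> 0" "v \<noteq> 0" "sigma (a\<^sup>2 * inverse u * v) \<noteq> 0"
    and "length es = length cs"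
  shows "turn_sum K cs es xs (as @ v # u # bs) = turn_sum K cs es xs (as @ u # v # bs)"
proof -
  let ?n = "\<lambda>p :: bool \<times> bool. (\<not> snd p, \<not> fst p)"
  \<comment> \<open>The order of the pair in the right half is given independently of
    \<open>ys\<close>, so that the mixed rectangle \<open>X\<close> of
    \<open>double_sum_exchange\<close> is covered too.\<close>
  let ?psi = "\<lambda>ys u v pa pb qa qb p q. psi xs (ys @ cs @ rev bs @ u # v # rev as)
    (tops (ys @ cs @ rev bs @ u # v # rev as))
    (pa @ fst p # snd p # pb @ es @ rev (map Not qb) @ fst q # snd q # rev (map Not qa))"
  let ?Ba = "bool_lists (length as)" and ?Bb = "bool_lists (length bs)"
  have decomp: "turn_sum K cs es xs (as @ w # z # bs) =
    (\<Sum>pa\<in>?Ba. \<Sum>pb\<in>?Bb. \<Sum>qa\<in>?Ba. \<Sum>qb\<in>?Bb. \<Sum>p\<in>UNIV. \<Sum>q\<in>UNIV.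
       ?psi (as @ w # z # bs) z w pa pb qa qb p (?n q) *
       K (as @ w # z # bs) (pa @ fst p # snd p # pb) (qa @ fst q # snd q # qb))" for w z
  proof -
    have "turn_sum K cs es xs (as @ w # z # bs) =
      (\<Sum>pa\<in>?Ba. \<Sum>pb\<in>?Bb. \<Sum>p\<in>UNIV. \<Sum>qa\<in>?Ba. \<Sum>qb\<in>?Bb. \<Sum>q\<in>UNIV.
       ?psi (as @ w # z # bs) z w pa pb qa qb p (?n q) *
       K (as @ w # z # bs) (pa @ fst p # snd p # pb) (qa @ fst q # snd q # qb))"
      by (simp add: turn_sum_def sum_bool_lists_pair_prod)
    also have "\<dots> = (\<Sum>pa\<in>?Ba. \<Sum>pb\<in>?Bb. \<Sum>qa\<in>?Ba. \<Sum>qb\<in>?Bb. \<Sum>p\<in>UNIV. \<Sum>q\<in>UNIV.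
       ?psi (as @ w # z # bs) z w pa pb qa qb p (?n q) *
       K (as @ w # z # bs) (pa @ fst p # snd p # pb) (qa @ fst q # snd q # qb))"
      by (rule sum.cong[OF refl], rule sum.cong[OF refl], subst sum.swap, rule sum.cong[OF refl],
          rule sum.swap)
    finally show ?thesis .
  qed
  have core: "(\<Sum>p\<in>UNIV. \<Sum>q\<in>UNIV. ?psi (as @ v # u # bs) u v pa pb qa qb p (?n q) *
       K (as @ v # u # bs) (pa @ fst p # snd p # pb) (qa @ fst q # snd q # qb)) =
     (\<Sum>p\<in>UNIV. \<Sum>q\<in>UNIV. ?psi (as @ u # v # bs) v u pa pb qa qb p (?n q) *
       K (as @ u # v # bs) (pa @ fst p # snd p # pb) (qa @ fst q # snd q # qb))"
    if mem: "pa \<in> ?Ba" "pb \<in> ?Bb" "qa \<in> ?Ba" "qb \<in> ?Bb" for pa pb qa qb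
  proof (rule double_sum_exchange[where n = ?n and w = "sigma (a\<^sup>2 * inverse u * v)"
        and c = "\<lambda>p q. cross u v (fst p) (snd p) (fst q) (snd q)"])
    from mem have len: "length pa = length as" "length pb = length bs" "length qa = length as"
      "length qb = length bs" by (auto simp: bool_lists_def)
    show "(\<Sum>i\<in>UNIV. ?psi (as @ u # v # bs) u v pa pb qa qb i (?n q) * cross u v (fst i) (snd i) (fst p) (snd p)) =
      sigma (a\<^sup>2 * inverse u * v) * ?psi (as @ v # u # bs) u v pa pb qa qb p (?n q)" for p q
      using psi_exchange_tops[OF assms(2-4), of pa as "pb @ es @ rev (map Not qb) @ fst (?n q) # snd (?n q) # rev (map Not qa)"
          "bs @ cs @ rev bs @ u # v # rev as" "fst p" "snd p"] len assms
      by (simp add: sum.cartesian_product case_prod_unfold)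
    show "(\<Sum>e\<in>UNIV. ?psi (as @ u # v # bs) u v pa pb qa qb i e * cross u v (fst e) (snd e) (fst (?n p)) (snd (?n p))) =
      sigma (a\<^sup>2 * inverse u * v) * ?psi (as @ u # v # bs) v u pa pb qa qb i (?n p)" for i p
      using psi_exchange_tops[OF assms(2-4), of "pa @ fst i # snd i # pb @ es @ rev (map Not qb)"
          "as @ u # v # bs @ cs @ rev bs" "rev (map Not qa)" "rev as" "fst (?n p)" "snd (?n p)"] len assms
      by (simp add: sum.cartesian_product case_prod_unfold)
    show "cross u v (fst (?n q)) (snd (?n q)) (fst (?n p)) (snd (?n p)) =
      cross u v (fst p) (snd p) (fst q) (snd q)" for p q
      by (simp add: cross_rotate)
    show "(\<Sum>r\<in>UNIV. K (as @ u # v # bs) (pa @ fst i # snd i # pb) (qa @ fst r # snd r # qb) *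
        cross u v (fst r) (snd r) (fst q) (snd q)) =
      (\<Sum>s\<in>UNIV. cross u v (fst i) (snd i) (fst s) (snd s) *
         K (as @ v # u # bs) (pa @ fst s # snd s # pb) (qa @ fst q # snd q # qb))" for i q
      using K[unfolded intertwines_def, rule_format, OF assms(3,4), of pa as qa pb bs qb "fst i" "snd i" "fst q" "snd q"] len
      by (simp add: sum.cartesian_product case_prod_unfold)
  qed (use assms in simp_all)
  show ?thesis
    unfolding decomp
    by (rule sum.cong[OF refl], rule sum.cong[OF refl], rule sum.cong[OF refl],
        rule sum.cong[OF refl], rule core)
qed

lemma half_turn_eq_turn_sum: "half_turn xs ys = turn_sum (\<lambda>ys ps qs. of_bool (ps = qs)) [] [] xs ys"
  unfolding half_turn_def turn_sum_def
  by (intro sum.cong refl) (simp add: mult.commute[of _ "of_bool _"] sum_bool_lists_delta replicate_add del: sum_of_bool_mult_eq)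

lemma odd_turn_eq_turn_sum: "odd_turn s xs x ys v = turn_sum (\<lambda>ys. row x ys True s) [v] [s] xs ys"
  by (simp add: odd_turn_def turn_sum_def replicate_add replicate_app_Cons_same)

lemma half_turn_perm_columns:
  assumes "swappable ys" "mset ys = mset ys'" "0 \<notin> set xs"
  shows "half_turn xs ys = half_turn xs ys'"
proof (rule perm_invariant[where P = swappable])
  show "half_turn xs (as @ p # q # zs) = half_turn xs (as @ q # p # zs)"
    if "swappable (as @ p # q # zs)" for as p q zs
    unfolding half_turn_eq_turn_sum
    by (rule turn_sum_swap[symmetric]) (use swappable_adjacent[OF that] assms(3) in \<open>simp_all add: intertwines_delta\<close>)
qed (fact swappable_perm assms(1,2))+

lemma odd_turn_perm_columns:
  assumes "swappable ys" "mset ys = mset ys'" "0 \<notin> set xs" "x \<noteq> 0"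
  shows "odd_turn s xs x ys v = odd_turn s xs x ys' v"
proof (rule perm_invariant[where P = swappable])
  show "odd_turn s xs x (as @ p # q # zs) v = odd_turn s xs x (as @ q # p # zs) v"
    if "swappable (as @ p # q # zs)" for as p q zs
    unfolding odd_turn_eq_turn_sum
    by (rule turn_sum_swap[symmetric]) (use swappable_adjacent[OF that] assms(3,4) in \<open>simp_all add: intertwines_row\<close>)
qed (fact swappable_perm assms(1,2))+

end

subsection \<open>Degrees and interpolation\<close>

text \<open>Up to the factor \<open>x ^ d\<close>, the function is a polynomial of degree at most \<open>d\<close> in \<open>x\<^sup>2\<close>; for
  negative \<open>d\<close> it vanishes at all nonzero arguments.\<close>

definition laurent :: "int \<Rightarrow> (complex \<Rightarrow> complex) \<Rightarrow> bool" where
  "laurent d f \<longleftrightarrow> (\<exists>p. (\<forall>x. x \<noteq> 0 \<longrightarrow> f x = poly p (x\<^sup>2) * x powi (- d)) \<and> (p \<noteq> 0 \<longrightarrow> int (degree p) \<le> d))"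

lemma laurent_zero: "(\<And>x. x \<noteq> 0 \<Longrightarrow> f x = 0) \<Longrightarrow> laurent d f"
  unfolding laurent_def by (intro exI[of _ 0]) simp

lemma laurent_const: "laurent 0 (\<lambda>x. c)"
  unfolding laurent_def by (intro exI[of _ "[:c:]"]) simp

lemma laurent_sigma: "laurent 1 (\<lambda>x. sigma (c * x))"
  unfolding laurent_def
  by (intro exI[of _ "[:- inverse c, c:]"])
    (auto simp: sigma_def power_int_minus power2_eq_square field_simps)

lemma laurent_sigma_inverse: "laurent 1 (\<lambda>x. sigma (c * inverse x))"
  unfolding laurent_def
  by (intro exI[of _ "[:c, - inverse c:]"])
    (auto simp: sigma_def power_int_minus power2_eq_square field_simps)

lemma laurent_mult:
  assumes "laurent d f" "laurent e g"
  shows "laurent (d + e) (\<lambda>x. f x * g x)"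
proof -
  obtain p q where
    p: "\<And>x. x \<noteq> 0 \<Longrightarrow> f x = poly p (x\<^sup>2) * x powi (- d)" "p \<noteq> 0 \<Longrightarrow> int (degree p) \<le> d" and
    q: "\<And>x. x \<noteq> 0 \<Longrightarrow> g x = poly q (x\<^sup>2) * x powi (- e)" "q \<noteq> 0 \<Longrightarrow> int (degree q) \<le> e"
    using assms unfolding laurent_def by auto
  have "f x * g x = poly (p * q) (x\<^sup>2) * x powi (- (d + e))" if "x \<noteq> 0" for x
    using that by (simp add: p(1) q(1) power_int_add[of x "- d" "- e", simplified] mult_ac)
  moreover have "int (degree (p * q)) \<le> d + e" if "p * q \<noteq> 0"
    using degree_mult_le[of p q] p(2) q(2) that by fastforce
  ultimately show ?thesis unfolding laurent_def by blast
qed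

lemma laurent_add:
  assumes "laurent d f" "laurent d g"
  shows "laurent d (\<lambda>x. f x + g x)"
proof -
  obtain p q where
    p: "\<And>x. x \<noteq> 0 \<Longrightarrow> f x = poly p (x\<^sup>2) * x powi (- d)" "p \<noteq> 0 \<Longrightarrow> int (degree p) \<le> d" and
    q: "\<And>x. x \<noteq> 0 \<Longrightarrow> g x = poly q (x\<^sup>2) * x powi (- d)" "q \<noteq> 0 \<Longrightarrow> int (degree q) \<le> d"
    using assms unfolding laurent_def by auto
  have "int (degree (p + q)) \<le> d" if "p + q \<noteq> 0"
  proof (cases "p = 0 \<or> q = 0")
    case True
    then show ?thesis using p(2) q(2) that by auto
  next
    case False
    then show ?thesis using degree_add_le_max[of p q] p(2) q(2) by fastforce
  qed
  then show ?thesis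
    unfolding laurent_def by (intro exI[of _ "p + q"]) (simp add: p(1) q(1) distrib_right)
qed

lemma laurent_cmult: "laurent d f \<Longrightarrow> laurent d (\<lambda>x. c * f x)"
  using laurent_mult[OF laurent_const] by simp

lemma laurent_multc: "laurent d f \<Longrightarrow> laurent d (\<lambda>x. f x * c)"
  using laurent_mult[OF _ laurent_const] by simp

lemma laurent_minus: "laurent d f \<Longrightarrow> laurent d g \<Longrightarrow> laurent d (\<lambda>x. f x - g x)"
  using laurent_add[of d f "\<lambda>x. - 1 * g x"] laurent_cmult[of d g "- 1"] by simp

lemma laurent_sum:
  assumes "finite I" "\<And>i. i \<in> I \<Longrightarrow> laurent d (f i)"
  shows "laurent d (\<lambda>x. \<Sum>i\<in>I. f i x)"
  using assms by (induction I rule: finite_induct) (auto intro: laurent_zero laurent_add)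

text \<open>Multiplying the polynomial by its variable, the square of \<open>x\<close>, raises the
  degree by two; the parity of \<open>d\<close> is fixed by the power of \<open>x\<close>.\<close>

lemma laurent_mono:
  assumes "laurent d f" "e = d + 2 * int k"
  shows "laurent e f"
  unfolding assms(2)
proof (induction k)
  case 0
  then show ?case using assms by simp
next
  case (Suc k)
  then obtain p where p: "\<And>x. x \<noteq> 0 \<Longrightarrow> f x = poly p (x\<^sup>2) * x powi (- (d + 2 * int k))"
    "p \<noteq> 0 \<Longrightarrow> int (degree p) \<le> d + 2 * int k"
    unfolding laurent_def by auto
  have "f x = poly (pCons 0 p) (x\<^sup>2) * x powi (- (d + 2 * int (Suc k)))" if "x \<noteq> 0" for x
    using that p(1)[OF that] power_int_add[of x 2 "- (d + 2 * int (Suc k))"] by (simp add: algebra_simps)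
  then show ?case
    unfolding laurent_def using p(2) by (intro exI[of _ "pCons 0 p"]) (auto simp: algebra_simps)
qed

lemma laurent_eq_0:
  assumes "laurent d f" "finite S" "int (card S) > d"
    and roots: "\<And>s. s \<in> S \<Longrightarrow> \<exists>x. x \<noteq> 0 \<and> x\<^sup>2 = s \<and> f x = 0"
    and "x \<noteq> 0"
  shows "f x = 0"
proof -
  obtain p where p: "\<And>x. x \<noteq> 0 \<Longrightarrow> f x = poly p (x\<^sup>2) * x powi (- d)" "p \<noteq> 0 \<Longrightarrow> int (degree p) \<le> d"
    using assms(1) unfolding laurent_def by auto
  have "p = 0"
  proof (rule ccontr)
    assume "p \<noteq> 0"
    have "S \<subseteq> {s. poly p s = 0}"
      using roots p(1) by fastforce
    then have "card S \<le> card {s. poly p s = 0}"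
      by (rule card_mono[OF poly_roots_finite[OF \<open>p \<noteq> 0\<close>]])
    also have "\<dots> \<le> degree p" by (rule card_poly_roots_bound[OF \<open>p \<noteq> 0\<close>])
    finally have "card S \<le> degree p" .
    with p(2) \<open>p \<noteq> 0\<close> assms(3) show False by simp
  qed
  then show ?thesis using p(1) \<open>x \<noteq> 0\<close> by simp
qed

text \<open>Column parameters in which \<^const>\<open>None\<close> marks the occurrences of the variable.  A column with
  parameter \<open>u\<close> and \<open>m\<close> vertices has degree \<open>m\<close> in \<open>u\<close> if its two ends agree, and \<open>m - 1\<close> otherwise.\<close>

definition inst :: "complex option list \<Rightarrow> complex \<Rightarrow> complex list" where
  "inst cs u = map (\<lambda>c. case c of None \<Rightarrow> u | Some y \<Rightarrow> y) cs"

fun defect :: "complex option list \<Rightarrow> bool list \<Rightarrow> bool list \<Rightarrow> int" where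
  "defect (None # cs) (t # ts) (b # bs) = of_bool (t \<noteq> b) + defect cs ts bs"
| "defect (Some y # cs) (t # ts) (b # bs) = defect cs ts bs"
| "defect _ _ _ = 0"

definition occs :: "complex option list \<Rightarrow> int" where
  "occs cs = int (length (filter (\<lambda>c. c = None) cs))"

lemma defect_append:
  "length ts1 = length cs1 \<Longrightarrow> length bs1 = length cs1 \<Longrightarrow>
    defect (cs1 @ cs2) (ts1 @ ts2) (bs1 @ bs2) = defect cs1 ts1 bs1 + defect cs2 ts2 bs2"
  by (induction cs1 ts1 bs1 rule: defect.induct) auto

lemma defect_Some [simp]: "defect (map Some ys) ts bs = 0"
  by (induction ys arbitrary: ts bs) (case_tac ts; case_tac bs; simp; fail)+

lemma defect_refl [simp]: "defect cs ts ts = 0"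
proof (induction cs arbitrary: ts)
  case (Cons c cs)
  then show ?case by (cases c; cases ts) auto
qed simp

text \<open>A column with different ends changes exactly once along the way, one with equal ends
  twice or never. The excess is even, as \<open>laurent_mono\<close> requires.\<close>

lemma defect_triangle:
  assumes "length ts = length cs" "length qs = length cs" "length bs = length cs"
  shows "\<exists>k. defect cs ts qs + defect cs qs bs = defect cs ts bs + 2 * int k"
  using assms
proof (induction cs arbitrary: ts qs bs)
  case Nil
  then show ?case by (auto intro: exI[of _ 0])
next
  case (Cons c cs)
  then obtain t ts' q qs' b bs' where [simp]: "ts = t # ts'" "qs = q # qs'" "bs = b # bs'"
    by (auto simp: length_Suc_conv)
  obtain k where k: "defect cs ts' qs' + defect cs qs' bs' = defect cs ts' bs' + 2 * int k"
    using Cons.IH[of ts' qs' bs'] Cons.prems by auto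
  then show ?case
    by (intro exI[of _ "k + of_bool (c = None \<and> t = b \<and> t \<noteq> q)"])
      (cases c; cases t; cases q; cases b; simp)
qed

context six_vertex
begin

text \<open>Types 1 and 2, with constant weight, are those whose left and right edges
  differ.\<close>

lemma laurent_vwt_row: "laurent (1 - of_bool (l \<noteq> r)) (\<lambda>x. vwt a (x * inverse y) l r t b)"
proof -
  have "laurent 1 (\<lambda>x. sigma (a * (x * inverse y)))" "laurent 1 (\<lambda>x. sigma (a * inverse (x * inverse y)))"
    using laurent_sigma[of "a * inverse y"] laurent_sigma_inverse[of "a * y"]
    by (simp_all add: mult_ac)
  then show ?thesis
    by (cases l; cases r; cases t; cases b) (auto simp: vwt_def intro: laurent_zero laurent_const)
qed

lemma laurent_vwt_column: "laurent (1 - of_bool (t \<noteq> b)) (\<lambda>y. vwt a (x * inverse y) l r t b)"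
proof -
  have "laurent 1 (\<lambda>y. sigma (a * (x * inverse y)))" "laurent 1 (\<lambda>y. sigma (a * inverse (x * inverse y)))"
    using laurent_sigma_inverse[of "a * x"] laurent_sigma[of "a * inverse x"]
    by (simp_all add: mult_ac)
  then show ?thesis
    by (cases l; cases r; cases t; cases b) (auto simp: vwt_def intro: laurent_zero laurent_const)
qed

lemma laurent_row:
  assumes "length ts = length ys" "length bs = length ys"
  shows "laurent (int (length ys) - of_bool (l \<noteq> r)) (\<lambda>x. row x ys l r ts bs)"
  using assms
proof (induction ys arbitrary: ts bs l)
  case Nil
  then show ?case by (cases "l = r") (auto intro: laurent_zero laurent_const)
next
  case (Cons y ys)
  then obtain t ts' b bs' where [simp]: "ts = t # ts'" "bs = b # bs'"
    by (auto simp: length_Suc_conv)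
  \<comment> \<open>Only a detour, with \<open>k\<close> different from equal ends \<open>l\<close>
    and \<open>r\<close>, falls short of the bound, and then by two.\<close>
  have "laurent (int (length (y # ys)) - of_bool (l \<noteq> r))
      (\<lambda>x. vwt a (x * inverse y) l k t b * row x ys k r ts' bs')" for k
    by (rule laurent_mono[OF laurent_mult[OF laurent_vwt_row Cons.IH],
          where k = "of_bool (l = r \<and> l \<noteq> k)"]) (use Cons.prems in auto)
  then show ?case by (simp only: row.simps \<open>ts = _\<close> \<open>bs = _\<close>) (rule laurent_sum, auto)
qed

lemma psi_single: "length bs = length ys \<Longrightarrow> psi [x] ys ts bs = row x ys True False ts bs"
  by (simp add: psi_def grid_single del: grid.simps)

lemma laurent_psi_last_row:
  assumes "length ts = length ys" "length bs = length ys"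
  shows "laurent (int (length ys) - 1) (\<lambda>x. psi (xs @ [x]) ys ts bs)"
proof -
  have "laurent (int (length ys) - 1) (\<lambda>x. psi xs ys ts qs * row x ys True False qs bs)"
    if "qs \<in> bool_lists (length ys)" for qs
    using laurent_row[of qs ys bs True False] assms that by (auto simp: bool_lists_def intro: laurent_cmult)
  moreover have "psi (xs @ [x]) ys ts bs =
    (\<Sum>qs\<in>bool_lists (length ys). psi xs ys ts qs * row x ys True False qs bs)" for x
    using assms by (simp add: psi_append psi_single)
  ultimately show ?thesis by (auto intro: laurent_sum)
qed

lemma laurent_row_column:
  assumes "length ts = length cs" "length bs = length cs"
  shows "laurent (occs cs - defect cs ts bs) (\<lambda>u. row x (inst cs u) l r ts bs)"
  using assms
proof (induction cs arbitrary: ts bs l)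
  case Nil
  then show ?case by (auto simp: inst_def occs_def intro: laurent_const)
next
  case (Cons c cs)
  then obtain t ts' b bs' where [simp]: "ts = t # ts'" "bs = b # bs'"
    by (auto simp: length_Suc_conv)
  have IH: "laurent (occs cs - defect cs ts' bs') (\<lambda>u. row x (inst cs u) k r ts' bs')" for k
    using Cons by auto
  have "laurent (occs (c # cs) - defect (c # cs) ts bs)
      (\<lambda>u. vwt a (x * inverse (case c of None \<Rightarrow> u | Some y \<Rightarrow> y)) l k t b * row x (inst cs u) k r ts' bs')" for k
  proof (cases c)
    case None
    then show ?thesis
      using laurent_mult[OF laurent_vwt_column IH, of t b x l k k] by (simp add: occs_def algebra_simps)
  next
    case (Some y)
    then show ?thesis
      using laurent_cmult[OF IH] by (simp add: occs_def)
  qed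
  then show ?case by (simp only: inst_def list.map row.simps \<open>ts = _\<close> \<open>bs = _\<close>) (rule laurent_sum, auto)
qed

lemma laurent_psi_column:
  assumes "length ts = length cs" "length bs = length cs"
  shows "laurent (int (length xs) * occs cs - defect cs ts bs) (\<lambda>u. psi xs (inst cs u) ts bs)"
  using assms
proof (induction xs arbitrary: ts)
  case Nil
  then show ?case by (cases "ts = bs") (auto intro: laurent_zero laurent_const)
next
  case (Cons x xs)
  have "laurent (int (length (x # xs)) * occs cs - defect cs ts bs)
      (\<lambda>u. row x (inst cs u) True False ts qs * psi xs (inst cs u) qs bs)"
    if "qs \<in> bool_lists (length cs)" for qs
  proof -
    have len: "length qs = length cs" using that by (simp add: bool_lists_def)
    obtain k where k: "defect cs ts qs + defect cs qs bs = defect cs ts bs + 2 * int k"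
      using defect_triangle[of ts cs qs bs] Cons.prems len by auto
    show ?thesis
      by (rule laurent_mono[OF laurent_mult[OF laurent_row_column Cons.IH], where k = k])
        (use Cons.prems len k in \<open>auto simp: algebra_simps\<close>)
  qed
  then show ?case by (auto simp: psi_Cons inst_def intro!: laurent_sum)
qed

lemma laurent_domain_wall_row: "laurent (int (length ys) - 1) (\<lambda>x. domain_wall (xs @ [x]) ys)"
  unfolding domain_wall_def by (rule laurent_psi_last_row) simp_all

lemma laurent_half_turn_row: "laurent (2 * int (length ys) - 1) (\<lambda>x. half_turn (xs @ [x]) ys)"
proof -
  have "laurent (2 * int (length ys) - 1)
      (\<lambda>x. psi (xs @ [x]) (ys @ rev ys) (tops ys @ tops ys) (ps @ rev (map Not ps)))"
    if "ps \<in> bool_lists (length ys)" for ps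
    using laurent_psi_last_row[of "tops ys @ tops ys" "ys @ rev ys" "ps @ rev (map Not ps)" xs] that
    by (simp add: bool_lists_def)
  then show ?thesis unfolding half_turn_def by (auto intro: laurent_sum)
qed

text \<open>Only the middle row contains \<open>x\<close>; it starts with an edge pointing right, so
  its ends differ exactly if \<open>s\<close> is false.\<close>

lemma laurent_odd_turn_row: "laurent (int (length ys) - of_bool (\<not> s)) (\<lambda>x. odd_turn s xs x ys v)"
proof -
  have *: "laurent (int (length ys) - of_bool (\<not> s)) (\<lambda>x. c * row x ys True s ps qs)"
    if "ps \<in> bool_lists (length ys)" "qs \<in> bool_lists (length ys)" for c ps qs
    using laurent_cmult[OF laurent_row[of ps ys qs True s]] that by (cases s) (simp_all add: bool_lists_def)
  show ?thesis unfolding odd_turn_def by (intro laurent_sum finite_bool_lists *)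
qed

lemma laurent_domain_wall_column: "laurent (int (length xs) - 1) (\<lambda>u. domain_wall xs (ys @ [u]))"
proof -
  let ?cs = "map Some ys @ [None]"
  have "defect ?cs (tops ys @ [True]) (replicate (length ys) False @ [False]) = 1"
    by (subst defect_append) simp_all
  then show ?thesis
    using laurent_psi_column[of "tops ys @ [True]" ?cs "replicate (length ys) False @ [False]" xs]
    by (simp add: domain_wall_def inst_def comp_def occs_def replicate_append_same)
qed

lemma laurent_split_turn_column:
  "laurent (int (length xs) - of_bool (\<not> s)) (\<lambda>u. split_turn s xs ys u v)"
proof -
  let ?cs = "map Some ys @ None # Some v # map Some (rev ys)"
  have "laurent (int (length xs) - of_bool (\<not> s)) (\<lambda>u. psi xs (ys @ u # v # rev ys)
      (tops ys @ True # True # tops ys) (ps @ s # (\<not> s) # rev (map Not ps)))"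
    if "ps \<in> bool_lists (length ys)" for ps
  proof -
    have "defect ?cs (tops ys @ True # True # tops ys) (ps @ s # (\<not> s) # rev (map Not ps)) = of_bool (\<not> s)"
      using that by (subst defect_append) (simp_all add: bool_lists_def)
    then show ?thesis
      using laurent_psi_column[of "tops ys @ True # True # tops ys" ?cs
          "ps @ s # (\<not> s) # rev (map Not ps)" xs] that
      by (simp add: inst_def comp_def occs_def bool_lists_def)
  qed
  then show ?thesis unfolding split_turn_def by (auto intro: laurent_sum)
qed

text \<open>The two copies of \<open>u\<close> in the centre end with \<open>s\<close> and its
  negation below edges pointing up, so exactly one of them loses a degree.\<close>

lemma laurent_half_turn_column:
  "laurent (2 * int (length xs) - 1) (\<lambda>u. half_turn xs (ys @ [u]))"
proof -
  let ?cs = "map Some ys @ None # None # map Some (rev ys)"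
  have *: "laurent (2 * int (length xs) - 1) (\<lambda>u. psi xs (ys @ u # u # rev ys)
      (tops ys @ True # True # tops ys) (ps @ s # (\<not> s) # rev (map Not ps)))"
    if "ps \<in> bool_lists (length ys)" for ps s
  proof -
    have "defect ?cs (tops ys @ True # True # tops ys) (ps @ s # (\<not> s) # rev (map Not ps)) = 1"
      using that by (subst defect_append) (simp_all add: bool_lists_def)
    then show ?thesis
      using laurent_psi_column[of "tops ys @ True # True # tops ys" ?cs
          "ps @ s # (\<not> s) # rev (map Not ps)" xs] that
      by (simp add: inst_def comp_def occs_def bool_lists_def mult.commute[of _ 2])
  qed
  show ?thesis unfolding half_turn_snoc split_turn_def by (intro laurent_sum finite_bool_lists finite *)
qed

section \<open>Inversion of all parameters, and the exchange of the two central columns\<close>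

lemma swappable_inverse: "swappable zs \<Longrightarrow> swappable (map inverse zs)"
  unfolding swappable_def sorted_wrt_map by (auto simp: mult_ac elim!: sorted_wrt_mono_rel[rotated])

text \<open>The reflection reverses the columns, a half-turn restores them at the price of reversing
  the rows, and the symmetry in the rows repairs this.\<close>

lemma domain_wall_inverse:
  assumes "swappable xs" "0 \<notin> set ys"
  shows "domain_wall (map inverse xs) (map inverse ys) = domain_wall xs ys"
proof -
  let ?F = "replicate (length ys) False"
  have "domain_wall xs ys = domain_wall (map inverse xs) (rev (map inverse ys))"
    using psi_flip[of "tops ys" ys ?F xs] by (simp add: domain_wall_def)
  also have "\<dots> = domain_wall (rev (map inverse xs)) (map inverse ys)"
    using psi_rotate[of "tops ys" "map inverse ys" ?F "rev (map inverse xs)"]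
    by (simp add: domain_wall_def)
  also have "\<dots> = domain_wall (map inverse xs) (map inverse ys)"
    using assms swappable_perm[OF _ swappable_inverse[OF assms(1)], of "rev (map inverse xs)"]
    by (intro domain_wall_perm_rows) auto
  finally show ?thesis by simp
qed

text \<open>The column list \<open>ys @ rev ys\<close> is a palindrome, so the reflection merely
  negates the summation variable \<open>ps\<close>.\<close>

lemma half_turn_inverse: "half_turn (map inverse xs) (map inverse ys) = half_turn xs ys"
proof -
  let ?B = "bool_lists (length ys)"
  have "half_turn xs ys = (\<Sum>ps\<in>?B. psi (map inverse xs) (map inverse ys @ rev (map inverse ys))
      (tops ys @ tops ys) (map Not ps @ rev (map Not (map Not ps))))"
    unfolding half_turn_def
  proof (intro sum.cong refl)
    fix ps assume "ps \<in> ?B"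
    then show "psi xs (ys @ rev ys) (tops ys @ tops ys) (ps @ rev (map Not ps)) =
      psi (map inverse xs) (map inverse ys @ rev (map inverse ys))
      (tops ys @ tops ys) (map Not ps @ rev (map Not (map Not ps)))"
      using psi_flip[of "tops ys @ tops ys" "ys @ rev ys" "ps @ rev (map Not ps)" xs]
      by (simp add: bool_lists_def rev_map comp_def)
  qed
  also have "\<dots> = half_turn (map inverse xs) (map inverse ys)"
    using sum_bool_lists_Not[of "\<lambda>ps. psi (map inverse xs) (map inverse ys @ rev (map inverse ys))
      (tops ys @ tops ys) (ps @ rev (map Not ps))" "length ys"]
    by (simp add: half_turn_def)
  finally show ?thesis by simp
qed

text \<open>The reflection exchanges the two central columns together with their lower edges
  \<open>s\<close> and its negation.\<close>

lemma split_turn_inverse: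
  "split_turn s (map inverse xs) (map inverse ys) (inverse u) (inverse v) = split_turn (\<not> s) xs ys v u"
proof -
  let ?B = "bool_lists (length ys)"
  let ?f = "\<lambda>ps. psi (map inverse xs) (map inverse ys @ inverse u # inverse v # rev (map inverse ys))
      (tops ys @ True # True # tops ys) (ps @ s # (\<not> s) # rev (map Not ps))"
  have "split_turn (\<not> s) xs ys v u = (\<Sum>ps\<in>?B. ?f (map Not ps))"
    unfolding split_turn_def
  proof (intro sum.cong refl)
    fix ps assume "ps \<in> ?B"
    then show "psi xs (ys @ v # u # rev ys) (tops ys @ True # True # tops ys)
        (ps @ (\<not> s) # (\<not> \<not> s) # rev (map Not ps)) = ?f (map Not ps)"
      using psi_flip[of "tops ys @ True # True # tops ys" "ys @ v # u # rev ys"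
          "ps @ (\<not> s) # s # rev (map Not ps)" xs]
      by (simp add: bool_lists_def rev_map comp_def)
  qed
  also have "\<dots> = split_turn s (map inverse xs) (map inverse ys) (inverse u) (inverse v)"
    by (subst sum_bool_lists_Not[of ?f]) (simp add: split_turn_def)
  finally show ?thesis by simp
qed

text \<open>Reflecting the rectangle exchanges the roles of \<open>ps\<close> and \<open>qs\<close>,
  so the middle row has to be reflected in the horizontal axis.\<close>

lemma odd_turn_inverse:
  "odd_turn s (map inverse xs) (inverse x) (map inverse ys) (inverse v) = odd_turn s xs x ys v"
proof -
  let ?B = "bool_lists (length ys)"
  let ?f = "\<lambda>ps qs. psi (map inverse xs) (map inverse ys @ inverse v # rev (map inverse ys))
      (tops ys @ True # tops ys) (ps @ s # rev (map Not qs)) * row (inverse x) (map inverse ys) True s ps qs"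
  have "odd_turn s xs x ys v = (\<Sum>ps\<in>?B. \<Sum>qs\<in>?B. ?f (map Not qs) (map Not ps))"
    unfolding odd_turn_def
  proof (intro sum.cong refl)
    fix ps qs assume "ps \<in> ?B" "qs \<in> ?B"
    then show "psi xs (ys @ v # rev ys) (tops ys @ True # tops ys) (ps @ s # rev (map Not qs)) *
        row x ys True s ps qs = ?f (map Not qs) (map Not ps)"
      using psi_flip[of "tops ys @ True # tops ys" "ys @ v # rev ys" "ps @ s # rev (map Not qs)" xs]
        row_flip_vertical[of ps ys qs x True s]
      by (simp add: bool_lists_def rev_map comp_def)
  qed
  also have "\<dots> = (\<Sum>qs\<in>?B. \<Sum>ps\<in>?B. ?f qs ps)"
    by (subst sum.swap, subst (2) sum_bool_lists_Not[symmetric], rule sum.cong[OF refl],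
        rule sum_bool_lists_Not)
  also have "\<dots> = odd_turn s (map inverse xs) (inverse x) (map inverse ys) (inverse v)"
    by (simp add: odd_turn_def)
  finally show ?thesis by simp
qed

text \<open>A crossing of the central columns whose lower edges have opposite orientations has two
  states, one of type 1 or 2 and one of type 3 or 4.\<close>

lemma split_turn_exchange:
  assumes "0 \<notin> set xs" "u \<noteq> 0" "v \<noteq> 0"
  shows "sigma (a\<^sup>2 * inverse u * v) * split_turn s xs ys v u =
    sigma (a\<^sup>2) * split_turn s xs ys u v + sigma (u * inverse v) * split_turn (\<not> s) xs ys u v"
proof -
  let ?p = "\<lambda>ps s. psi xs (ys @ u # v # rev ys) (tops ys @ True # True # tops ys)
    (ps @ s # (\<not> s) # rev (map Not ps))"
  have "sigma (a\<^sup>2 * inverse u * v) * psi xs (ys @ v # u # rev ys) (tops ys @ True # True # tops ys)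
      (ps @ s # (\<not> s) # rev (map Not ps)) =
    sigma (a\<^sup>2) * ?p ps s + sigma (u * inverse v) * ?p ps (\<not> s)" if "ps \<in> bool_lists (length ys)" for ps
  proof -
    have eq: "a * (u * (inverse a * inverse v)) = u * inverse v" using a_nonzero by simp
    show ?thesis
      using psi_exchange_tops[OF assms, of ps ys "rev (map Not ps)" "rev ys" s "\<not> s"] that
      by (cases s) (simp_all add: bool_lists_def UNIV_bool cross_def vwt_def replicate_add
          replicate_app_Cons_same eq mult_ac add_ac)
  qed
  then show ?thesis
    unfolding split_turn_def sum_distrib_left sum.distrib[symmetric] by (intro sum.cong refl) simp
qed

end

subsection \<open>The bilinear relations\<close>

lemma sigma_eq_0_iff: "z \<noteq> 0 \<Longrightarrow> sigma z = 0 \<longleftrightarrow> z\<^sup>2 = 1"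
  by (auto simp: sigma_def field_simps power2_eq_square)

lemma laurent_binomial: "laurent 1 (\<lambda>x. x * c + inverse x * d)"
  unfolding laurent_def
  by (intro exI[of _ "[:d, c:]"]) (auto simp: power_int_minus power2_eq_square field_simps)

context six_vertex
begin

text \<open>The relations without a prime are those for \<open>P\<close>, the relations with a prime those for \<open>Q\<close>, both
  multiplied by a domain-wall partition function to avoid the quotient \<open>ZHT2\<close>.\<close>

definition odd_rel :: "complex list \<Rightarrow> complex \<Rightarrow> complex list \<Rightarrow> complex \<Rightarrow> bool" where
  "odd_rel xs x ys v \<longleftrightarrow> domain_wall (xs @ [x]) (ys @ [v]) * half_turn xs ys =
     sigma a * ((a + inverse a) * odd_turn True xs x ys v +
       (x * inverse v + inverse x * v) * odd_turn False xs x ys v) * domain_wall xs ys"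

definition odd_rel' :: "complex list \<Rightarrow> complex \<Rightarrow> complex list \<Rightarrow> complex \<Rightarrow> bool" where
  "odd_rel' xs x ys v \<longleftrightarrow> domain_wall xs ys * half_turn (xs @ [x]) (ys @ [v]) =
     sigma a * ((x * inverse v + inverse x * v) * odd_turn True xs x ys v +
       (a + inverse a) * odd_turn False xs x ys v) * domain_wall (xs @ [x]) (ys @ [v])"

definition split_rel :: "complex list \<Rightarrow> complex list \<Rightarrow> complex \<Rightarrow> complex \<Rightarrow> bool" where
  "split_rel xs ys u v \<longleftrightarrow>
     sigma (a\<^sup>2 * inverse u * v) * domain_wall xs (ys @ [v]) * half_turn xs (ys @ [u]) =
     sigma a * ((a + inverse a) * split_turn False xs ys u v +
       (u * (inverse a * inverse v) + inverse u * (a * v)) * split_turn True xs ys u v) *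
     domain_wall xs (ys @ [u])"

definition split_rel' :: "complex list \<Rightarrow> complex list \<Rightarrow> complex \<Rightarrow> complex \<Rightarrow> bool" where
  "split_rel' xs ys u v \<longleftrightarrow>
     sigma (a\<^sup>2 * inverse u * v) * domain_wall xs (ys @ [u]) * half_turn xs (ys @ [v]) =
     sigma a * ((u * (inverse a * inverse v) + inverse u * (a * v)) * split_turn False xs ys u v +
       (a + inverse a) * split_turn True xs ys u v) * domain_wall xs (ys @ [v])"

lemma swappable_zero: "swappable zs \<Longrightarrow> 0 \<notin> set zs"
  by (simp add: swappable_def)

section \<open>Reductions for a row or column in arbitrary position, and the relations at the
  nodes\<close>

lemma domain_wall_column:
  assumes "swappable (xs @ [u * inverse a])" "swappable (as @ u # bs)"
  shows "domain_wall (xs @ [u * inverse a]) (as @ u # bs) =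
    sigma (a\<^sup>2) * (\<Prod>y\<leftarrow>as @ bs. sigma (a\<^sup>2 * inverse u * y)) * (\<Prod>x\<leftarrow>xs. sigma (a * inverse x * u)) *
    domain_wall xs (as @ bs)"
proof -
  have "domain_wall (xs @ [u * inverse a]) (as @ u # bs) = domain_wall (u * inverse a # xs) (as @ u # bs)"
    using assms swappable_zero[OF assms(2)] by (intro domain_wall_perm_rows) auto
  also have "\<dots> = domain_wall (u * inverse a # xs) (u # as @ bs)"
    using assms swappable_zero[OF assms(1)] by (intro domain_wall_perm_columns) auto
  finally show ?thesis
    using domain_wall_first[of u xs "as @ bs"] swappable_zero[OF assms(2)] by simp
qed

lemma half_turn_column:
  assumes "swappable (xs @ [u * inverse a])" "swappable (as @ u # bs)"
  shows "half_turn (xs @ [u * inverse a]) (as @ u # bs) =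
    (sigma (a\<^sup>2) * (\<Prod>y\<leftarrow>as @ bs. sigma (a\<^sup>2 * inverse u * y)) * (\<Prod>x\<leftarrow>xs. sigma (a * inverse x * u)))\<^sup>2 *
    half_turn xs (as @ bs)"
proof -
  have "half_turn (xs @ [u * inverse a]) (as @ u # bs) = half_turn (u * inverse a # xs) (as @ u # bs)"
    using assms swappable_zero[OF assms(2)] by (intro half_turn_perm_rows) auto
  also have "\<dots> = half_turn (u * inverse a # xs) (u # as @ bs)"
    using assms swappable_zero[OF assms(1)] by (intro half_turn_perm_columns) auto
  finally show ?thesis
    using half_turn_first[of u xs "as @ bs"] swappable_zero[OF assms(2)] by simp
qed

lemma odd_turn_column:
  assumes "swappable (as @ u # bs)" "0 \<notin> set xs"
  shows "odd_turn s xs (u * inverse a) (as @ u # bs) v =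
    sigma (a\<^sup>2) * (\<Prod>x\<leftarrow>xs. sigma (a * inverse x * u)) * (\<Prod>y\<leftarrow>as @ bs. sigma (a\<^sup>2 * inverse u * y)) *
    split_turn (\<not> s) xs (as @ bs) u v"
proof -
  have "odd_turn s xs (u * inverse a) (as @ u # bs) v = odd_turn s xs (u * inverse a) (u # as @ bs) v"
    using assms swappable_zero[OF assms(1)] a_nonzero by (intro odd_turn_perm_columns) auto
  then show ?thesis
    using odd_turn_first_column[of u xs "as @ bs" s v] assms(2) swappable_zero[OF assms(1)] by simp
qed

lemma split_turn_row:
  assumes "swappable (as @ x # bs)" "0 \<notin> set ys" "v \<noteq> 0"
  shows "split_turn s (as @ x # bs) ys (a * x) v =
    sigma (a\<^sup>2) * sigma (a * inverse x * v) * (\<Prod>y\<leftarrow>ys. sigma (a * inverse x * y)) *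
    (\<Prod>z\<leftarrow>as @ bs. sigma (a * inverse z * (a * x))) * odd_turn (\<not> s) (as @ bs) x ys v"
proof -
  have "split_turn s (as @ x # bs) ys (a * x) v = split_turn s (x # as @ bs) ys (a * x) v"
    using assms swappable_zero[OF assms(1)] a_nonzero by (intro split_turn_perm_rows) auto
  then show ?thesis
    using split_turn_first_row[of x "as @ bs" ys s v] assms(2) swappable_zero[OF assms(1)] by simp
qed

lemma odd_rel_column:
  assumes rel: "split_rel xs (as @ bs) u v"
    and sw: "swappable (xs @ [u * inverse a])" "swappable (as @ u # bs @ [v])"
  shows "odd_rel xs (u * inverse a) (as @ u # bs) v"
proof -
  let ?w = "sigma (a\<^sup>2 * inverse u * v)"
  define f where "f = sigma (a\<^sup>2) * (\<Prod>y\<leftarrow>as @ bs. sigma (a\<^sup>2 * inverse u * y)) * (\<Prod>x\<leftarrow>xs. sigma (a * inverse x * u))"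
  have sw': "swappable (as @ u # bs)" and xs: "0 \<notin> set xs" and u: "u \<noteq> 0"
    using sw by (auto simp: swappable_def sorted_wrt_append)
  have "half_turn xs (as @ u # bs) = half_turn xs ((as @ bs) @ [u])"
    and "domain_wall xs (as @ u # bs) = domain_wall xs ((as @ bs) @ [u])"
    using sw' xs by (auto intro!: half_turn_perm_columns domain_wall_perm_columns)
  moreover have "domain_wall (xs @ [u * inverse a]) ((as @ u # bs) @ [v]) = f * ?w * domain_wall xs ((as @ bs) @ [v])"
    using domain_wall_column[OF sw] by (simp add: f_def mult_ac)
  moreover have "odd_turn s xs (u * inverse a) (as @ u # bs) v = f * split_turn (\<not> s) xs (as @ bs) u v" for s
    using odd_turn_column[OF sw' xs] by (simp add: f_def mult_ac)
  moreover have "u * inverse a * inverse v + inverse (u * inverse a) * v =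
      u * (inverse a * inverse v) + inverse u * (a * v)"
    by (simp add: mult_ac)
  moreover have "f * w * D * H = s * (A * (f * p) + B * (f * q)) * d" if "w * D * H = s * (A * p + B * q) * d"
    for w D H s A p B q d :: complex
    using that by algebra
  ultimately show ?thesis
    using rel unfolding odd_rel_def split_rel_def by simp
qed

lemma odd_rel'_column:
  assumes rel: "split_rel' xs (as @ bs) u v"
    and sw: "swappable (xs @ [u * inverse a])" "swappable (as @ u # bs @ [v])"
  shows "odd_rel' xs (u * inverse a) (as @ u # bs) v"
proof -
  let ?w = "sigma (a\<^sup>2 * inverse u * v)"
  define f where "f = sigma (a\<^sup>2) * (\<Prod>y\<leftarrow>as @ bs. sigma (a\<^sup>2 * inverse u * y)) * (\<Prod>x\<leftarrow>xs. sigma (a * inverse x * u))"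
  have sw': "swappable (as @ u # bs)" and xs: "0 \<notin> set xs" and u: "u \<noteq> 0"
    using sw by (auto simp: swappable_def sorted_wrt_append)
  have "domain_wall xs (as @ u # bs) = domain_wall xs ((as @ bs) @ [u])"
    using sw' xs by (auto intro!: domain_wall_perm_columns)
  moreover have "domain_wall (xs @ [u * inverse a]) ((as @ u # bs) @ [v]) = f * ?w * domain_wall xs ((as @ bs) @ [v])"
    using domain_wall_column[OF sw] by (simp add: f_def mult_ac)
  moreover have "half_turn (xs @ [u * inverse a]) ((as @ u # bs) @ [v]) = (f * ?w)\<^sup>2 * half_turn xs ((as @ bs) @ [v])"
    using half_turn_column[OF sw] by (simp add: f_def mult_ac)
  moreover have "odd_turn s xs (u * inverse a) (as @ u # bs) v = f * split_turn (\<not> s) xs (as @ bs) u v" for s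
    using odd_turn_column[OF sw' xs] by (simp add: f_def mult_ac)
  moreover have "u * inverse a * inverse v + inverse (u * inverse a) * v =
      u * (inverse a * inverse v) + inverse u * (a * v)"
    by (simp add: mult_ac)
  moreover have "d * ((f * w)\<^sup>2 * H) = s * (B * (f * p) + A * (f * q)) * (f * w * D)"
    if "w * d * H = s * (B * p + A * q) * D" for w D H s A p B q d :: complex
    using that by algebra
  ultimately show ?thesis
    using rel unfolding odd_rel'_def split_rel'_def by simp
qed

text \<open>Here the last row degenerates at the central column \<open>v\<close>, and
  \<open>split_turn_row\<close> with \<open>u = v\<close> turns both summands of
  \<open>half_turn\<close> into odd models. Both coefficients equal \<open>a + inverse a\<close>, so
  only the sum of the two odd functions enters.\<close>

lemma odd_rel'_last_column:
  assumes sw: "swappable (xs @ [v * inverse a])" "swappable (ys @ [v])"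
  shows "odd_rel' xs (v * inverse a) ys v"
proof -
  let ?x = "v * inverse a"
  define f where "f = sigma (a\<^sup>2) * (\<Prod>y\<leftarrow>ys. sigma (a\<^sup>2 * inverse v * y)) * (\<Prod>x\<leftarrow>xs. sigma (a * inverse x * v))"
  have v: "v \<noteq> 0" and ys: "0 \<notin> set ys"
    using sw by (auto simp: swappable_def)
  have x: "a * ?x = v" "a * inverse ?x * y = a\<^sup>2 * inverse v * y" for y
    using a_nonzero v by (simp_all add: power2_eq_square mult_ac)
  have vv: "a\<^sup>2 * inverse v * v = a\<^sup>2"
    using v by (simp add: mult.assoc)
  have "split_turn s (xs @ [?x]) ys v v = sigma (a\<^sup>2) * f * odd_turn (\<not> s) xs ?x ys v" for s
    using split_turn_row[OF sw(1) ys v, of s] unfolding x vv by (simp add: f_def mult_ac)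
  then have "half_turn (xs @ [?x]) (ys @ [v]) = sigma (a\<^sup>2) * f * (odd_turn True xs ?x ys v + odd_turn False xs ?x ys v)"
    by (simp add: half_turn_snoc UNIV_bool distrib_left)
  moreover have "domain_wall (xs @ [?x]) (ys @ [v]) = f * domain_wall xs ys"
    using domain_wall_column[OF sw] by (simp add: f_def)
  moreover have "?x * inverse v + inverse ?x * v = a + inverse a"
    using v a_nonzero by (simp add: field_simps)
  moreover have "sigma a * (a + inverse a) = sigma (a\<^sup>2)"
    by (simp add: sigma_def power2_eq_square algebra_simps)
  moreover have "d * (t * f * (p + q)) = s * (A * p + A * q) * (f * d)" if "s * A = t"
    for d t p q s A :: complex
    by (simp add: that[symmetric] algebra_simps)
  ultimately show ?thesis
    unfolding odd_rel'_def by simp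
qed

lemma split_rel_row:
  assumes rel: "odd_rel (as @ bs) x ys v"
    and sw: "swappable (as @ x # bs)" "swappable (ys @ [a * x])" "v \<noteq> 0"
  shows "split_rel (as @ x # bs) ys (a * x) v"
proof -
  let ?u = "a * x" and ?w = "sigma (a\<^sup>2 * inverse (a * x) * v)"
  define g where "g = sigma (a\<^sup>2) * (\<Prod>y\<leftarrow>ys. sigma (a\<^sup>2 * inverse ?u * y)) * (\<Prod>z\<leftarrow>as @ bs. sigma (a * inverse z * ?u))"
  have x: "x \<noteq> 0" "x = ?u * inverse a" and ys: "0 \<notin> set ys" and xs: "0 \<notin> set (as @ x # bs)"
    using sw a_nonzero by (auto simp: swappable_def)
  have ax: "a * inverse x * y = a\<^sup>2 * inverse ?u * y" for y
    using a_nonzero by (simp add: power2_eq_square)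
  have sw': "swappable ((as @ bs) @ [?u * inverse a])"
    using swappable_perm[OF _ sw(1), of "(as @ bs) @ [x]"] unfolding x(2)[symmetric] by simp
  have perm: "mset (as @ x # bs) = mset ((as @ bs) @ [?u * inverse a])"
    unfolding x(2)[symmetric] by simp
  have "domain_wall (as @ x # bs) (ys @ [v]) = domain_wall ((as @ bs) @ [x]) (ys @ [v])"
    using sw ys by (intro domain_wall_perm_rows) auto
  moreover have "domain_wall (as @ x # bs) (ys @ [?u]) = g * domain_wall (as @ bs) ys"
    using domain_wall_perm_rows[OF sw(1) perm, of "ys @ [?u]"] domain_wall_column[OF sw' sw(2)]
      swappable_zero[OF sw(2)] by (simp add: g_def)
  moreover have "half_turn (as @ x # bs) (ys @ [?u]) = g\<^sup>2 * half_turn (as @ bs) ys"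
    using half_turn_perm_rows[OF sw(1) perm, of "ys @ [?u]"] half_turn_column[OF sw' sw(2)]
      swappable_zero[OF sw(2)] by (simp add: g_def)
  moreover have "split_turn s (as @ x # bs) ys ?u v = g * ?w * odd_turn (\<not> s) (as @ bs) x ys v" for s
    using split_turn_row[OF sw(1) ys sw(3), of s] unfolding ax by (simp add: g_def mult_ac)
  moreover have "?u * (inverse a * inverse v) + inverse ?u * (a * v) = x * inverse v + inverse x * v"
    using a_nonzero x(1) sw(3) by (simp add: field_simps)
  moreover have "w * D * (g\<^sup>2 * H) = s * (A * (g * w * p) + B * (g * w * q)) * (g * d)"
    if "D * H = s * (A * p + B * q) * d" for w D H s A p B q d :: complex
    using that by algebra
  ultimately show ?thesis
    using rel unfolding odd_rel_def split_rel_def by simp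
qed

lemma split_rel'_row:
  assumes rel: "odd_rel' (as @ bs) x ys v"
    and sw: "swappable (as @ x # bs)" "swappable (ys @ [a * x])" "v \<noteq> 0"
  shows "split_rel' (as @ x # bs) ys (a * x) v"
proof -
  let ?u = "a * x" and ?w = "sigma (a\<^sup>2 * inverse (a * x) * v)"
  define g where "g = sigma (a\<^sup>2) * (\<Prod>y\<leftarrow>ys. sigma (a\<^sup>2 * inverse ?u * y)) * (\<Prod>z\<leftarrow>as @ bs. sigma (a * inverse z * ?u))"
  have x: "x \<noteq> 0" "x = ?u * inverse a" and ys: "0 \<notin> set ys" and xs: "0 \<notin> set (as @ x # bs)"
    using sw a_nonzero by (auto simp: swappable_def)
  have ax: "a * inverse x * y = a\<^sup>2 * inverse ?u * y" for y
    using a_nonzero by (simp add: power2_eq_square)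
  have sw': "swappable ((as @ bs) @ [?u * inverse a])"
    using swappable_perm[OF _ sw(1), of "(as @ bs) @ [x]"] unfolding x(2)[symmetric] by simp
  have perm: "mset (as @ x # bs) = mset ((as @ bs) @ [?u * inverse a])"
    unfolding x(2)[symmetric] by simp
  have "domain_wall (as @ x # bs) (ys @ [v]) = domain_wall ((as @ bs) @ [x]) (ys @ [v])"
    and "half_turn (as @ x # bs) (ys @ [v]) = half_turn ((as @ bs) @ [x]) (ys @ [v])"
    using sw ys by (auto intro!: domain_wall_perm_rows half_turn_perm_rows)
  moreover have "domain_wall (as @ x # bs) (ys @ [?u]) = g * domain_wall (as @ bs) ys"
    using domain_wall_perm_rows[OF sw(1) perm, of "ys @ [?u]"] domain_wall_column[OF sw' sw(2)]
      swappable_zero[OF sw(2)] by (simp add: g_def)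
  moreover have "split_turn s (as @ x # bs) ys ?u v = g * ?w * odd_turn (\<not> s) (as @ bs) x ys v" for s
    using split_turn_row[OF sw(1) ys sw(3), of s] unfolding ax by (simp add: g_def mult_ac)
  moreover have "?u * (inverse a * inverse v) + inverse ?u * (a * v) = x * inverse v + inverse x * v"
    using a_nonzero x(1) sw(3) by (simp add: field_simps)
  moreover have "w * (g * d) * H = s * (B * (g * w * p) + A * (g * w * q)) * D"
    if "d * H = s * (B * p + A * q) * D" for w D H s A p B q d :: complex
    using that by algebra
  ultimately show ?thesis
    using rel unfolding odd_rel'_def split_rel'_def by simp
qed

text \<open>For equal columns the two coefficients coincide and the two orientations of the middle
  edge add up to \<open>half_turn\<close>.\<close>

lemma split_rel_diagonal:
  assumes "v \<noteq> 0"
  shows "split_rel xs ys v v"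
proof -
  have "sigma (a\<^sup>2 * inverse v * v) = sigma a * (a + inverse a)"
    using assms by (simp add: sigma_def power2_eq_square algebra_simps)
  moreover have "v * (inverse a * inverse v) + inverse v * (a * v) = a + inverse a"
    using assms by (simp add: mult.left_commute[of v] mult.left_commute[of "inverse v"])
  ultimately show ?thesis
    unfolding split_rel_def by (simp add: half_turn_snoc UNIV_bool algebra_simps)
qed

lemma odd_rel_inverse:
  assumes "odd_rel (map inverse xs) (inverse x) (map inverse ys) (inverse v)"
    and "swappable (xs @ [x])" "0 \<notin> set ys" "v \<noteq> 0"
  shows "odd_rel xs x ys v"
proof -
  have "swappable xs" using assms(2) by (auto simp: swappable_def sorted_wrt_append)
  then show ?thesis
    using assms(1) domain_wall_inverse[OF assms(2), of "ys @ [v]"] domain_wall_inverse[of xs ys] assms(3,4)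
    by (simp add: odd_rel_def half_turn_inverse odd_turn_inverse add.commute)
qed

lemma odd_rel'_inverse:
  assumes "odd_rel' (map inverse xs) (inverse x) (map inverse ys) (inverse v)"
    and "swappable (xs @ [x])" "0 \<notin> set ys" "v \<noteq> 0"
  shows "odd_rel' xs x ys v"
proof -
  have "swappable xs" using assms(2) by (auto simp: swappable_def sorted_wrt_append)
  then show ?thesis
    using assms(1) domain_wall_inverse[OF assms(2), of "ys @ [v]"] domain_wall_inverse[of xs ys] assms(3,4)
      half_turn_inverse[of "xs @ [x]" "ys @ [v]"]
    by (simp add: odd_rel'_def odd_turn_inverse add.commute)
qed

text \<open>The inverted hypothesis speaks of the central columns in the order \<open>v\<close>,
  \<open>u\<close>; \<open>split_turn_exchange\<close> expresses these functions by those in the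
  order \<open>u\<close>, \<open>v\<close>.\<close>

lemma split_rel_inverse:
  assumes rel: "split_rel (map inverse xs) (map inverse ys) (inverse u) (inverse v)"
    and nz: "swappable xs" "0 \<notin> set ys" "u \<noteq> 0" "v \<noteq> 0" "sigma (a\<^sup>2 * u * inverse v) \<noteq> 0"
  shows "split_rel xs ys u v"
proof -
  let ?w = "sigma (a\<^sup>2 * inverse u * v)" and ?w' = "sigma (a\<^sup>2 * u * inverse v)"
  let ?t = "sigma (u * inverse v)" and ?c = "sigma (a\<^sup>2)" and ?A = "a + inverse a"
  let ?B = "u * (inverse a * inverse v) + inverse u * (a * v)"
  let ?B' = "inverse u * (inverse a * v) + u * (a * inverse v)"
  let ?T = "split_turn True xs ys u v" and ?F = "split_turn False xs ys u v"
  \<comment> \<open>The exchange maps the inverted pair of coefficients to \<open>?w'\<close> times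
    the wanted pair; \<open>?w'\<close> is nonzero and cancels.\<close>
  have coeff: "?A * ?t + ?B' * ?c = ?w' * ?A" "?A * ?c + ?B' * ?t = ?w' * ?B"
    using a_nonzero nz(3,4) by (simp_all add: sigma_def field_simps power2_eq_square)
  have ex: "?w * split_turn s xs ys v u = ?c * split_turn s xs ys u v + ?t * split_turn (\<not> s) xs ys u v" for s
    using split_turn_exchange[OF swappable_zero[OF nz(1)] nz(3,4)] .
  let ?D = "domain_wall xs (ys @ [v])" and ?d = "domain_wall xs (ys @ [u])" and ?H = "half_turn xs (ys @ [u])"
  have "?w' * ?D * ?H = sigma a * (?A * split_turn True xs ys v u + ?B' * split_turn False xs ys v u) * ?d"
    using rel domain_wall_inverse[OF nz(1), of "ys @ [v]"] domain_wall_inverse[OF nz(1), of "ys @ [u]"]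
      half_turn_inverse[of xs "ys @ [u]"] nz(2-4)
    by (simp add: split_rel_def split_turn_inverse)
  then have "?w' * (?w * ?D * ?H) = sigma a * (?A * (?w * split_turn True xs ys v u) +
      ?B' * (?w * split_turn False xs ys v u)) * ?d"
    by algebra
  also have "\<dots> = sigma a * ((?A * ?t + ?B' * ?c) * ?F + (?A * ?c + ?B' * ?t) * ?T) * ?d"
    unfolding ex by (simp add: algebra_simps)
  also have "\<dots> = ?w' * (sigma a * (?A * ?F + ?B * ?T) * ?d)"
    unfolding coeff by (simp only: distrib_left distrib_right mult_ac)
  finally show ?thesis
    using nz(5) by (simp add: split_rel_def)
qed

lemma split_rel'_inverse:
  assumes rel: "split_rel' (map inverse xs) (map inverse ys) (inverse u) (inverse v)"
    and nz: "swappable xs" "0 \<notin> set ys" "u \<noteq> 0" "v \<noteq> 0" "sigma (a\<^sup>2 * u * inverse v) \<noteq> 0"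
  shows "split_rel' xs ys u v"
proof -
  let ?w = "sigma (a\<^sup>2 * inverse u * v)" and ?w' = "sigma (a\<^sup>2 * u * inverse v)"
  let ?t = "sigma (u * inverse v)" and ?c = "sigma (a\<^sup>2)" and ?A = "a + inverse a"
  let ?B = "u * (inverse a * inverse v) + inverse u * (a * v)"
  let ?B' = "inverse u * (inverse a * v) + u * (a * inverse v)"
  let ?T = "split_turn True xs ys u v" and ?F = "split_turn False xs ys u v"
  have coeff: "?B' * ?t + ?A * ?c = ?w' * ?B" "?B' * ?c + ?A * ?t = ?w' * ?A"
    using a_nonzero nz(3,4) by (simp_all add: sigma_def field_simps power2_eq_square)
  have ex: "?w * split_turn s xs ys v u = ?c * split_turn s xs ys u v + ?t * split_turn (\<not> s) xs ys u v" for s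
    using split_turn_exchange[OF swappable_zero[OF nz(1)] nz(3,4)] .
  let ?D = "domain_wall xs (ys @ [v])" and ?d = "domain_wall xs (ys @ [u])" and ?H = "half_turn xs (ys @ [v])"
  have "?w' * ?d * ?H = sigma a * (?B' * split_turn True xs ys v u + ?A * split_turn False xs ys v u) * ?D"
    using rel domain_wall_inverse[OF nz(1), of "ys @ [v]"] domain_wall_inverse[OF nz(1), of "ys @ [u]"]
      half_turn_inverse[of xs "ys @ [v]"] nz(2-4)
    by (simp add: split_rel'_def split_turn_inverse)
  then have "?w' * (?w * ?d * ?H) = sigma a * (?B' * (?w * split_turn True xs ys v u) +
      ?A * (?w * split_turn False xs ys v u)) * ?D"
    by algebra
  also have "\<dots> = sigma a * ((?B' * ?t + ?A * ?c) * ?F + (?B' * ?c + ?A * ?t) * ?T) * ?D"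
    unfolding ex by (simp add: algebra_simps)
  also have "\<dots> = ?w' * (sigma a * (?B * ?F + ?A * ?T) * ?D)"
    unfolding coeff by (simp only: distrib_left distrib_right mult_ac)
  finally show ?thesis
    using nz(5) by (simp add: split_rel'_def)
qed

text \<open>The range of exponents covers the factors by which two parameters may differ when
  rows or columns are interchanged at the interpolation nodes.\<close>

definition apart :: "complex \<Rightarrow> complex \<Rightarrow> bool" where
  "apart z w \<longleftrightarrow> (\<forall>k\<in>{-6..6::int}. z\<^sup>2 \<noteq> a powi k * w\<^sup>2)"

definition generic :: "complex list \<Rightarrow> bool" where
  "generic zs \<longleftrightarrow> 0 \<notin> set zs \<and> sorted_wrt apart zs"

lemma apart_sym:
  assumes "apart z w" shows "apart w z"
proof -
  have "w\<^sup>2 \<noteq> a powi k * z\<^sup>2" if "k \<in> {-6..6}" for k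
  proof
    assume "w\<^sup>2 = a powi k * z\<^sup>2"
    then have "z\<^sup>2 = a powi (- k) * w\<^sup>2"
      using a_nonzero by (simp add: power_int_minus)
    then show False using assms that by (auto simp: apart_def)
  qed
  then show ?thesis by (simp add: apart_def)
qed

lemma apart_inverse:
  assumes "apart z w" "z \<noteq> 0" "w \<noteq> 0" shows "apart (inverse z) (inverse w)"
proof -
  have "(inverse z)\<^sup>2 \<noteq> a powi k * (inverse w)\<^sup>2" if "k \<in> {-6..6}" for k
  proof
    assume "(inverse z)\<^sup>2 = a powi k * (inverse w)\<^sup>2"
    then have "z\<^sup>2 = a powi (- k) * w\<^sup>2"
      using a_nonzero assms(2,3) by (simp add: power_int_minus field_simps)
    then show False using assms(1) that by (auto simp: apart_def)
  qed
  then show ?thesis by (simp add: apart_def)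
qed

lemma generic_inverse: "generic zs \<Longrightarrow> generic (map inverse zs)"
  unfolding generic_def sorted_wrt_map
  by (auto elim!: sorted_wrt_mono_rel[rotated] intro: apart_inverse)

text \<open>\<open>sigma\<close> vanishes where the square of its argument is 1, so exponents double
  and the bound 3 matches the 6 in \<open>apart\<close>. It is 3 because swap weights contain
  \<open>a^2\<close> and a node shifts a parameter by one more factor \<open>a\<close> or
  \<open>inverse a\<close>.\<close>

lemma sigma_nonzero:
  assumes "apart z w" "z \<noteq> 0" "w \<noteq> 0" "k \<in> {-3..3}"
  shows "sigma (a powi k * inverse z * w) \<noteq> 0"
proof
  assume "sigma (a powi k * inverse z * w) = 0"
  then have "(a powi k * inverse z * w)\<^sup>2 = 1"
    using assms a_nonzero by (simp add: sigma_eq_0_iff)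
  then have "z\<^sup>2 = a powi (k * 2) * w\<^sup>2"
    using assms(2) by (simp add: power_mult_distrib power_int_mult field_simps)
  then show False
    using assms(1,4) unfolding apart_def by (elim ballE[of _ _ "k * 2"]) auto
qed

lemma generic_swappable: "generic zs \<Longrightarrow> swappable zs"
  unfolding generic_def swappable_def
  using sigma_nonzero[where k = 2] apart_sym
  by (auto elim!: sorted_wrt_mono_rel[rotated])

lemma swappable_snoc:
  assumes "generic (zs @ [w])" "k \<in> {-1..1}"
  shows "swappable (zs @ [a powi k * w])"
proof -
  have "sigma (a\<^sup>2 * inverse z * (a powi k * w)) \<noteq> 0 \<and> sigma (a\<^sup>2 * inverse (a powi k * w) * z) \<noteq> 0"
    if "z \<in> set zs" for z
  proof -
    have z: "apart z w" "apart w z" "z \<noteq> 0" "w \<noteq> 0"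
      using assms(1) that apart_sym[of z w] by (auto simp: generic_def sorted_wrt_append)
    have "a powi (2 + k) = a\<^sup>2 * a powi k" "a powi (2 - k) = a\<^sup>2 * inverse (a powi k)"
      using a_nonzero power_int_add[of a 2 k] power_int_add[of a 2 "- k"] by (simp_all add: power_int_minus)
    then show ?thesis
      using sigma_nonzero[OF z(1,3,4), of "2 + k"] sigma_nonzero[OF z(2,4,3), of "2 - k"] assms(2)
      by (simp add: mult_ac)
  qed
  moreover have "swappable zs" "w \<noteq> 0"
    using assms(1) generic_swappable[of zs] by (auto simp: generic_def sorted_wrt_append)
  ultimately show ?thesis
    using a_nonzero by (auto simp: swappable_def sorted_wrt_append)
qed

lemma swappable_snoc_divide: "generic (zs @ [w]) \<Longrightarrow> swappable (zs @ [w * inverse a])"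
  using swappable_snoc[of zs w "-1"] by (simp add: mult.commute)

lemma swappable_snoc_times: "generic (zs @ [w]) \<Longrightarrow> swappable (zs @ [a * w])"
  using swappable_snoc[of zs w 1] by simp

lemma generic_append: "generic (zs @ ws) \<longleftrightarrow>
    generic zs \<and> generic ws \<and> (\<forall>z\<in>set zs. \<forall>w\<in>set ws. apart z w)"
  by (auto simp: generic_def sorted_wrt_append)

definition nodes :: "complex list \<Rightarrow> complex set" where
  "nodes zs = (\<Union>z\<in>set zs. {(z * inverse a)\<^sup>2, (a * z)\<^sup>2})"

lemma apart_nodes:
  assumes "apart z w"
  shows "z\<^sup>2 \<noteq> w\<^sup>2" "(z * inverse a)\<^sup>2 \<noteq> (a * w)\<^sup>2" "(a * z)\<^sup>2 \<noteq> (w * inverse a)\<^sup>2"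
    "z\<^sup>2 \<noteq> (w * inverse a)\<^sup>2" "z\<^sup>2 \<noteq> (a * w)\<^sup>2"
proof -
  have *: "z\<^sup>2 \<noteq> a powi k * w\<^sup>2" if "k \<in> {-6..6}" for k
    using assms that by (auto simp: apart_def)
  show "z\<^sup>2 \<noteq> w\<^sup>2" using *[of 0] by simp
  show "(z * inverse a)\<^sup>2 \<noteq> (a * w)\<^sup>2" using *[of 4] a_nonzero
    by (simp add: power_mult_distrib field_simps)
  show "(a * z)\<^sup>2 \<noteq> (w * inverse a)\<^sup>2" using *[of "-4"] a_nonzero
    by (simp add: power_mult_distrib power_int_minus field_simps)
  show "z\<^sup>2 \<noteq> (w * inverse a)\<^sup>2" using *[of "-2"] a_nonzero
    by (simp add: power_mult_distrib power_int_minus field_simps)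
  show "z\<^sup>2 \<noteq> (a * w)\<^sup>2" using *[of 2] a_nonzero
    by (simp add: power_mult_distrib field_simps)
qed

lemma finite_nodes [simp]: "finite (nodes zs)"
  by (simp add: nodes_def)

lemma card_nodes:
  assumes "a ^ 4 \<noteq> 1" "generic zs"
  shows "card (nodes zs) = 2 * length zs"
  using assms(2)
proof (induction zs)
  case Nil
  then show ?case by (simp add: nodes_def)
next
  case (Cons z zs)
  have z: "z \<noteq> 0" "\<And>w. w \<in> set zs \<Longrightarrow> apart z w"
    using Cons.prems by (auto simp: generic_def)
  \<comment> \<open>The two nodes of the same \<open>z\<close> are kept apart by the condition on
    \<open>a^4\<close>.\<close>
  have "(z * inverse a)\<^sup>2 \<noteq> (a * z)\<^sup>2"
    using assms(1) z(1) a_nonzero by (auto simp: power_mult_distrib field_simps)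
  moreover have "(z * inverse a)\<^sup>2 \<notin> nodes zs" "(a * z)\<^sup>2 \<notin> nodes zs"
    using apart_nodes[OF z(2)] a_nonzero by (auto simp: nodes_def power_mult_distrib)
  moreover have "nodes (z # zs) = insert ((z * inverse a)\<^sup>2) (insert ((a * z)\<^sup>2) (nodes zs))"
    by (auto simp: nodes_def)
  moreover have "card (nodes zs) = 2 * length zs"
    using Cons by (auto simp: generic_def)
  ultimately show ?case by simp
qed

lemma laurent_eq_0_nodes:
  assumes "laurent d f" "a ^ 4 \<noteq> 1" "generic zs" "2 * int (length zs) > d" "x \<noteq> 0"
    and roots: "\<And>z. z \<in> set zs \<Longrightarrow> f (z * inverse a) = 0 \<and> f (a * z) = 0"
  shows "f x = 0"
proof (rule laurent_eq_0[OF assms(1) finite_nodes])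
  show "int (card (nodes zs)) > d"
    using card_nodes[OF assms(2,3)] assms(4) by simp
  show "\<exists>x. x \<noteq> 0 \<and> x\<^sup>2 = s \<and> f x = 0" if s: "s \<in> nodes zs" for s
  proof -
    obtain z where z: "z \<in> set zs" "s = (z * inverse a)\<^sup>2 \<or> s = (a * z)\<^sup>2"
      using s unfolding nodes_def by blast
    moreover have "z \<noteq> 0" using assms(3) z(1) by (auto simp: generic_def)
    ultimately show ?thesis
      using roots[OF z(1)] a_nonzero
      by (metis mult_eq_0_iff inverse_nonzero_iff_nonzero)
  qed
qed fact

text \<open>Serves the relation \<open>split_rel\<close>, whose degree equals the number of ordinary
  nodes; the additional node \<open>v\<close> is its diagonal.\<close>

lemma laurent_eq_0_nodes_insert:
  assumes "laurent d f" "a ^ 4 \<noteq> 1" "generic zs" "2 * int (length zs) + 1 > d" "x \<noteq> 0"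
    and roots: "\<And>z. z \<in> set zs \<Longrightarrow> f (z * inverse a) = 0 \<and> f (a * z) = 0"
    and v: "v \<noteq> 0" "f v = 0" "\<And>z. z \<in> set zs \<Longrightarrow> apart v z"
  shows "f x = 0"
proof (rule laurent_eq_0[OF assms(1)])
  have "v\<^sup>2 \<notin> nodes zs"
    using apart_nodes(4,5)[OF v(3)] by (auto simp: nodes_def)
  then show "int (card (insert (v\<^sup>2) (nodes zs))) > d"
    using card_nodes[OF assms(2,3)] assms(4) by simp
  show "\<exists>x. x \<noteq> 0 \<and> x\<^sup>2 = s \<and> f x = 0" if s: "s \<in> insert (v\<^sup>2) (nodes zs)" for s
  proof (cases "s = v\<^sup>2")
    case True
    then show ?thesis using v by blast
  next
    case False
    then obtain z where z: "z \<in> set zs" "s = (z * inverse a)\<^sup>2 \<or> s = (a * z)\<^sup>2"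
      using s unfolding nodes_def by blast
    moreover have "z \<noteq> 0" using assms(3) z(1) by (auto simp: generic_def)
    ultimately show ?thesis
      using roots[OF z(1)] a_nonzero
      by (metis mult_eq_0_iff inverse_nonzero_iff_nonzero)
  qed
qed (use assms in simp_all)

section \<open>Degrees of the relations in the interpolation variable\<close>

lemma laurent_odd_rel:
  "laurent (int (length ys)) (\<lambda>x. domain_wall (xs @ [x]) (ys @ [v]) * half_turn xs ys -
     sigma a * ((a + inverse a) * odd_turn True xs x ys v +
       (x * inverse v + inverse x * v) * odd_turn False xs x ys v) * domain_wall xs ys)"
proof -
  have 1: "laurent (int (length ys)) (\<lambda>x. domain_wall (xs @ [x]) (ys @ [v]))"
    using laurent_domain_wall_row[of "ys @ [v]" xs] by simp
  have 2: "laurent (int (length ys)) (\<lambda>x. odd_turn True xs x ys v)"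
    using laurent_odd_turn_row[of ys True xs v] by simp
  have 3: "laurent (int (length ys)) (\<lambda>x. (x * inverse v + inverse x * v) * odd_turn False xs x ys v)"
    using laurent_mult[OF laurent_binomial laurent_odd_turn_row[of ys False xs v]] by simp
  show ?thesis
    by (rule laurent_minus[OF laurent_multc[OF 1]
          laurent_multc[OF laurent_cmult[OF laurent_add[OF laurent_cmult[OF 2] 3]]]])
qed

lemma laurent_odd_rel':
  "laurent (2 * int (length ys) + 1) (\<lambda>x. domain_wall xs ys * half_turn (xs @ [x]) (ys @ [v]) -
     sigma a * ((x * inverse v + inverse x * v) * odd_turn True xs x ys v +
       (a + inverse a) * odd_turn False xs x ys v) * domain_wall (xs @ [x]) (ys @ [v]))"
proof -
  let ?m = "int (length ys)"
  have 1: "laurent (1 + ?m + ?m) (\<lambda>x. half_turn (xs @ [x]) (ys @ [v]))"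
    using laurent_half_turn_row[of "ys @ [v]" xs] by (simp add: add.commute)
  have 2: "laurent (1 + ?m) (\<lambda>x. (x * inverse v + inverse x * v) * odd_turn True xs x ys v)"
    using laurent_mult[OF laurent_binomial laurent_odd_turn_row[of ys True xs v]] by simp
  \<comment> \<open>The degree \<open>?m - 1\<close> is raised by two to match the other
    summand.\<close>
  have 3: "laurent (1 + ?m) (\<lambda>x. odd_turn False xs x ys v)"
    using laurent_mono[OF laurent_odd_turn_row[of ys False xs v], of "1 + ?m" 1] by simp
  have 4: "laurent ?m (\<lambda>x. domain_wall (xs @ [x]) (ys @ [v]))"
    using laurent_domain_wall_row[of "ys @ [v]" xs] by simp
  have "2 * ?m + 1 = 1 + ?m + ?m" by simp
  then show ?thesis
    by (simp only:) (rule laurent_minus[OF laurent_cmult[OF 1]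
          laurent_mult[OF laurent_cmult[OF laurent_add[OF 2 laurent_cmult[OF 3]]] 4]])
qed

lemma laurent_split_rel:
  "laurent (2 * int (length xs)) (\<lambda>u.
     sigma (a\<^sup>2 * inverse u * v) * domain_wall xs (ys @ [v]) * half_turn xs (ys @ [u]) -
     sigma a * ((a + inverse a) * split_turn False xs ys u v +
       (u * (inverse a * inverse v) + inverse u * (a * v)) * split_turn True xs ys u v) *
     domain_wall xs (ys @ [u]))"
proof -
  let ?m = "int (length xs)"
  have s: "laurent 1 (\<lambda>u. sigma (a\<^sup>2 * inverse u * v))"
    using laurent_sigma_inverse[of "a\<^sup>2 * v"] by (simp add: mult_ac)
  have 1: "laurent (1 + (2 * ?m - 1)) (\<lambda>u. sigma (a\<^sup>2 * inverse u * v) * domain_wall xs (ys @ [v]) *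
      half_turn xs (ys @ [u]))"
    by (rule laurent_mult[OF laurent_multc[OF s] laurent_half_turn_column])
  have 2: "laurent (1 + ?m) (\<lambda>u. split_turn False xs ys u v)"
    using laurent_mono[OF laurent_split_turn_column[of xs False ys v], of "1 + ?m" 1] by simp
  have 3: "laurent (1 + ?m) (\<lambda>u. (u * (inverse a * inverse v) + inverse u * (a * v)) * split_turn True xs ys u v)"
    using laurent_mult[OF laurent_binomial laurent_split_turn_column[of xs True ys v]] by simp
  have "laurent (1 + ?m + (?m - 1)) (\<lambda>u. sigma a * ((a + inverse a) * split_turn False xs ys u v +
       (u * (inverse a * inverse v) + inverse u * (a * v)) * split_turn True xs ys u v) *
     domain_wall xs (ys @ [u]))"
    by (rule laurent_mult[OF laurent_cmult[OF laurent_add[OF laurent_cmult[OF 2] 3]]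
          laurent_domain_wall_column])
  moreover have "1 + ?m + (?m - 1) = 2 * ?m" "1 + (2 * ?m - 1) = 2 * ?m" by simp_all
  ultimately show ?thesis using 1 by (simp only: laurent_minus)
qed

lemma laurent_split_rel':
  "laurent (int (length xs)) (\<lambda>u.
     sigma (a\<^sup>2 * inverse u * v) * domain_wall xs (ys @ [u]) * half_turn xs (ys @ [v]) -
     sigma a * ((u * (inverse a * inverse v) + inverse u * (a * v)) * split_turn False xs ys u v +
       (a + inverse a) * split_turn True xs ys u v) * domain_wall xs (ys @ [v]))"
proof -
  let ?m = "int (length xs)"
  have s: "laurent 1 (\<lambda>u. sigma (a\<^sup>2 * inverse u * v))"
    using laurent_sigma_inverse[of "a\<^sup>2 * v"] by (simp add: mult_ac)
  have 1: "laurent ?m (\<lambda>u. sigma (a\<^sup>2 * inverse u * v) * domain_wall xs (ys @ [u]))"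
    using laurent_mult[OF s laurent_domain_wall_column[of xs ys]] by simp
  have 2: "laurent ?m (\<lambda>u. split_turn True xs ys u v)"
    using laurent_split_turn_column[of xs True ys v] by simp
  have 3: "laurent ?m (\<lambda>u. (u * (inverse a * inverse v) + inverse u * (a * v)) * split_turn False xs ys u v)"
    using laurent_mult[OF laurent_binomial laurent_split_turn_column[of xs False ys v]] by simp
  show ?thesis
    by (rule laurent_minus[OF laurent_multc[OF 1]
          laurent_multc[OF laurent_cmult[OF laurent_add[OF 3 laurent_cmult[OF 2]]]]])
qed


section \<open>Mutual induction for the odd and the split relations\<close>

lemma generic_Cons: "generic (z # zs) \<longleftrightarrow> z \<noteq> 0 \<and> (\<forall>w\<in>set zs. apart z w) \<and> generic zs"
  by (auto simp: generic_def)

lemma generic_Nil [simp]: "generic []"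
  by (simp add: generic_def)

lemma generic_nonzero: "generic zs \<Longrightarrow> 0 \<notin> set zs"
  by (simp add: generic_def)

text \<open>The variable of interpolation, here \<open>x\<close> and in \<open>split_rels\<close>
  \<open>u\<close>, is only required to be nonzero, since interpolation yields the identity at all
  its values.\<close>

definition odd_rels :: "nat \<Rightarrow> bool" where
  "odd_rels m \<longleftrightarrow> (\<forall>xs x ys v. length xs = m \<longrightarrow> length ys = m \<longrightarrow> generic (xs @ ys @ [v]) \<longrightarrow> x \<noteq> 0 \<longrightarrow>
     odd_rel xs x ys v \<and> odd_rel' xs x ys v)"

definition split_rels :: "nat \<Rightarrow> bool" where
  "split_rels m \<longleftrightarrow> (\<forall>xs ys u v. length xs = Suc m \<longrightarrow> length ys = m \<longrightarrow> generic (xs @ ys @ [v]) \<longrightarrow> u \<noteq> 0 \<longrightarrow>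
     split_rel xs ys u v \<and> split_rel' xs ys u v)"

text \<open>Removing \<open>u\<close> from \<open>ys\<close> leaves a split model whose row list is
  longer by one than its column list. The premise of \<open>IH\<close> allows for empty
  \<open>ys\<close>, where there is no smaller model.\<close>

lemma odd_rel_nodes:
  assumes IH: "\<And>k. length ys = Suc k \<Longrightarrow> split_rels k"
    and len: "length xs = length ys" and gen: "generic (xs @ ys @ [v])" and "u \<in> set ys"
  shows "odd_rel xs (u * inverse a) ys v \<and> odd_rel' xs (u * inverse a) ys v"
proof -
  obtain as bs where ys: "ys = as @ u # bs"
    using \<open>u \<in> set ys\<close> by (meson split_list)
  have "generic (xs @ (as @ bs) @ [v])" "u \<noteq> 0"
    using gen unfolding ys by (simp_all add: generic_append generic_Cons)
  then have "split_rel xs (as @ bs) u v \<and> split_rel' xs (as @ bs) u v"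
    by (intro IH[of "length (as @ bs)", unfolded split_rels_def, rule_format])
      (simp_all add: len ys)
  moreover have "swappable (xs @ [u * inverse a])"
    using gen unfolding ys by (intro swappable_snoc_divide) (simp add: generic_append generic_Cons)
  moreover have "swappable (as @ u # bs @ [v])"
    using gen unfolding ys by (intro generic_swappable) (simp add: generic_append generic_Cons)
  ultimately show ?thesis
    unfolding ys by (simp add: odd_rel_column odd_rel'_column)
qed

text \<open>Inverting all parameters turns \<open>a * u\<close> into
  \<open>inverse u * inverse a\<close>, a node of the other kind.\<close>

lemma odd_rel_nodes_times:
  assumes IH: "\<And>k. length ys = Suc k \<Longrightarrow> split_rels k"
    and len: "length xs = length ys" and gen: "generic (xs @ ys @ [v])" and "u \<in> set ys"
  shows "odd_rel xs (a * u) ys v \<and> odd_rel' xs (a * u) ys v"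
proof -
  have sw: "swappable (xs @ [a * u])"
    using gen \<open>u \<in> set ys\<close> generic_nonzero[OF gen]
    by (intro swappable_snoc_times) (auto simp: generic_append generic_Cons)
  have "odd_rel (map inverse xs) (inverse u * inverse a) (map inverse ys) (inverse v) \<and>
      odd_rel' (map inverse xs) (inverse u * inverse a) (map inverse ys) (inverse v)"
    using generic_inverse[OF gen] IH len \<open>u \<in> set ys\<close> by (intro odd_rel_nodes) auto
  then have "odd_rel (map inverse xs) (inverse (a * u)) (map inverse ys) (inverse v) \<and>
      odd_rel' (map inverse xs) (inverse (a * u)) (map inverse ys) (inverse v)"
    by (simp add: mult.commute)
  then show ?thesis
    using odd_rel_inverse[OF _ sw] odd_rel'_inverse[OF _ sw] generic_nonzero[OF gen] by auto
qed

lemma odd_rel'_last_nodes: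
  assumes gen: "generic (xs @ ys @ [v])"
  shows "odd_rel' xs (v * inverse a) ys v" "odd_rel' xs (a * v) ys v"
proof -
  have last: "odd_rel' xs (v * inverse a) ys v" if "generic (xs @ ys @ [v])" for xs ys v
    using that by (intro odd_rel'_last_column swappable_snoc_divide generic_swappable)
      (simp_all add: generic_append)
  show "odd_rel' xs (v * inverse a) ys v" by (rule last) fact
  have sw: "swappable (xs @ [a * v])"
    using gen by (intro swappable_snoc_times) (simp add: generic_append)
  have "odd_rel' (map inverse xs) (inverse (a * v)) (map inverse ys) (inverse v)"
    using last[of "map inverse xs" "map inverse ys" "inverse v"] generic_inverse[OF gen]
    by (simp add: mult.commute)
  then show "odd_rel' xs (a * v) ys v"
    using generic_nonzero[OF gen] by (intro odd_rel'_inverse[OF _ sw]) auto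
qed

lemma odd_rels_step:
  assumes a4: "a ^ 4 \<noteq> 1" and IH: "\<And>k. m = Suc k \<Longrightarrow> split_rels k"
  shows "odd_rels m"
  unfolding odd_rels_def
proof (intro allI impI)
  fix xs x ys v
  assume len: "length xs = m" "length ys = m" and gen: "generic (xs @ ys @ [v])" and "x \<noteq> (0 :: complex)"
  have ys: "generic ys" "generic (ys @ [v])" and nz: "0 \<notin> set ys" "v \<noteq> 0"
    using gen generic_nonzero[OF gen] by (auto simp: generic_append)
  have IH': "split_rels k" if "length ys = Suc k" for k
    using IH that len by simp
  have nodes: "odd_rel xs (z * inverse a) ys v \<and> odd_rel' xs (z * inverse a) ys v"
    "odd_rel xs (a * z) ys v \<and> odd_rel' xs (a * z) ys v" if "z \<in> set ys" for z
    using odd_rel_nodes[OF IH' _ gen that] odd_rel_nodes_times[OF IH' _ gen that] len by simp_all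
  have "odd_rel xs x ys v"
  proof (cases m)
    case 0
    then show ?thesis
      using len by (simp add: odd_rel_def domain_wall_def half_turn_def odd_turn_def psi_Cons UNIV_bool
          sum_bool_lists_Suc vwt_def) (simp add: sigma_def power2_eq_square algebra_simps)
  next
    case (Suc k)
    then have "2 * int (length ys) > int (length ys)"
      using len by simp
    from laurent_eq_0_nodes[OF laurent_odd_rel[of ys xs v] a4 ys(1) this \<open>x \<noteq> 0\<close>] show ?thesis
      using nodes by (simp add: odd_rel_def)
  qed
  moreover have "odd_rel' xs x ys v"
  proof -
    \<comment> \<open>There are \<open>2 * m + 2\<close> nodes against degree
      \<open>2 * m + 1\<close>; the last two come from the column \<open>v\<close>.\<close>
    have "2 * int (length (ys @ [v])) > 2 * int (length ys) + 1"
      by simp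
    from laurent_eq_0_nodes[OF laurent_odd_rel'[of ys xs v] a4 ys(2) this \<open>x \<noteq> 0\<close>] show ?thesis
      using nodes odd_rel'_last_nodes[OF gen] by (auto simp add: odd_rel'_def)
  qed
  ultimately show "odd_rel xs x ys v \<and> odd_rel' xs x ys v" ..
qed

lemma split_rel_nodes:
  assumes IH: "odd_rels m" and len: "length xs = Suc m" "length ys = m"
    and gen: "generic (xs @ ys @ [v])" and "x \<in> set xs"
  shows "split_rel xs ys (a * x) v \<and> split_rel' xs ys (a * x) v"
proof -
  obtain as bs where xs: "xs = as @ x # bs"
    using \<open>x \<in> set xs\<close> by (meson split_list)
  have "generic ((as @ bs) @ ys @ [v])" "x \<noteq> 0"
    using gen unfolding xs by (simp_all add: generic_append generic_Cons)
  then have "odd_rel (as @ bs) x ys v \<and> odd_rel' (as @ bs) x ys v"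
    using len xs by (intro IH[unfolded odd_rels_def, rule_format]) simp_all
  moreover have "swappable (as @ x # bs)"
    using gen unfolding xs by (intro generic_swappable) (simp add: generic_append generic_Cons)
  moreover have "swappable (ys @ [a * x])"
    using gen unfolding xs
    by (intro swappable_snoc_times) (auto simp: generic_append generic_Cons intro: apart_sym[of x])
  moreover have "v \<noteq> 0"
    using generic_nonzero[OF gen] by auto
  ultimately show ?thesis
    unfolding xs by (simp add: split_rel_row split_rel'_row)
qed

lemma split_rel_nodes_divide:
  assumes IH: "odd_rels m" and len: "length xs = Suc m" "length ys = m"
    and gen: "generic (xs @ ys @ [v])" and "x \<in> set xs"
  shows "split_rel xs ys (x * inverse a) v \<and> split_rel' xs ys (x * inverse a) v"
proof -
  have sw: "swappable xs" and nz: "0 \<notin> set ys" "x \<noteq> 0" "v \<noteq> 0" "x * inverse a \<noteq> 0"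
    and "apart v x"
    using gen generic_nonzero[OF gen] \<open>x \<in> set xs\<close> a_nonzero
    by (auto simp: generic_append intro: generic_swappable apart_sym[of x v])
  have sigma: "sigma (a\<^sup>2 * (x * inverse a) * inverse v) \<noteq> 0"
    using sigma_nonzero[OF \<open>apart v x\<close> nz(3,2), of 1] a_nonzero by (simp add: power2_eq_square mult_ac)
  have "split_rel (map inverse xs) (map inverse ys) (a * inverse x) (inverse v) \<and>
      split_rel' (map inverse xs) (map inverse ys) (a * inverse x) (inverse v)"
    using generic_inverse[OF gen] IH len \<open>x \<in> set xs\<close> by (intro split_rel_nodes) auto
  then show ?thesis
    using split_rel_inverse[OF _ sw nz(1,4,3) sigma] split_rel'_inverse[OF _ sw nz(1,4,3) sigma]
    by (simp add: mult.commute)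
qed

lemma split_rels_step:
  assumes a4: "a ^ 4 \<noteq> 1" and IH: "odd_rels m"
  shows "split_rels m"
  unfolding split_rels_def
proof (intro allI impI)
  fix xs ys u v
  assume len: "length xs = Suc m" "length ys = m" and gen: "generic (xs @ ys @ [v])" and "u \<noteq> (0 :: complex)"
  have xs: "generic xs" and nz: "0 \<notin> set xs" "v \<noteq> 0" 
    and ap: "\<And>x. x \<in> set xs \<Longrightarrow> apart v x"
    using gen generic_nonzero[OF gen] by (auto simp: generic_append intro: apart_sym[of _ v])
  note nodes = split_rel_nodes[OF IH len gen] split_rel_nodes_divide[OF IH len gen]
  \<comment> \<open>The rows provide exactly as many nodes as the degree; the diagonal
    \<open>u = v\<close> is the one more that is required.\<close>
  have "2 * int (length xs) + 1 > 2 * int (length xs)"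
    by simp
  from laurent_eq_0_nodes_insert[OF laurent_split_rel[of xs v ys] a4 xs this \<open>u \<noteq> 0\<close> _ nz(2) _ ap]
  have "split_rel xs ys u v"
    using nodes split_rel_diagonal[OF nz(2), of xs ys] by (simp add: split_rel_def)
  moreover have "2 * int (length xs) > int (length xs)"
    using len by simp
  from laurent_eq_0_nodes[OF laurent_split_rel'[of xs v ys] a4 xs this \<open>u \<noteq> 0\<close>] have "split_rel' xs ys u v"
    using nodes by (simp add: split_rel'_def)
  ultimately show "split_rel xs ys u v \<and> split_rel' xs ys u v" ..
qed

lemma odd_rels: "a ^ 4 \<noteq> 1 \<Longrightarrow> odd_rels m"
proof (induction m)
  case 0
  then show ?case by (rule odd_rels_step) simp
next
  case (Suc m)
  then have "split_rels m" by (intro split_rels_step) auto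
  then show ?case by (intro odd_rels_step Suc.prems) simp
qed

end

section \<open>From generic to arbitrary nonzero parameters by continuity\<close>

lemma eventually_poly_nonzero:
  fixes p :: "complex poly"
  assumes "p \<noteq> 0"
  shows "eventually (\<lambda>t. poly p t \<noteq> 0) (at 0)"
proof -
  have "eventually (\<lambda>t. \<forall>s\<in>{s. poly p s = 0}. t \<noteq> s) (at 0)"
    by (intro eventually_ball_finite poly_roots_finite assms ballI eventually_neq_at_within)
  then show ?thesis by (auto elim: eventually_mono)
qed

lemma eventually_one_plus_neq_0: "eventually (\<lambda>t. 1 + t \<noteq> (0 :: complex)) (at 0)"
  using eventually_poly_nonzero[of "[:1, 1:]"] by simp

lemma eventually_power_neq:
  fixes c d :: complex
  assumes "c \<noteq> 0" "d \<noteq> 0" "i < j"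
  shows "eventually (\<lambda>t. c * (1 + t) ^ i \<noteq> d * (1 + t) ^ j) (at 0)"
proof -
  let ?p = "smult d ([:1, 1:] ^ (j - i)) - [:c:]"
  \<comment> \<open>As \<open>j - i\<close> is positive, the power vanishes at -1, which shows that
    \<open>?p\<close> is not the zero polynomial.\<close>
  have "poly ?p (-1) = - c"
    using assms by simp
  then have "?p \<noteq> 0" using assms(1) by (metis neg_equal_0_iff_equal poly_0)
  from eventually_poly_nonzero[OF this] eventually_one_plus_neq_0 show ?thesis
  proof eventually_elim
    case (elim t)
    have "(1 + t) ^ j = (1 + t) ^ (j - i) * (1 + t) ^ i"
      using assms(3) by (simp flip: power_add)
    then show ?case using elim by (auto simp: mult.assoc[symmetric])
  qed
qed

lemma isCont_zero_if_eventually: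
  fixes f :: "complex \<Rightarrow> complex"
  assumes "isCont f 0" "eventually (\<lambda>t. f t = 0) (at 0)"
  shows "f 0 = 0"
  using assms tendsto_unique[of "at (0::complex)" f "f 0" 0] tendsto_eventually
  by (auto simp: isCont_def)

context six_vertex
begin

definition at_arg :: "complex \<Rightarrow> (complex \<Rightarrow> complex) list \<Rightarrow> complex list" where
  "at_arg t fs = map (\<lambda>f. f t) fs"

text \<open>Distinct exponents separate any two entries for small nonzero \<open>t\<close>, even
  equal ones, and \<open>t = 0\<close> gives back the list.\<close>

definition deform :: "complex list \<Rightarrow> (complex \<Rightarrow> complex) list" where
  "deform zs = map (\<lambda>i t. zs ! i * (1 + t) ^ i) [0..<length zs]"

lemma at_arg_deform: "at_arg 0 (deform zs) = zs"
  by (simp add: at_arg_def deform_def comp_def map_nth)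

lemma eventually_generic_deform:
  assumes "0 \<notin> set zs"
  shows "eventually (\<lambda>t. generic (at_arg t (deform zs))) (at 0)"
proof -
  let ?n = "length zs"
  have nz: "zs ! i \<noteq> 0" if "i < ?n" for i
    using assms that by (metis nth_mem)
  have "eventually (\<lambda>t. \<forall>j\<in>{..<?n}. \<forall>i\<in>{..<j}. \<forall>k\<in>{-6..6::int}.
      (zs ! i)\<^sup>2 * (1 + t) ^ (2 * i) \<noteq> (a powi k * (zs ! j)\<^sup>2) * (1 + t) ^ (2 * j)) (at 0)"
    using nz a_nonzero by (intro eventually_ball_finite ballI eventually_power_neq) auto
  with eventually_one_plus_neq_0 show ?thesis
  proof eventually_elim
    case (elim t)
    have "0 \<notin> set (at_arg t (deform zs))"
      using elim nz by (auto simp: at_arg_def deform_def)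
    moreover have "sorted_wrt apart (at_arg t (deform zs))"
      unfolding sorted_wrt_iff_nth_less apart_def
    proof (intro allI impI ballI)
      fix i j k assume ij: "i < j" "j < length (at_arg t (deform zs))" and k: "k \<in> {-6..6::int}"
      then have "j < ?n" by (simp add: at_arg_def deform_def)
      then have "(zs ! i)\<^sup>2 * (1 + t) ^ (2 * i) \<noteq> (a powi k * (zs ! j)\<^sup>2) * (1 + t) ^ (2 * j)"
        using elim ij(1) k by blast
      then show "(at_arg t (deform zs) ! i)\<^sup>2 \<noteq> a powi k * (at_arg t (deform zs) ! j)\<^sup>2"
        using ij \<open>j < ?n\<close> by (simp add: at_arg_def deform_def power_mult_distrib power_mult[symmetric] mult_ac)
    qed
    ultimately show ?case by (simp add: generic_def)
  qed
qed

definition regular :: "(complex \<Rightarrow> complex) \<Rightarrow> bool" where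
  "regular f \<longleftrightarrow> isCont f 0 \<and> f 0 \<noteq> 0"

lemma regular_deform:
  assumes "0 \<notin> set zs" "f \<in> set (deform zs)" shows "regular f"
proof -
  obtain i where "i < length zs" "f = (\<lambda>t. zs ! i * (1 + t) ^ i)"
    using assms(2) by (auto simp: deform_def)
  moreover have "zs ! i \<noteq> 0" using assms(1) \<open>i < length zs\<close> by (metis nth_mem)
  ultimately show ?thesis by (auto simp: regular_def intro!: continuous_intros)
qed

lemma isCont_vwt:
  assumes "regular f" "regular g"
  shows "isCont (\<lambda>t. vwt a (f t * inverse (g t)) l r u b) 0"
proof -
  have "isCont (\<lambda>t. f t * inverse (g t)) 0"
    using assms by (intro continuous_intros) (auto simp: regular_def)
  moreover have "f 0 * inverse (g 0) \<noteq> 0" using assms by (simp add: regular_def)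
  ultimately have "isCont (\<lambda>t. sigma (a * (f t * inverse (g t)))) 0"
    "isCont (\<lambda>t. sigma (a * inverse (f t * inverse (g t)))) 0"
    unfolding sigma_def using a_nonzero by (auto intro!: continuous_intros simp del: inverse_mult_distrib)
  then show ?thesis
    by (cases l; cases r; cases u; cases b) (simp_all add: vwt_def)
qed

lemma isCont_row:
  assumes "regular f" "\<And>g. g \<in> set gs \<Longrightarrow> regular g"
  shows "isCont (\<lambda>t. row (f t) (at_arg t gs) l r ts bs) 0"
  using assms(2)
proof (induction gs arbitrary: l ts bs)
  case Nil
  then show ?case by (cases ts; cases bs) (simp_all add: at_arg_def)
next
  case (Cons g gs)
  show ?case
  proof (cases "\<exists>t ts' b bs'. ts = t # ts' \<and> bs = b # bs'")
    case True
    then obtain c ts' b bs' where [simp]: "ts = c # ts'" "bs = b # bs'" by auto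
    have eq: "row (f t) (at_arg t (g # gs)) l r ts bs = (\<Sum>k\<in>UNIV.
        vwt a (f t * inverse (g t)) l k c b * row (f t) (at_arg t gs) k r ts' bs')" for t
      by (simp add: at_arg_def)
    show ?thesis unfolding eq
      by (intro continuous_intros isCont_vwt assms(1) Cons.IH) (simp_all add: Cons.prems)
  next
    case False
    then show ?thesis by (cases ts; cases bs) (auto simp: at_arg_def)
  qed
qed

lemma isCont_psi:
  assumes "\<And>f. f \<in> set fs \<Longrightarrow> regular f" "\<And>g. g \<in> set gs \<Longrightarrow> regular g"
  shows "isCont (\<lambda>t. psi (at_arg t fs) (at_arg t gs) ts bs) 0"
  using assms(1)
proof (induction fs arbitrary: ts)
  case Nil
  then show ?case by (simp add: at_arg_def)
next
  case (Cons f fs)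
  have eq: "psi (at_arg t (f # fs)) (at_arg t gs) ts bs = (\<Sum>qs\<in>bool_lists (length gs).
      row (f t) (at_arg t gs) True False ts qs * psi (at_arg t fs) (at_arg t gs) qs bs)" for t
    by (simp add: at_arg_def psi_Cons)
  show ?case unfolding eq
    by (intro continuous_intros isCont_row Cons.IH) (simp_all add: Cons.prems assms(2))
qed

lemma isCont_domain_wall:
  assumes "\<And>f. f \<in> set fs \<Longrightarrow> regular f" "\<And>g. g \<in> set gs \<Longrightarrow> regular g"
  shows "isCont (\<lambda>t. domain_wall (at_arg t fs) (at_arg t gs)) 0"
  using isCont_psi[OF assms] by (simp add: domain_wall_def at_arg_def)

lemma isCont_half_turn:
  assumes "\<And>f. f \<in> set fs \<Longrightarrow> regular f" "\<And>g. g \<in> set gs \<Longrightarrow> regular g"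
  shows "isCont (\<lambda>t. half_turn (at_arg t fs) (at_arg t gs)) 0"
proof -
  have eq: "half_turn (at_arg t fs) (at_arg t gs) = (\<Sum>ps\<in>bool_lists (length gs).
      psi (at_arg t fs) (at_arg t (gs @ rev gs)) (replicate (length gs) True @ replicate (length gs) True)
        (ps @ rev (map Not ps)))" for t
    by (simp add: half_turn_def at_arg_def rev_map)
  show ?thesis unfolding eq
    by (intro continuous_intros isCont_psi) (auto dest: assms)
qed

lemma isCont_odd_turn:
  assumes "\<And>f. f \<in> set fs \<Longrightarrow> regular f" "\<And>g. g \<in> set gs \<Longrightarrow> regular g" "regular f" "regular g"
  shows "isCont (\<lambda>t. odd_turn s (at_arg t fs) (f t) (at_arg t gs) (g t)) 0"
proof -
  have eq: "odd_turn s (at_arg t fs) (f t) (at_arg t gs) (g t) = (\<Sum>ps\<in>bool_lists (length gs).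
      \<Sum>qs\<in>bool_lists (length gs). psi (at_arg t fs) (at_arg t (gs @ g # rev gs))
        (replicate (length gs) True @ True # replicate (length gs) True) (ps @ s # rev (map Not qs)) *
      row (f t) (at_arg t gs) True s ps qs)" for t
    by (simp add: odd_turn_def at_arg_def rev_map)
  show ?thesis unfolding eq
    by (intro continuous_intros isCont_psi isCont_row assms(3)) (auto dest: assms(1,2) simp: assms(4))
qed

lemma odd_rel_all:
  assumes a4: "a ^ 4 \<noteq> 1" and len: "length xs = length ys" and nz: "0 \<notin> set (xs @ [x] @ ys @ [v])"
  shows "odd_rel xs x ys v \<and> odd_rel' xs x ys v"
proof -
  let ?zs = "xs @ ys @ [v]"
  let ?D = "deform ?zs" and ?m = "length xs"
  define fs where "fs = take ?m ?D"
  define gs where "gs = take ?m (drop ?m ?D)"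
  define g where "g = ?D ! (2 * ?m)"
  have "length ?D = Suc (2 * ?m)" using len by (simp add: deform_def)
  then have D: "?D = fs @ gs @ [g]" and l: "length fs = ?m" "length gs = ?m"
    by (simp_all add: fs_def gs_def g_def take_add[symmetric] take_Suc_conv_app_nth[symmetric]
        append_take_drop_id flip: append_assoc mult_2)
  have at0: "at_arg 0 fs = xs" "at_arg 0 gs = ys" "g 0 = v"
    using at_arg_deform[of ?zs] l len unfolding D by (simp_all add: at_arg_def)
  have reg: "regular f" if "f \<in> set (fs @ gs @ [g])" for f
    using regular_deform[of ?zs] nz that unfolding D by auto
  have regx: "regular (\<lambda>t. x)" using nz by (auto simp: regular_def)
  \<comment> \<open>Only \<open>xs\<close>, \<open>ys\<close> and \<open>v\<close> are deformed;
    \<open>x\<close> is kept fixed.\<close>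
  have ev: "eventually (\<lambda>t. odd_rel (at_arg t fs) x (at_arg t gs) (g t) \<and>
      odd_rel' (at_arg t fs) x (at_arg t gs) (g t)) (at 0)"
    using eventually_generic_deform[of ?zs, unfolded D]
  proof (rule eventually_mono)
    show "0 \<notin> set ?zs" using nz by auto
    show "odd_rel (at_arg t fs) x (at_arg t gs) (g t) \<and> odd_rel' (at_arg t fs) x (at_arg t gs) (g t)"
      if "generic (at_arg t (fs @ gs @ [g]))" for t
      using odd_rels[OF a4, of ?m, unfolded odd_rels_def, rule_format, of "at_arg t fs" "at_arg t gs" "g t" x] that l nz
      by (simp add: at_arg_def)
  qed
  have cdw: "isCont (\<lambda>t. domain_wall (at_arg t fs @ [x]) (at_arg t gs @ [g t])) 0"
    using isCont_domain_wall[of "fs @ [\<lambda>t. x]" "gs @ [g]"] reg regx by (auto simp: at_arg_def)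
  have cht: "isCont (\<lambda>t. half_turn (at_arg t fs @ [x]) (at_arg t gs @ [g t])) 0"
    using isCont_half_turn[of "fs @ [\<lambda>t. x]" "gs @ [g]"] reg regx by (auto simp: at_arg_def)
  have c: "isCont (\<lambda>t. domain_wall (at_arg t fs) (at_arg t gs)) 0" "isCont (\<lambda>t. half_turn (at_arg t fs) (at_arg t gs)) 0"
    "isCont (\<lambda>t. odd_turn s (at_arg t fs) x (at_arg t gs) (g t)) 0" "isCont g 0" "g 0 \<noteq> 0" for s
    using isCont_domain_wall[of fs gs] isCont_half_turn[of fs gs] isCont_odd_turn[of fs gs "\<lambda>t. x" g s] reg regx
    by (auto simp: regular_def)
  have "domain_wall (at_arg 0 fs @ [x]) (at_arg 0 gs @ [g 0]) * half_turn (at_arg 0 fs) (at_arg 0 gs) -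
     sigma a * ((a + inverse a) * odd_turn True (at_arg 0 fs) x (at_arg 0 gs) (g 0) +
       (x * inverse (g 0) + inverse x * g 0) * odd_turn False (at_arg 0 fs) x (at_arg 0 gs) (g 0)) *
     domain_wall (at_arg 0 fs) (at_arg 0 gs) = 0"
    by (rule isCont_zero_if_eventually[of "\<lambda>t. domain_wall (at_arg t fs @ [x]) (at_arg t gs @ [g t]) *
        half_turn (at_arg t fs) (at_arg t gs) - sigma a * ((a + inverse a) *
        odd_turn True (at_arg t fs) x (at_arg t gs) (g t) + (x * inverse (g t) + inverse x * g t) *
        odd_turn False (at_arg t fs) x (at_arg t gs) (g t)) * domain_wall (at_arg t fs) (at_arg t gs)"])
      (use ev c cdw in \<open>auto intro!: continuous_intros elim!: eventually_mono simp: odd_rel_def\<close>)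
  moreover have "domain_wall (at_arg 0 fs) (at_arg 0 gs) * half_turn (at_arg 0 fs @ [x]) (at_arg 0 gs @ [g 0]) -
     sigma a * ((x * inverse (g 0) + inverse x * g 0) * odd_turn True (at_arg 0 fs) x (at_arg 0 gs) (g 0) +
       (a + inverse a) * odd_turn False (at_arg 0 fs) x (at_arg 0 gs) (g 0)) *
     domain_wall (at_arg 0 fs @ [x]) (at_arg 0 gs @ [g 0]) = 0"
    by (rule isCont_zero_if_eventually[of "\<lambda>t. domain_wall (at_arg t fs) (at_arg t gs) *
        half_turn (at_arg t fs @ [x]) (at_arg t gs @ [g t]) - sigma a * ((x * inverse (g t) + inverse x * g t) *
        odd_turn True (at_arg t fs) x (at_arg t gs) (g t) + (a + inverse a) *
        odd_turn False (at_arg t fs) x (at_arg t gs) (g t)) * domain_wall (at_arg t fs @ [x]) (at_arg t gs @ [g t])"])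
      (use ev c cdw cht in \<open>auto intro!: continuous_intros elim!: eventually_mono simp: odd_rel'_def\<close>)
  ultimately show ?thesis
    unfolding at0 odd_rel_def odd_rel'_def by simp
qed

end

subsection \<open>Sums over states as row sums\<close>

lemma sum_Pow_disjoint_union:
  assumes "A \<inter> B = {}"
  shows "(\<Sum>S\<in>Pow (A \<union> B). f S) = (\<Sum>S\<in>Pow A. \<Sum>T\<in>Pow B. f (S \<union> T))"
proof -
  have "(\<Sum>S\<in>Pow A. \<Sum>T\<in>Pow B. f (S \<union> T)) = (\<Sum>(S, T)\<in>Pow A \<times> Pow B. f (S \<union> T))"
    by (simp add: sum.cartesian_product)
  also have "\<dots> = (\<Sum>S\<in>Pow (A \<union> B). f S)"
    using assms
    by (intro sum.reindex_bij_witness[where i = "\<lambda>S. (S \<inter> A, S \<inter> B)" and j = "\<lambda>(S, T). S \<union> T"]) auto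
  finally show ?thesis by simp
qed

lemma sum_Pow_singleton_times: "(\<Sum>S\<in>Pow ({i} \<times> J). f S) = (\<Sum>S\<in>Pow J. f ({i} \<times> S))"
  by (rule sum.reindex_bij_witness[where j = "\<lambda>S. {k. (i, k) \<in> S}" and i = "\<lambda>S. {i} \<times> S"])
    (auto intro!: arg_cong[where f = f])

lemma sum_Pow_times_singleton: "(\<Sum>S\<in>Pow (I \<times> {j}). f S) = (\<Sum>S\<in>Pow I. f (S \<times> {j}))"
  by (rule sum.reindex_bij_witness[where j = "\<lambda>S. {k. (k, j) \<in> S}" and i = "\<lambda>S. S \<times> {j}"])
    (auto intro!: arg_cong[where f = f])

lemma sum_Pow_insert:
  assumes "e \<notin> A"
  shows "(\<Sum>S\<in>Pow (insert e A). f S) = (\<Sum>S\<in>Pow A. f S + f (insert e S))"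
proof -
  have "Pow {e} = {{}, {e}}" by auto
  then show ?thesis using sum_Pow_disjoint_union[of A "{e}" f] assms by simp
qed

text \<open>Used for fixed vertical edges: the rows are then independent, and the sum over all
  horizontal edges factorizes.\<close>

lemma sum_Pow_prod:
  fixes F :: "'i \<Rightarrow> 'j set \<Rightarrow> 'c::comm_semiring_1"
  assumes "finite I" "finite J"
  shows "(\<Sum>H\<in>Pow (I \<times> J). \<Prod>i\<in>I. F i {j. (i, j) \<in> H}) = (\<Prod>i\<in>I. \<Sum>S\<in>Pow J. F i S)"
  using assms(1)
proof (induction I)
  case empty
  then show ?case by simp
next
  case (insert k I)
  have split: "insert k I \<times> J = {k} \<times> J \<union> I \<times> J" "({k} \<times> J) \<inter> (I \<times> J) = {}"
    using insert by auto
  have "(\<Sum>H\<in>Pow (insert k I \<times> J). \<Prod>i\<in>insert k I. F i {j. (i, j) \<in> H}) =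
    (\<Sum>S\<in>Pow J. \<Sum>H\<in>Pow (I \<times> J). \<Prod>i\<in>insert k I. F i {j. (i, j) \<in> {k} \<times> S \<union> H})"
    unfolding split(1) sum_Pow_disjoint_union[OF split(2)] sum_Pow_singleton_times ..
  also have "\<dots> = (\<Sum>S\<in>Pow J. \<Sum>H\<in>Pow (I \<times> J). F k S * (\<Prod>i\<in>I. F i {j. (i, j) \<in> H}))"
  proof (intro sum.cong refl)
    fix S H assume "H \<in> Pow (I \<times> J)"
    then have "{j. (k, j) \<in> {k} \<times> S \<union> H} = S" "\<And>i. i \<in> I \<Longrightarrow> {j. (i, j) \<in> {k} \<times> S \<union> H} = {j. (i, j) \<in> H}"
      using insert by auto
    then show "(\<Prod>i\<in>insert k I. F i {j. (i, j) \<in> {k} \<times> S \<union> H}) = F k S * (\<Prod>i\<in>I. F i {j. (i, j) \<in> H})"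
      using insert by simp
  qed
  finally show ?case
    using insert by (simp add: sum_distrib_right sum_distrib_left[symmetric])
qed

lemma sum_Pow_bool_lists:
  "(\<Sum>S\<in>Pow {Suc c..c + n}. f (map (\<lambda>j. j \<in> S) [Suc c..<Suc (c + n)])) = (\<Sum>bs\<in>bool_lists n. f bs)"
proof (rule sum.reindex_bij_witness[where j = "\<lambda>S. map (\<lambda>j. j \<in> S) [Suc c..<Suc (c + n)]"
      and i = "\<lambda>bs. {j \<in> {Suc c..c + n}. bs ! (j - Suc c)}"])
  show "{j \<in> {Suc c..c + n}. map (\<lambda>j. j \<in> S) [Suc c..<Suc (c + n)] ! (j - Suc c)} = S"
    if "S \<in> Pow {Suc c..c + n}" for S
  proof -
    have "map (\<lambda>j. j \<in> S) [Suc c..<Suc (c + n)] ! (j - Suc c) \<longleftrightarrow> j \<in> S" if "j \<in> {Suc c..c + n}" for j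
      using that by (subst nth_map) (auto simp: nth_upt simp del: upt_Suc)
    then show ?thesis using that by auto
  qed
  show "map (\<lambda>j. j \<in> {j \<in> {Suc c..c + n}. bs ! (j - Suc c)}) [Suc c..<Suc (c + n)] = bs"
    if "bs \<in> bool_lists n" for bs
    using that by (intro nth_equalityI) (auto simp: bool_lists_def nth_upt simp del: upt_Suc)
qed (auto simp: bool_lists_def simp del: upt_Suc)

context six_vertex
begin

text \<open>A configuration violating the ice rule at some vertex has a zero factor there, so the
  sum may run over all orientations.\<close>

lemma state_sum_eq:
  assumes "finite Vtx"
  shows "state_sum a Vtx HE VE z R U P = (\<Sum>H\<in>Pow HE. \<Sum>V\<in>Pow VE. of_bool (P H V) *
    (\<Prod>(i, j)\<in>Vtx. vwt a (z i j) (R H V i (j - 1)) (R H V i j) (U H V i j) (U H V (i + 1) j)))"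
  unfolding state_sum_def
proof (intro sum.cong refl)
  fix H V
  have "(\<Prod>(i, j)\<in>Vtx. vwt a (z i j) (R H V i (j - 1)) (R H V i j) (U H V i j) (U H V (i + 1) j)) = 0"
    if not_ice: "\<not> (\<forall>(i, j)\<in>Vtx. ice (R H V i (j - 1)) (R H V i j) (U H V i j) (U H V (i + 1) j))"
  proof -
    obtain i j where "(i, j) \<in> Vtx" "\<not> ice (R H V i (j - 1)) (R H V i j) (U H V i j) (U H V (i + 1) j)"
      using not_ice by auto
    then show ?thesis
      by (intro prod_zero[OF assms bexI[of _ "(i, j)"]]) (simp_all add: ice_vwt)
  qed
  then show "(if P H V \<and> (\<forall>(i, j)\<in>Vtx. ice (R H V i (j - 1)) (R H V i j) (U H V i j) (U H V (i + 1) j))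
      then \<Prod>(i, j)\<in>Vtx. vwt a (z i j) (R H V i (j - 1)) (R H V i j) (U H V i j) (U H V (i + 1) j) else 0) =
    of_bool (P H V) * (\<Prod>(i, j)\<in>Vtx. vwt a (z i j) (R H V i (j - 1)) (R H V i j) (U H V i j) (U H V (i + 1) j))"
    by auto
qed

lemma sum_row:
  assumes "n \<ge> 1"
  shows "(\<Sum>S\<in>Pow {Suc c..<c + n}. \<Prod>j\<in>{Suc c..c + n}. vwt a (x * inverse (y j))
      (if j - 1 = c then l else j - 1 \<in> S) (if j = c + n then r else j \<in> S) (t j) (b j)) =
    row x (map y [Suc c..<Suc (c + n)]) l r (map t [Suc c..<Suc (c + n)]) (map b [Suc c..<Suc (c + n)])"
  using assms
proof (induction n arbitrary: r rule: dec_induct)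
  case base
  then show ?case by (cases r) (simp_all add: UNIV_bool)
next
  case (step n)
  let ?w = "\<lambda>n r S j. vwt a (x * inverse (y j))
      (if j - 1 = c then l else j - 1 \<in> S) (if j = c + n then r else j \<in> S) (t j) (b j)"
  let ?e = "c + n"
  have iv: "{Suc c..<c + Suc n} = insert ?e {Suc c..<c + n}" "?e \<notin> {Suc c..<c + n}"
    "{Suc c..c + Suc n} = insert (Suc ?e) {Suc c..c + n}"
    using step.hyps by auto
  have up: "[Suc c..<Suc (c + Suc n)] = [Suc c..<Suc (c + n)] @ [Suc ?e]"
    using step.hyps by simp
  have part: "(\<Prod>j\<in>{Suc c..c + Suc n}. ?w (Suc n) r T j) =
      (\<Prod>j\<in>{Suc c..c + n}. ?w n k S j) * vwt a (x * inverse (y (Suc ?e))) k r (t (Suc ?e)) (b (Suc ?e))"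
    if S: "S \<in> Pow {Suc c..<c + n}" and T: "T = (if k then insert ?e S else S)" for S T k
  proof -
    have e: "?e \<in> T \<longleftrightarrow> k" using S T by auto
    have "?w (Suc n) r T j = ?w n k S j" if "j \<in> {Suc c..c + n}" for j
    proof -
      have "j - 1 \<in> T \<longleftrightarrow> j - 1 \<in> S" "j \<in> T \<longleftrightarrow> (if j = ?e then k else j \<in> S)" "j \<noteq> c + Suc n"
        using that S T by auto
      then show ?thesis by (cases "j = ?e") simp_all
    qed
    then show ?thesis
      unfolding iv(3) using e step.hyps by (simp add: mult.commute)
  qed
  have "(\<Sum>S\<in>Pow {Suc c..<c + Suc n}. \<Prod>j\<in>{Suc c..c + Suc n}. ?w (Suc n) r S j) =
    (\<Sum>k\<in>UNIV. \<Sum>S\<in>Pow {Suc c..<c + n}. (\<Prod>j\<in>{Suc c..c + n}. ?w n k S j) *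
       vwt a (x * inverse (y (Suc ?e))) k r (t (Suc ?e)) (b (Suc ?e)))"
    (is "_ = (\<Sum>k\<in>UNIV. \<Sum>S\<in>_. ?g k S)")
  proof -
    have "(\<Sum>S\<in>Pow {Suc c..<c + Suc n}. \<Prod>j\<in>{Suc c..c + Suc n}. ?w (Suc n) r S j) =
      (\<Sum>S\<in>Pow {Suc c..<c + n}. ?g False S + ?g True S)"
      unfolding iv(1) sum_Pow_insert[OF iv(2)]
      by (intro sum.cong refl arg_cong2[where f = "(+)"] part) simp_all
    then show ?thesis
      by (simp only: sum.distrib UNIV_bool sum.insert sum.empty finite.intros) simp
  qed
  also have "\<dots> = (\<Sum>k\<in>UNIV. row x (map y [Suc c..<Suc (c + n)]) l k (map t [Suc c..<Suc (c + n)])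
      (map b [Suc c..<Suc (c + n)]) * vwt a (x * inverse (y (Suc ?e))) k r (t (Suc ?e)) (b (Suc ?e)))"
    by (simp only: sum_distrib_right[symmetric] step.IH)
  also have "\<dots> = row x (map y [Suc c..<Suc (c + Suc n)]) l r (map t [Suc c..<Suc (c + Suc n)])
      (map b [Suc c..<Suc (c + Suc n)])"
    unfolding up map_append by (subst row_append) (simp_all add: UNIV_bool)
  finally show ?case .
qed

lemma sum_grid:
  assumes "n \<ge> 1"
  shows "(\<Sum>V\<in>Pow ({Suc (Suc p)..p + n} \<times> {Suc c..c + k}). \<Prod>i\<in>{Suc p..p + n}.
      row (x i) (map y [Suc c..<Suc (c + k)]) (l i) (r i)
        (map (\<lambda>j. if i = Suc p then t j else (i, j) \<in> V) [Suc c..<Suc (c + k)])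
        (map (\<lambda>j. if i = p + n then b j else (Suc i, j) \<in> V) [Suc c..<Suc (c + k)])) =
    grid (map x [Suc p..<Suc (p + n)]) (map y [Suc c..<Suc (c + k)]) (map l [Suc p..<Suc (p + n)])
      (map r [Suc p..<Suc (p + n)]) (map t [Suc c..<Suc (c + k)]) (map b [Suc c..<Suc (c + k)])"
  using assms
proof (induction n arbitrary: b rule: dec_induct)
  case base
  then show ?case by (simp add: grid_single del: grid.simps upt_Suc add: upt_rec[of _ "Suc (Suc p)"])
next
  case (step n)
  let ?J = "[Suc c..<Suc (c + k)]"
  let ?w = "\<lambda>n b V i. row (x i) (map y ?J) (l i) (r i)
        (map (\<lambda>j. if i = Suc p then t j else (i, j) \<in> V) ?J)
        (map (\<lambda>j. if i = p + n then b j else (Suc i, j) \<in> V) ?J)"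
  let ?e = "Suc (p + n)"
  have iv: "{Suc (Suc p)..p + Suc n} \<times> {Suc c..c + k} =
      {Suc (Suc p)..p + n} \<times> {Suc c..c + k} \<union> {?e} \<times> {Suc c..c + k}"
    "({Suc (Suc p)..p + n} \<times> {Suc c..c + k}) \<inter> ({?e} \<times> {Suc c..c + k}) = {}"
    "{Suc p..p + Suc n} = insert ?e {Suc p..p + n}"
    using step.hyps by auto
  have up: "[Suc p..<Suc (p + Suc n)] = [Suc p..<Suc (p + n)] @ [?e]"
    using step.hyps by simp
  have part: "(\<Prod>i\<in>{Suc p..p + Suc n}. ?w (Suc n) b (V \<union> {?e} \<times> S) i) =
      (\<Prod>i\<in>{Suc p..p + n}. ?w n (\<lambda>j. j \<in> S) V i) *
      row (x ?e) (map y ?J) (l ?e) (r ?e) (map (\<lambda>j. j \<in> S) ?J) (map b ?J)"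
    if V: "V \<in> Pow ({Suc (Suc p)..p + n} \<times> {Suc c..c + k})" for V S
  proof -
    have e: "(?e, j) \<notin> V" "(Suc ?e, j) \<notin> V" for j using V by auto
    have "?w (Suc n) b (V \<union> {?e} \<times> S) i = ?w n (\<lambda>j. j \<in> S) V i" if "i \<in> {Suc p..p + n}" for i
      using that e by (intro arg_cong2[where f = "row (x i) (map y ?J) (l i) (r i)"] map_cong refl) auto
    moreover have "?w (Suc n) b (V \<union> {?e} \<times> S) ?e =
        row (x ?e) (map y ?J) (l ?e) (r ?e) (map (\<lambda>j. j \<in> S) ?J) (map b ?J)"
      using e step.hyps by (intro arg_cong2[where f = "row (x ?e) (map y ?J) (l ?e) (r ?e)"] map_cong refl) auto
    ultimately show ?thesis
      unfolding iv(3) by (simp add: mult.commute del: upt_Suc)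
  qed
  have "(\<Sum>V\<in>Pow ({Suc (Suc p)..p + Suc n} \<times> {Suc c..c + k}). \<Prod>i\<in>{Suc p..p + Suc n}. ?w (Suc n) b V i) =
    (\<Sum>V\<in>Pow ({Suc (Suc p)..p + n} \<times> {Suc c..c + k}). \<Sum>S\<in>Pow {Suc c..c + k}.
      (\<Prod>i\<in>{Suc p..p + n}. ?w n (\<lambda>j. j \<in> S) V i) *
      row (x ?e) (map y ?J) (l ?e) (r ?e) (map (\<lambda>j. j \<in> S) ?J) (map b ?J))"
    unfolding iv(1) sum_Pow_disjoint_union[OF iv(2)] sum_Pow_singleton_times
    by (intro sum.cong refl part)
  also have "\<dots> = (\<Sum>S\<in>Pow {Suc c..c + k}.
      grid (map x [Suc p..<Suc (p + n)]) (map y ?J) (map l [Suc p..<Suc (p + n)])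
        (map r [Suc p..<Suc (p + n)]) (map t ?J) (map (\<lambda>j. j \<in> S) ?J) *
      row (x ?e) (map y ?J) (l ?e) (r ?e) (map (\<lambda>j. j \<in> S) ?J) (map b ?J))"
    by (subst sum.swap) (simp only: sum_distrib_right[symmetric] step.IH)
  also have "\<dots> = (\<Sum>qs\<in>bool_lists k.
      grid (map x [Suc p..<Suc (p + n)]) (map y ?J) (map l [Suc p..<Suc (p + n)])
        (map r [Suc p..<Suc (p + n)]) (map t ?J) qs *
      row (x ?e) (map y ?J) (l ?e) (r ?e) qs (map b ?J))"
    by (rule sum_Pow_bool_lists)
  also have "\<dots> = grid (map x [Suc p..<Suc (p + Suc n)]) (map y ?J) (map l [Suc p..<Suc (p + Suc n)])
      (map r [Suc p..<Suc (p + Suc n)]) (map t ?J) (map b ?J)"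
    unfolding up map_append
    by (subst grid_vertical_append) (simp_all add: grid_single del: grid.simps upt_Suc)
  finally show ?case .
qed

text \<open>The offsets \<open>p\<close> and \<open>c\<close> allow a rectangle anywhere in the
  lattice, in particular the half-height last column of the odd model.\<close>

lemma sum_rectangle:
  assumes "n \<ge> 1" "k \<ge> 1"
  shows "(\<Sum>H\<in>Pow ({Suc p..p + n} \<times> {Suc c..<c + k}). \<Sum>V\<in>Pow ({Suc (Suc p)..p + n} \<times> {Suc c..c + k}).
      \<Prod>(i, j)\<in>{Suc p..p + n} \<times> {Suc c..c + k}. vwt a (x i * inverse (y j))
        (if j - 1 = c then l i else (i, j - 1) \<in> H) (if j = c + k then r i else (i, j) \<in> H)
        (if i = Suc p then t j else (i, j) \<in> V) (if i = p + n then b j else (Suc i, j) \<in> V)) =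
    grid (map x [Suc p..<Suc (p + n)]) (map y [Suc c..<Suc (c + k)]) (map l [Suc p..<Suc (p + n)])
      (map r [Suc p..<Suc (p + n)]) (map t [Suc c..<Suc (c + k)]) (map b [Suc c..<Suc (c + k)])"
    (is "?L = _")
proof -
  let ?I = "{Suc p..p + n}" and ?J = "{Suc c..c + k}"
  let ?F = "\<lambda>V i S. \<Prod>j\<in>?J. vwt a (x i * inverse (y j))
        (if j - 1 = c then l i else j - 1 \<in> S) (if j = c + k then r i else j \<in> S)
        (if i = Suc p then t j else (i, j) \<in> V) (if i = p + n then b j else (Suc i, j) \<in> V)"
  have "?L = (\<Sum>V\<in>Pow ({Suc (Suc p)..p + n} \<times> ?J). \<Sum>H\<in>Pow (?I \<times> {Suc c..<c + k}).
      \<Prod>i\<in>?I. ?F V i {j. (i, j) \<in> H})"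
    by (subst sum.swap) (simp only: prod.cartesian_product mem_Collect_eq)
  also have "\<dots> = (\<Sum>V\<in>Pow ({Suc (Suc p)..p + n} \<times> ?J). \<Prod>i\<in>?I. \<Sum>S\<in>Pow {Suc c..<c + k}. ?F V i S)"
    by (intro sum.cong refl sum_Pow_prod) simp_all
  also have "\<dots> = grid (map x [Suc p..<Suc (p + n)]) (map y [Suc c..<Suc (c + k)]) (map l [Suc p..<Suc (p + n)])
      (map r [Suc p..<Suc (p + n)]) (map t [Suc c..<Suc (c + k)]) (map b [Suc c..<Suc (c + k)])"
    unfolding sum_row[OF assms(2)] by (rule sum_grid[OF assms(1)])
  finally show ?thesis .
qed

section \<open>Identification with the lattices of the statement\<close>

abbreviation params :: "(nat \<Rightarrow> complex) \<Rightarrow> nat \<Rightarrow> complex list" where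
  "params x n \<equiv> map x [1..<Suc n]"

lemma Zdw_eq: "Zdw a n x y = domain_wall (params x n) (params y n)"
proof (cases "n = 0")
  case True
  then show ?thesis by (simp add: Zdw_def state_sum_def domain_wall_def)
next
  case False
  then have n: "n \<ge> 1" by simp
  have "Zdw a n x y = (\<Sum>H\<in>Pow ({Suc 0..0 + n} \<times> {Suc 0..<0 + n}). \<Sum>V\<in>Pow ({Suc (Suc 0)..0 + n} \<times> {Suc 0..0 + n}).
      \<Prod>(i, j)\<in>{Suc 0..0 + n} \<times> {Suc 0..0 + n}. vwt a (x i * inverse (y j))
        (if j - 1 = 0 then True else (i, j - 1) \<in> H) (if j = 0 + n then False else (i, j) \<in> H)
        (if i = Suc 0 then True else (i, j) \<in> V) (if i = 0 + n then False else (Suc i, j) \<in> V))"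
    unfolding Zdw_def
    by (subst state_sum_eq, simp)
      (auto intro!: sum.cong prod.cong arg_cong2[where f = "vwt a _ _ _"] arg_cong2[where f = "vwt a _"]
        simp: numeral_2_eq_2)
  also have "\<dots> = grid (params x n) (params y n) (map (\<lambda>_. True) [1..<Suc n]) (map (\<lambda>_. False) [1..<Suc n])
      (map (\<lambda>_. True) [1..<Suc n]) (map (\<lambda>_. False) [1..<Suc n])"
    by (subst sum_rectangle[OF n n]) simp
  finally show ?thesis
    by (simp add: domain_wall_def psi_def map_replicate_const del: upt_Suc)
qed

end

lemma map_reflect:
  "map (\<lambda>r. g (Suc (p + m) - r)) [Suc p..<Suc (p + m)] = rev (map g [1..<Suc m])"
  by (rule nth_equalityI) (simp_all add: rev_nth nth_upt Suc_diff_Suc del: upt_Suc)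

context six_vertex
begin

lemma grid_rotate_lower:
  assumes "length ls = length xs" "length rs = length xs" "length ts = length ys" "length bs = length ys"
  shows "grid (rev xs) ys ls rs ts bs =
    grid xs (rev ys) (rev (map Not rs)) (rev (map Not ls)) (rev (map Not bs)) (rev (map Not ts))"
  using grid_rotate[of "rev (map Not rs)" xs "rev (map Not ls)" "rev (map Not bs)" "rev ys" "rev (map Not ts)"] assms
  by (simp add: rev_map comp_def)

text \<open>The lattice is cut in the middle. A half-turn of the lower half turns its right edges
  \<open>rev (map Not rs)\<close> into left edges \<open>rs\<close>, along which it fits to the
  upper half.\<close>

lemma half_turn_eq_grid:
  assumes "length xs = length ys"
  shows "half_turn xs ys = (\<Sum>rs\<in>bool_lists (length xs). grid (xs @ rev xs) ys
    (tops xs @ tops xs) (rs @ rev (map Not rs)) (tops ys) (replicate (length ys) False))"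
proof -
  let ?F = "replicate (length ys) False" and ?X = "bool_lists (length xs)" and ?Y = "bool_lists (length ys)"
  have "(\<Sum>rs\<in>?X. grid (xs @ rev xs) ys (tops xs @ tops xs) (rs @ rev (map Not rs)) (tops ys) ?F) =
    (\<Sum>rs\<in>?X. \<Sum>ps\<in>?Y. grid xs ys (tops xs) rs (tops ys) ps *
      grid xs (rev ys) rs (replicate (length xs) False) (tops ys) (rev (map Not ps)))"
  proof (intro sum.cong refl)
    fix rs assume rs: "rs \<in> ?X"
    have "grid (rev xs) ys (tops xs) (rev (map Not rs)) ps ?F =
      grid xs (rev ys) rs (replicate (length xs) False) (tops ys) (rev (map Not ps))" if "ps \<in> ?Y" for ps
      using that rs by (subst grid_rotate_lower) (simp_all add: bool_lists_def rev_map comp_def)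
    then show "grid (xs @ rev xs) ys (tops xs @ tops xs) (rs @ rev (map Not rs)) (tops ys) ?F =
      (\<Sum>ps\<in>?Y. grid xs ys (tops xs) rs (tops ys) ps *
      grid xs (rev ys) rs (replicate (length xs) False) (tops ys) (rev (map Not ps)))"
      using rs by (subst grid_vertical_append) (simp_all add: bool_lists_def)
  qed
  also have "\<dots> = half_turn xs ys"
    unfolding half_turn_def
  proof (subst sum.swap, intro sum.cong refl)
    fix ps assume "ps \<in> ?Y"
    then show "(\<Sum>rs\<in>?X. grid xs ys (tops xs) rs (tops ys) ps *
        grid xs (rev ys) rs (replicate (length xs) False) (tops ys) (rev (map Not ps))) =
      psi xs (ys @ rev ys) (tops ys @ tops ys) (ps @ rev (map Not ps))"
      unfolding psi_def by (subst grid_horizontal_append) (simp_all add: bool_lists_def)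
  qed
  finally show ?thesis by simp
qed

text \<open>\<open>as\<close>, \<open>s\<close> and \<open>cs\<close> are the edges to the right of
  the full columns in the upper, middle and lower rows. The second grid is the half-height column
  \<open>v\<close>, whose right edges are joined to \<open>as\<close> by the U-turns.\<close>

lemma odd_turn_eq_grid:
  assumes "length xs = length ys"
  shows "odd_turn s xs x ys v = (\<Sum>as\<in>bool_lists (length xs). \<Sum>cs\<in>bool_lists (length xs).
    grid (xs @ x # rev xs) ys (tops xs @ True # tops xs) (as @ s # cs) (tops ys) (replicate (length ys) False) *
    grid (rev xs) [v] cs (rev (map Not as)) [\<not> s] [False])"
proof -
  let ?F = "replicate (length ys) False" and ?X = "bool_lists (length xs)" and ?Y = "bool_lists (length ys)"
  let ?U = "\<lambda>as ps. grid xs ys (tops xs) as (tops ys) ps"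
  let ?L = "\<lambda>cs qs. grid (rev xs) ys (tops xs) cs qs ?F"
  let ?C = "\<lambda>as cs. grid (rev xs) [v] cs (rev (map Not as)) [\<not> s] [False]"
  let ?M = "\<lambda>as qs. grid xs (v # rev ys) as (replicate (length xs) False) (True # tops ys) (s # rev (map Not qs))"
  \<comment> \<open>The lower half and the column \<open>v\<close> to its right form one rectangle,
    whose half-turn starts with \<open>v\<close>.\<close>
  have lower: "(\<Sum>cs\<in>?X. ?L cs qs * ?C as cs) = ?M as qs" if "as \<in> ?X" "qs \<in> ?Y" for as qs
  proof -
    have "(\<Sum>cs\<in>?X. ?L cs qs * ?C as cs) =
      grid (rev xs) (ys @ [v]) (tops xs) (rev (map Not as)) (qs @ [\<not> s]) (?F @ [False])"
      using that by (subst grid_horizontal_append) (simp_all add: bool_lists_def)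
    also have "\<dots> = ?M as qs"
      using that by (subst grid_rotate_lower) (simp_all add: bool_lists_def rev_map comp_def)
    finally show ?thesis .
  qed
  have "(\<Sum>as\<in>?X. \<Sum>cs\<in>?X. grid (xs @ x # rev xs) ys (tops xs @ True # tops xs) (as @ s # cs) (tops ys) ?F * ?C as cs) =
    (\<Sum>as\<in>?X. \<Sum>cs\<in>?X. \<Sum>ps\<in>?Y. \<Sum>qs\<in>?Y. ?U as ps * row x ys True s ps qs * ?L cs qs * ?C as cs)"
    by (intro sum.cong refl, subst grid_vertical_append)
      (simp_all add: bool_lists_def sum_distrib_left sum_distrib_right mult.assoc)
  also have "\<dots> = (\<Sum>as\<in>?X. \<Sum>ps\<in>?Y. \<Sum>qs\<in>?Y. ?U as ps * row x ys True s ps qs * (\<Sum>cs\<in>?X. ?L cs qs * ?C as cs))"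
  proof (rule sum.cong[OF refl])
    fix as
    show "(\<Sum>cs\<in>?X. \<Sum>ps\<in>?Y. \<Sum>qs\<in>?Y. ?U as ps * row x ys True s ps qs * ?L cs qs * ?C as cs) =
      (\<Sum>ps\<in>?Y. \<Sum>qs\<in>?Y. ?U as ps * row x ys True s ps qs * (\<Sum>cs\<in>?X. ?L cs qs * ?C as cs))"
      by (subst sum.swap, rule sum.cong[OF refl], subst sum.swap) (simp add: sum_distrib_left mult.assoc)
  qed
  also have "\<dots> = (\<Sum>as\<in>?X. \<Sum>ps\<in>?Y. \<Sum>qs\<in>?Y. ?U as ps * row x ys True s ps qs * ?M as qs)"
    by (intro sum.cong refl) (simp only: lower)
  also have "\<dots> = (\<Sum>ps\<in>?Y. \<Sum>qs\<in>?Y. (\<Sum>as\<in>?X. ?U as ps * ?M as qs) * row x ys True s ps qs)"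
    by (subst sum.swap, rule sum.cong[OF refl], subst sum.swap) (simp add: sum_distrib_left sum_distrib_right mult_ac)
  also have "\<dots> = odd_turn s xs x ys v"
    unfolding odd_turn_def
  proof (intro sum.cong refl arg_cong2[where f = "(*)"])
    fix ps qs assume "ps \<in> ?Y" "qs \<in> ?Y"
    then show "(\<Sum>as\<in>?X. ?U as ps * ?M as qs) =
        psi xs (ys @ v # rev ys) (tops ys @ True # tops ys) (ps @ s # rev (map Not qs))"
      unfolding psi_def by (subst grid_horizontal_append) (simp_all add: bool_lists_def)
  qed
  finally show ?thesis by simp
qed

lemma map_upt_double:
  "map f [1..<Suc (2 * m)] = map f [1..<Suc m] @ map f [Suc m..<Suc (m + m)]"
  using upt_add_eq_append[of 1 "Suc m" m] by (simp add: mult_2 del: upt_Suc)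

lemma map_upt_odd:
  "map f [1..<Suc (2 * m + 1)] = map f [1..<Suc m] @ f (Suc m) # map f [Suc (Suc m)..<Suc (Suc m + m)]"
  using upt_add_eq_append[of 1 "Suc m" "Suc m"]
  by (simp add: mult_2 upt_conv_Cons[of "Suc m"] del: upt_Suc)

lemma ZHT_eq: "ZHT a m x y = half_turn (params x m) (params y m)"
proof (cases "m = 0")
  case True
  then show ?thesis by (simp add: ZHT_def state_sum_def half_turn_def)
next
  case False
  then have m: "m \<ge> 1" and m2: "2 * m \<ge> 1" by simp_all
  let ?V = "Pow ({Suc (Suc 0)..0 + 2 * m} \<times> {Suc 0..0 + m})"
  let ?H = "Pow ({Suc 0..0 + 2 * m} \<times> {Suc 0..<0 + m})"
  let ?x = "\<lambda>r. x (min r (2 * m + 1 - r))"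
  \<comment> \<open>\<open>A\<close> consists of the rows of the upper half whose U-turn edge points
    right; the same edge, seen from the lower half, has the opposite direction.\<close>
  let ?r = "\<lambda>A r. if r > m then 2 * m + 1 - r \<notin> A else r \<in> A"
  let ?w = "\<lambda>A H V. \<Prod>(i, j)\<in>{Suc 0..0 + 2 * m} \<times> {Suc 0..0 + m}. vwt a (?x i * inverse (y j))
        (if j - 1 = 0 then True else (i, j - 1) \<in> H) (if j = 0 + m then ?r A i else (i, j) \<in> H)
        (if i = Suc 0 then True else (i, j) \<in> V) (if i = 0 + 2 * m then False else (Suc i, j) \<in> V)"
  have disj: "({1..2*m} \<times> {1..<m}) \<inter> ({1..m} \<times> {m}) = {}" by auto
  have "ZHT a m x y = (\<Sum>H\<in>?H. \<Sum>A\<in>Pow {1..m}. \<Sum>V\<in>?V. ?w A H V)"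
    unfolding ZHT_def
    unfolding state_sum_eq[OF finite_cartesian_product[OF finite_atLeastAtMost finite_atLeastAtMost]]
      sum_Pow_disjoint_union[OF disj] sum_Pow_times_singleton
  proof (intro sum.cong refl, goal_cases)
    case 1
    then show ?case by simp
  next
    case (2 H A)
    then show ?case by (auto simp: numeral_2_eq_2)
  next
    case (3 H A V)
    have H: "(i, m) \<notin> H" for i using 3(1) by auto
    have A: "i \<notin> A" if "i > m" for i using 3(2) that by auto
    have J: "j - Suc 0 \<noteq> m" if "j \<le> m" for j using that m by auto
    show ?case
      using H A J
      by (auto intro!: prod.cong arg_cong2[where f = "vwt a _ _ _"] arg_cong2[where f = "vwt a _"])
  qed
  also have "\<dots> = (\<Sum>A\<in>Pow {1..m}. \<Sum>H\<in>?H. \<Sum>V\<in>?V. ?w A H V)"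
    by (rule sum.swap)
  also have "\<dots> = (\<Sum>A\<in>Pow {1..m}. grid (params ?x (2 * m)) (params y m) (map (\<lambda>_. True) [1..<Suc (2 * m)])
      (map (?r A) [1..<Suc (2 * m)]) (map (\<lambda>_. True) [1..<Suc m]) (map (\<lambda>_. False) [1..<Suc m]))"
    by (intro sum.cong refl, subst sum_rectangle[OF m2 m]) simp
  also have "\<dots> = (\<Sum>A\<in>Pow {Suc 0..0 + m}. grid (params x m @ rev (params x m)) (params y m)
      (tops (params x m) @ tops (params x m))
      (map (\<lambda>j. j \<in> A) [Suc 0..<Suc (0 + m)] @ rev (map Not (map (\<lambda>j. j \<in> A) [Suc 0..<Suc (0 + m)])))
      (tops (params y m)) (replicate (length (params y m)) False))"
  proof (rule sum.cong, goal_cases)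
    case (2 A)
    have "params ?x (2 * m) = params x m @ rev (params x m)"
      unfolding map_upt_double map_reflect[of x m m, symmetric]
      by (intro arg_cong2[where f = "(@)"] map_cong refl arg_cong[where f = x]) auto
    moreover have "map (?r A) [1..<Suc (2 * m)] = map (\<lambda>j. j \<in> A) [1..<Suc m] @ rev (map (\<lambda>j. j \<notin> A) [1..<Suc m])"
      unfolding map_upt_double map_reflect[of "\<lambda>j. j \<notin> A" m m, symmetric]
      by (intro arg_cong2[where f = "(@)"] map_cong refl) (auto simp: mult_2)
    ultimately show ?case
      by (simp add: map_replicate_const replicate_add[symmetric] comp_def mult_2 del: upt_Suc)
  qed simp
  also have "\<dots> = half_turn (params x m) (params y m)"
    by (subst sum_Pow_bool_lists) (simp add: half_turn_eq_grid del: upt_Suc)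
  finally show ?thesis .
qed

lemma ZHTodd_gen_eq:
  assumes "m \<ge> 1"
  shows "ZHTodd_gen a m x y (\<lambda>H V. ((m + 1, m) \<in> H) = s) =
    odd_turn s (params x m) (x (Suc m)) (params y m) (y (Suc m))"
proof -
  let ?n = "2 * m + 1"
  let ?x = "\<lambda>r. x (min r (2 * m + 2 - r))"
  let ?H = "Pow ({Suc 0..0 + ?n} \<times> {Suc 0..<0 + m})"
  let ?V = "Pow ({Suc (Suc 0)..0 + ?n} \<times> {Suc 0..0 + m})"
  let ?W = "Pow ({Suc (Suc (Suc m))..Suc m + m} \<times> {Suc m..m + 1})"
  \<comment> \<open>A member of \<open>?D\<close> tells in which rows the edge to the right of
    column \<open>m\<close> points right. Once it is fixed, the full columns and the half-height
    column factorize.\<close>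
  let ?D = "Pow {Suc 0..0 + ?n}"
  let ?xs = "params x m" and ?ys = "params y m"
  \<comment> \<open>Position \<open>m\<close> of \<open>ds\<close>, counted from 0, belongs to the
    middle row \<open>Suc m\<close>.\<close>
  let ?f = "\<lambda>ds. of_bool (ds ! m = s) * (grid (?xs @ x (Suc m) # rev ?xs) ?ys (tops ?xs @ True # tops ?xs)
        ds (tops ?ys) (replicate (length ?ys) False) *
      grid (rev ?xs) [y (Suc m)] (drop (Suc m) ds) (rev (map Not (take m ds))) [\<not> ds ! m] [False])"
  let ?w = "\<lambda>D H V. \<Prod>(i, j)\<in>{Suc 0..0 + ?n} \<times> {Suc 0..0 + m}. vwt a (?x i * inverse (y j))
        (if j - 1 = 0 then True else (i, j - 1) \<in> H) (if j = 0 + m then i \<in> D else (i, j) \<in> H)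
        (if i = Suc 0 then True else (i, j) \<in> V) (if i = 0 + ?n then False else (Suc i, j) \<in> V)"
  let ?c = "\<lambda>D (G :: (nat \<times> nat) set) V. \<Prod>(i, j)\<in>{Suc (Suc m)..Suc m + m} \<times> {Suc m..m + 1}. vwt a (?x i * inverse (y j))
        (if j - 1 = m then i \<in> D else (i, j - 1) \<in> G) (if j = m + 1 then 2 * m + 2 - i \<notin> D else (i, j) \<in> G)
        (if i = Suc (Suc m) then Suc m \<notin> D else (i, j) \<in> V) (if i = Suc m + m then False else (Suc i, j) \<in> V)"
  have HE: "{1..2*m+1} \<times> {1..m} = {1..2*m+1} \<times> {1..<m} \<union> {1..2*m+1} \<times> {m}"
    and Hdisj: "({1..2*m+1} \<times> {1..<m}) \<inter> ({1..2*m+1} \<times> {m}) = {}"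
    and Vdisj: "({2..2*m+1} \<times> {1..m}) \<inter> ({m+3..2*m+1} \<times> {m+1}) = {}"
    and Xdisj: "({1..2*m+1} \<times> {1..m}) \<inter> ({m+2..2*m+1} \<times> {m+1}) = {}"
    using assms by auto
  have fin: "finite ({1..2*m+1} \<times> {1..m} \<union> {m+2..2*m+1} \<times> {m+1})" by simp
  have split: "prod g ({1..2*m+1} \<times> {1..m} \<union> {m+2..2*m+1} \<times> {m+1}) =
      prod g ({1..2*m+1} \<times> {1..m}) * prod g ({m+2..2*m+1} \<times> {m+1})" for g :: "nat \<times> nat \<Rightarrow> complex"
    using Xdisj by (intro prod.union_disjoint) auto
  have sets: "?V = Pow ({2..2*m+1} \<times> {1..m})" "?W = Pow ({m+3..2*m+1} \<times> {m+1})"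
    "?H = Pow ({1..2*m+1} \<times> {1..<m})"
    by (auto simp: numeral_2_eq_2 numeral_3_eq_3)
  have "ZHTodd_gen a m x y (\<lambda>H V. ((m + 1, m) \<in> H) = s) =
    (\<Sum>H\<in>?H. \<Sum>D\<in>?D. \<Sum>V\<in>?V. \<Sum>W\<in>?W. of_bool ((Suc m \<in> D) = s) * (?w D H V * ?c D {} W))"
    unfolding ZHTodd_gen_def state_sum_eq[OF fin] sets
    unfolding HE sum_Pow_disjoint_union[OF Hdisj] sum_Pow_disjoint_union[OF Vdisj]
      sum_Pow_times_singleton[where I = "{1..2*m+1}" and j = m]
    unfolding HE[symmetric]
  proof (intro sum.cong refl, goal_cases)
    case 1
    then show ?case by simp
  next
    case (2 H D V W)
    have H: "(i, j) \<notin> H" if "j \<ge> m" for i j using 2(1) that by auto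
    have V: "(i, j) \<notin> V" if "j > m" for i j using 2(3) that by auto
    have W: "(i, j) \<notin> W" if "j \<le> m" for i j using 2(4) that by auto
    have J: "j - Suc 0 \<noteq> m" "j - Suc 0 \<noteq> Suc m" if "j \<le> m" for j using that assms by auto
    show ?case
      unfolding split
      using H V W J
      by (intro arg_cong2[where f = "(*)"] prod.cong) auto
  qed
  also have "\<dots> = (\<Sum>D\<in>?D. of_bool ((Suc m \<in> D) = s) * ((\<Sum>H\<in>?H. \<Sum>V\<in>?V. ?w D H V) * (\<Sum>W\<in>?W. ?c D {} W)))"
    by (rule trans[OF sum.swap]) (simp only: sum_distrib_left[symmetric] sum_distrib_right[symmetric])
  also have "\<dots> = (\<Sum>D\<in>?D. ?f (map (\<lambda>j. j \<in> D) [Suc 0..<Suc (0 + ?n)]))"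
  proof (rule sum.cong[OF refl])
    fix D
    let ?ds = "map (\<lambda>j. j \<in> D) [Suc 0..<Suc (0 + ?n)]"
    have ds: "?ds = map (\<lambda>j. j \<in> D) [1..<Suc m] @ (Suc m \<in> D) #
        map (\<lambda>j. j \<in> D) [Suc (Suc m)..<Suc (Suc m + m)]"
      using map_upt_odd[of "\<lambda>j. j \<in> D" m] by simp
    have "params ?x ?n = ?xs @ x (Suc m) # rev ?xs"
      unfolding map_upt_odd map_reflect[of x "Suc m" m, symmetric]
      by (intro arg_cong2[where f = "(@)"] arg_cong2[where f = "(#)"] map_cong refl arg_cong[where f = x]) auto
    then have g1: "(\<Sum>H\<in>?H. \<Sum>V\<in>?V. ?w D H V) = grid (?xs @ x (Suc m) # rev ?xs) ?ys (tops ?xs @ True # tops ?xs)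
        ?ds (tops ?ys) (replicate (length ?ys) False)"
      using assms by (subst sum_rectangle)
        (simp_all add: map_replicate_const replicate_app_Cons_same replicate_add[symmetric] mult_2 del: upt_Suc)
    have "map ?x [Suc (Suc m)..<Suc (Suc m + m)] = rev ?xs"
      "map (\<lambda>i. 2 * m + 2 - i \<notin> D) [Suc (Suc m)..<Suc (Suc m + m)] = rev (map Not (map (\<lambda>j. j \<in> D) [1..<Suc m]))"
      unfolding map_map comp_def map_reflect[of _ "Suc m" m, symmetric]
      by (intro map_cong refl arg_cong[where f = x]; auto simp: mult_2)+
    \<comment> \<open>A single column has no inner horizontal edges, so the sum over them is one
      term.\<close>
    moreover have "(\<Sum>H\<in>Pow ({Suc (Suc m)..Suc m + m} \<times> {Suc m..<m + 1}). F H) = F {}"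
      for F :: "(nat \<times> nat) set \<Rightarrow> complex"
      by simp
    note this[of "\<lambda>H. \<Sum>W\<in>?W. ?c D H W"]
    moreover have "drop (Suc m) ?ds = map (\<lambda>j. j \<in> D) [Suc (Suc m)..<Suc (Suc m + m)]"
      "take m ?ds = map (\<lambda>j. j \<in> D) [1..<Suc m]" "?ds ! m \<longleftrightarrow> Suc m \<in> D" "[Suc m..<Suc (m + 1)] = [Suc m]"
      unfolding ds by (simp_all add: nth_append del: upt_Suc) simp
    ultimately have g2: "(\<Sum>W\<in>?W. ?c D {} W) = grid (rev ?xs) [y (Suc m)] (drop (Suc m) ?ds)
        (rev (map Not (take m ?ds))) [\<not> ?ds ! m] [False]"
      using sum_rectangle[where p = "Suc m" and n = m and c = m and k = 1 and x = ?x and y = y and l = "\<lambda>i. i \<in> D"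
          and r = "\<lambda>i. 2 * m + 2 - i \<notin> D" and t = "\<lambda>_. Suc m \<notin> D" and b = "\<lambda>_. False", OF assms order_refl]
      by (simp only: list.map)
    show "of_bool ((Suc m \<in> D) = s) * ((\<Sum>H\<in>?H. \<Sum>V\<in>?V. ?w D H V) * (\<Sum>W\<in>?W. ?c D {} W)) = ?f ?ds"
      unfolding g1 g2 by (simp add: ds nth_append del: upt_Suc)
  qed
  also have "\<dots> = (\<Sum>ds\<in>bool_lists (m + Suc m). ?f ds)"
    by (subst sum_Pow_bool_lists) (simp add: mult_2)
  also have "\<dots> = odd_turn s ?xs (x (Suc m)) ?ys (y (Suc m))"
    unfolding sum_bool_lists_append sum_bool_lists_Suc
    by (subst odd_turn_eq_grid, simp, intro sum.cong)
      (cases s; simp add: UNIV_bool bool_lists_def nth_append del: upt_Suc)+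
  finally show ?thesis .
qed


text \<open>Under top edges pointing up, a row with inward ends needs a vertex of type 1 to reverse
  its horizontal edges. Hence a nonzero domain-wall function forces \<open>sigma (a^2)\<close> to be
  nonzero, which is the condition on \<open>a^4\<close>.\<close>

lemma Zdw_eq_0:
  assumes "sigma (a\<^sup>2) = 0"
  shows "Zdw a (Suc n) x y = 0"
proof -
  have nz: "row x ys True False (tops ys) qs = 0" if "length qs = length ys" for x ys qs
    using that
  proof (induction ys arbitrary: qs)
    case (Cons y ys)
    then obtain q qs' where "qs = q # qs'" by (cases qs) auto
    then show ?case using Cons assms by (simp add: UNIV_bool vwt_def)
  qed simp
  have "domain_wall (z # zs) ys = 0" for z zs ys
    unfolding domain_wall_def psi_Cons by (intro sum.neutral) (auto simp: nz bool_lists_def)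
  moreover have "params x (Suc n) = x 1 # map x [Suc 1..<Suc (Suc n)]"
    by (simp add: upt_conv_Cons del: upt_Suc)
  ultimately show ?thesis
    unfolding Zdw_eq by simp
qed

end

section \<open>Solving the two relations for the odd partition functions\<close>

lemma sigma_mult_sigma:
  fixes a w :: complex
  assumes "a \<noteq> 0" "w \<noteq> 0"
  shows "sigma (a * w) * sigma (a * inverse w) = (a + inverse a)\<^sup>2 - (w + inverse w)\<^sup>2"
  using assms by (simp add: sigma_def field_simps power2_eq_square)

theorem theorem2:
  fixes a :: complex and m :: nat and x y :: "nat \<Rightarrow> complex"
  assumes "a \<noteq> 0"
    and "\<forall>i\<in>{1..m+1}. x i \<noteq> 0" and "\<forall>j\<in>{1..m+1}. y j \<noteq> 0"
    and "Zdw a m x y \<noteq> 0" and "Zdw a (m+1) x y \<noteq> 0"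
    and "sigma a * sigma (a * x (m+1) * inverse (y (m+1)))
           * sigma (a * inverse (x (m+1)) * y (m+1)) \<noteq> 0"
  shows "(ZHTp a m x y =
           ((a + inverse a) * Zdw a (m+1) x y * ZHT2 a m x y
            - (x (m+1) * inverse (y (m+1)) + inverse (x (m+1)) * y (m+1))
                * Zdw a m x y * ZHT2 a (m+1) x y)
           / (sigma a * sigma (a * x (m+1) * inverse (y (m+1)))
                * sigma (a * inverse (x (m+1)) * y (m+1))))
         \<and> (ZHTm a m x y =
           (- (x (m+1) * inverse (y (m+1)) + inverse (x (m+1)) * y (m+1))
                * Zdw a (m+1) x y * ZHT2 a m x y
            + (a + inverse a) * Zdw a m x y * ZHT2 a (m+1) x y)
           / (sigma a * sigma (a * x (m+1) * inverse (y (m+1)))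
                * sigma (a * inverse (x (m+1)) * y (m+1))))"
proof -
  interpret six_vertex a by unfold_locales fact
  let ?xs = "params x m" and ?ys = "params y m" and ?x = "x (m+1)" and ?y = "y (m+1)"
  define A where "A = a + inverse a"
  define B where "B = ?x * inverse ?y + inverse ?x * ?y"
  define D where "D = sigma a * sigma (a * ?x * inverse ?y) * sigma (a * inverse ?x * ?y)"
  have xy: "?x \<noteq> 0" "?y \<noteq> 0" using assms(2,3) by auto
  have "sigma (a\<^sup>2) \<noteq> 0" using assms(5) Zdw_eq_0[of m x y] by auto
  then have a4: "a ^ 4 \<noteq> 1"
    using sigma_eq_0_iff[of "a\<^sup>2"] assms(1) by (simp add: power_mult[symmetric])
  have params: "params x (m+1) = ?xs @ [?x]" "params y (m+1) = ?ys @ [?y]" by simp_all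
  have "0 \<notin> set (?xs @ [?x] @ ?ys @ [?y])" using assms(2,3) by auto
  from odd_rel_all[OF a4 _ this]
  have rel: "odd_rel ?xs ?x ?ys ?y" "odd_rel' ?xs ?x ?ys ?y" by simp_all
  have p: "ZHTp a m x y = odd_turn True ?xs ?x ?ys ?y"
  proof (cases "m = 0")
    case True
    then show ?thesis by (simp add: ZHTp_def odd_turn_def)
  next
    case False
    then show ?thesis using ZHTodd_gen_eq[of m x y True] by (simp add: ZHTp_def)
  qed
  have m: "ZHTm a m x y = odd_turn False ?xs ?x ?ys ?y"
  proof (cases "m = 0")
    case True
    then show ?thesis by (simp add: ZHTm_def odd_turn_def)
  next
    case False
    then show ?thesis using ZHTodd_gen_eq[of m x y False] by (simp add: ZHTm_def)
  qed
  have P: "Zdw a (m+1) x y * ZHT2 a m x y = sigma a * (A * ZHTp a m x y + B * ZHTm a m x y)"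
    using rel(1) assms(4) unfolding odd_rel_def p m ZHT2_def ZHT_eq Zdw_eq params A_def B_def
    by (simp add: field_simps)
  have Q: "Zdw a m x y * ZHT2 a (m+1) x y = sigma a * (B * ZHTp a m x y + A * ZHTm a m x y)"
    using rel(2) assms(5) unfolding odd_rel'_def p m ZHT2_def ZHT_eq Zdw_eq params A_def B_def
    by (simp add: field_simps)
  \<comment> \<open>\<open>P\<close> and \<open>Q\<close> form a linear system with matrix
    \<open>sigma a\<close> times the rows \<open>(A, B)\<close> and \<open>(B, A)\<close>;
    \<open>D\<close> is its determinant divided by \<open>sigma a\<close>.\<close>
  have D: "D = sigma a * (A\<^sup>2 - B\<^sup>2)"
    using sigma_mult_sigma[of a "?x * inverse ?y"] assms(1) xy
    by (simp add: D_def A_def B_def mult.assoc)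
  have "D \<noteq> 0" using assms(6) by (simp add: D_def)
  have "ZHTp a m x y * D = A * (Zdw a (m+1) x y * ZHT2 a m x y) - B * (Zdw a m x y * ZHT2 a (m+1) x y)"
    "ZHTm a m x y * D = - B * (Zdw a (m+1) x y * ZHT2 a m x y) + A * (Zdw a m x y * ZHT2 a (m+1) x y)"
    unfolding P Q D by (simp_all add: algebra_simps power2_eq_square)
  then show ?thesis
    using \<open>D \<noteq> 0\<close> unfolding A_def B_def D_def[symmetric]
    by (simp add: eq_divide_eq mult.assoc)
qed

end
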